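(* Let $u\in H^1_0(\Omega)$ be the weak solution, $\sigma=Af_2-A\nabla u$ the flux, $(\sigma_h,u_h)\in RT_k\times S_{k+1,0}$ the least-squares finite element solution, and set $E=\sigma-\sigma_h$, $e=u-u_h$. Define, for each $K\in\mathcal{T}$, $$\eta_K^2=\|A^{-1/2}\sigma_h+A^{1/2}\nabla u_h-A^{1/2}f_2\|_{0,K}^2+\|\nabla\cdot\sigma_h+Xu_h-f_1\|_{0,K}^2,\qquad \eta^2=\sum_{K\in\mathcal{T}}\eta_K^2 .$$ Then the error estimator $\eta$ is reliable and efficient: there exist constants $C_1,C_2>0$, independent of the mesh $\mathcal{T}$ and of $f_1,f_2$, such that $$C_1\left(\|E\|_0^2+\|\nabla\cdot E\|_0^2+\|\nabla e\|_0^2\right)\le\eta^2\le C_2\left(\|E\|_0^2+\|\nabla\cdot E\|_0^2+\|\nabla e\|_0^2\right).$$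
   Context: Domain and coefficients: $\Omega\subset\mathbb{R}^d$ ($d=2$ or $3$) is bounded, open and connected with Lipschitz boundary, and is exactly triangulated by the simplicial mesh below. $A\in L^\infty(\Omega)^{d\times d}$ is symmetric with $\Lambda_0y^Ty\le y^TA(x)y\le\Lambda_1y^Ty$ for all $y\in\mathbb{R}^d$, a.e. $x\in\Omega$, for constants $0<\Lambda_0\le\Lambda_1$; $b\in L^\infty(\Omega)^d$, $c\in L^\infty(\Omega)$. $(\cdot,\cdot)$, $\|\cdot\|_0$ denote the $L^2(\Omega)$ (or $L^2(\Omega)^d$) inner product and norm, and $\|\cdot\|_{0,K}$ the $L^2(K)$ norm. Write $Xv=b\cdot\nabla v+cv$. Uniqueness assumption: the only $w\in H^1_0(\Omega)$ with $(A\nabla w,\nabla v)+(Xw,v)=0$ for all $v\in H^1_0(\Omega)$ is $w=0$. Continuous problem: given $f_1\in L^2(\Omega)$ and $f_2\in L^2(\Omega)^d$, $u\in H^1_0(\Omega)$ is the solution of $(A\nabla u,\nabla v)+(Xu,v)=(f_1,v)+(Af_2,\nabla v)$ for all $v\in H^1_0(\Omega)$. The flux $\sigma=Af_2-A\nabla u$ lies in $H(\mathrm{div};\Omega)=\{\tau\in L^2(\Omega)^d:\nabla\cdot\tau\in L^2(\Omega)\}$, with $\nabla\cdot\sigma=f_1-Xu$. Mesh and finite element spaces: $\mathcal{T}$ is a regular (shape-regular, conforming) triangulation of $\Omega$ into simplices $K$. $k\ge0$ is an integer and $P_k(K)$ is the space of polynomials on $K$ of degree at most $k$. $RT_k=\{\tau\in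 H(\mathrm{div};\Omega):\tau|_K\in P_k(K)^d+xP_k(K)\ \forall K\in\mathcal{T}\}$, and $S_{k+1,0}=\{v\in C^0(\Omega):v|_K\in P_{k+1}(K)\ \forall K\in\mathcal{T}\}\cap H^1_0(\Omega)$. Discrete problem: $(\sigma_h,u_h)\in RT_k\times S_{k+1,0}$ satisfies $$(\sigma_h+A\nabla u_h,A^{-1}\tau+\nabla v)+(\nabla\cdot\sigma_h+Xu_h,\nabla\cdot\tau+Xv)=(Af_2,A^{-1}\tau+\nabla v)+(f_1,\nabla\cdot\tau+Xv)$$ for all $(\tau,v)\in RT_k\times S_{k+1,0}$. *)

theory Defs
  imports "HOL-Analysis.Analysis"
begin

text \<open>
  Elements of the spaces below are honest functions on the ambient space; only their values on
  the given set, up to null sets, matter.  The same definitions serve scalar, vector and matrix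
  fields.
\<close>

definition L2 :: "(real^'d) set \<Rightarrow> (real^'d \<Rightarrow> 'a::euclidean_space) set" where
  "L2 S = {f. f \<in> borel_measurable (lebesgue_on S) \<and>
              integrable (lebesgue_on S) (\<lambda>x. (norm (f x))^2)}"

definition L2_inner :: "(real^'d) set \<Rightarrow> (real^'d \<Rightarrow> 'a::euclidean_space) \<Rightarrow> (real^'d \<Rightarrow> 'a) \<Rightarrow> real" where
  "L2_inner S f g = (LINT x|lebesgue_on S. f x \<bullet> g x)"

definition L2_norm :: "(real^'d) set \<Rightarrow> (real^'d \<Rightarrow> 'a::euclidean_space) \<Rightarrow> real" where
  "L2_norm S f = sqrt (LINT x|lebesgue_on S. (norm (f x))^2)"

definition Linf :: "(real^'d) set \<Rightarrow> (real^'d \<Rightarrow> 'a::euclidean_space) set" where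
  "Linf S = {f. f \<in> borel_measurable (lebesgue_on S) \<and>
                (\<exists>M. AE x in lebesgue_on S. norm (f x) \<le> M)}"

definition partial_deriv :: "'d \<Rightarrow> (real^'d \<Rightarrow> real) \<Rightarrow> real^'d \<Rightarrow> real" where
  "partial_deriv i f x = frechet_derivative f (at x) (axis i 1)"

definition gradient :: "(real^'d \<Rightarrow> real) \<Rightarrow> real^'d \<Rightarrow> real^'d" where
  "gradient f x = (\<chi> i. partial_deriv i f x)"

primrec Ck :: "nat \<Rightarrow> (real^'d \<Rightarrow> real) \<Rightarrow> bool" where
  "Ck 0 f \<longleftrightarrow> continuous_on UNIV f"
| "Ck (Suc n) f \<longleftrightarrow> (\<forall>x. f differentiable (at x)) \<and> (\<forall>i. Ck n (partial_deriv i f))"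

definition test_functions :: "(real^'d) set \<Rightarrow> (real^'d \<Rightarrow> real) set" where
  "test_functions \<Omega> = {\<phi>. (\<forall>n. Ck n \<phi>) \<and>
     compact (closure {x. \<phi> x \<noteq> 0}) \<and> closure {x. \<phi> x \<noteq> 0} \<subseteq> \<Omega>}"

definition is_weak_grad :: "(real^'d) set \<Rightarrow> (real^'d \<Rightarrow> real) \<Rightarrow> (real^'d \<Rightarrow> real^'d) \<Rightarrow> bool" where
  "is_weak_grad \<Omega> v g \<longleftrightarrow> g \<in> L2 \<Omega> \<and>
     (\<forall>\<phi>\<in>test_functions \<Omega>. \<forall>i. L2_inner \<Omega> v (partial_deriv i \<phi>) = - L2_inner \<Omega> (\<lambda>x. g x $ i) \<phi>)"

text \<open>
  Weak derivatives are unique only almost everywhere, so the operators below select some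
  representative; they are meaningful only on functions having a weak derivative in \<open>L2\<close>.
\<close>

definition weak_grad :: "(real^'d) set \<Rightarrow> (real^'d \<Rightarrow> real) \<Rightarrow> real^'d \<Rightarrow> real^'d" where
  "weak_grad \<Omega> v = (SOME g. is_weak_grad \<Omega> v g)"

definition is_weak_div :: "(real^'d) set \<Rightarrow> (real^'d \<Rightarrow> real^'d) \<Rightarrow> (real^'d \<Rightarrow> real) \<Rightarrow> bool" where
  "is_weak_div \<Omega> \<tau> g \<longleftrightarrow> g \<in> L2 \<Omega> \<and>
     (\<forall>\<phi>\<in>test_functions \<Omega>. L2_inner \<Omega> \<tau> (gradient \<phi>) = - L2_inner \<Omega> g \<phi>)"

definition weak_div :: "(real^'d) set \<Rightarrow> (real^'d \<Rightarrow> real^'d) \<Rightarrow> real^'d \<Rightarrow> real" where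
  "weak_div \<Omega> \<tau> = (SOME g. is_weak_div \<Omega> \<tau> g)"

definition H1 :: "(real^'d) set \<Rightarrow> (real^'d \<Rightarrow> real) set" where
  "H1 \<Omega> = {v \<in> L2 \<Omega>. \<exists>g. is_weak_grad \<Omega> v g}"

definition H1_norm :: "(real^'d) set \<Rightarrow> (real^'d \<Rightarrow> real) \<Rightarrow> real" where
  "H1_norm \<Omega> v = sqrt ((L2_norm \<Omega> v)^2 + (L2_norm \<Omega> (weak_grad \<Omega> v))^2)"

definition H10 :: "(real^'d) set \<Rightarrow> (real^'d \<Rightarrow> real) set" where
  "H10 \<Omega> = {v \<in> H1 \<Omega>. \<forall>\<epsilon>>0. \<exists>\<phi>\<in>test_functions \<Omega>. H1_norm \<Omega> (\<lambda>x. v x - \<phi> x) < \<epsilon>}"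

definition Hdiv :: "(real^'d) set \<Rightarrow> (real^'d \<Rightarrow> real^'d) set" where
  "Hdiv \<Omega> = {\<tau> \<in> L2 \<Omega>. \<exists>g. is_weak_div \<Omega> \<tau> g}"

text \<open>
  Near each boundary point, \<open>\<Omega>\<close> lies on one side of the graph of a Lipschitz function over the
  hyperplane orthogonal to a unit vector \<open>n\<close>: \<open>n \<bullet> x\<close> is the vertical coordinate of \<open>x\<close> and
  \<open>x - (n \<bullet> x) *\<^sub>R n\<close> its horizontal part.
\<close>

definition lipschitz_boundary :: "(real^'d) set \<Rightarrow> bool" where
  "lipschitz_boundary \<Omega> \<longleftrightarrow>
     (\<forall>p\<in>frontier \<Omega>. \<exists>r>0. \<exists>n L. \<exists>\<gamma> :: real^'d \<Rightarrow> real.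
        norm n = 1 \<and> L-lipschitz_on {y. n \<bullet> y = 0} \<gamma> \<and>
        \<Omega> \<inter> ball p r = {x \<in> ball p r. \<gamma> (x - (n \<bullet> x) *\<^sub>R n) < n \<bullet> x})"

definition inradius :: "(real^'d) set \<Rightarrow> real" where
  "inradius K = Sup {r. 0 \<le> r \<and> (\<exists>x. cball x r \<subseteq> K)}"

text \<open>
  \<open>triangulation\<close> is the library notion: a finite set of simplices, any two of which meet in a
  common (possibly empty) face.
\<close>

definition regular_mesh :: "real \<Rightarrow> (real^'d) set \<Rightarrow> (real^'d) set set \<Rightarrow> bool" where
  "regular_mesh \<kappa> \<Omega> \<T> \<longleftrightarrow> triangulation \<T> \<and> (\<forall>K\<in>\<T>. int CARD('d) simplex K) \<and>
     \<Union>\<T> = closure \<Omega> \<and> (\<forall>K\<in>\<T>. diameter K \<le> \<kappa> * inradius K)"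

definition polys :: "nat \<Rightarrow> (real^'d \<Rightarrow> real) set" where
  "polys k = {p. \<exists>a :: ('d \<Rightarrow> nat) \<Rightarrow> real.
     p = (\<lambda>x. \<Sum>\<alpha> | (\<Sum>i\<in>UNIV. \<alpha> i) \<le> k. a \<alpha> * (\<Prod>i\<in>UNIV. (x $ i) ^ \<alpha> i))}"

text \<open>
  Raviart--Thomas fields have discontinuous tangential components across faces, so the
  elementwise condition must be read almost everywhere on the closed simplices.
\<close>

definition RT :: "nat \<Rightarrow> (real^'d) set \<Rightarrow> (real^'d) set set \<Rightarrow> (real^'d \<Rightarrow> real^'d) set" where
  "RT k \<Omega> \<T> = {\<tau> \<in> Hdiv \<Omega>. \<forall>K\<in>\<T>. \<exists>q p. (\<forall>i. (\<lambda>x. q x $ i) \<in> polys k) \<and> p \<in> polys k \<and>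
     (AE x in lebesgue_on K. \<tau> x = q x + p x *\<^sub>R x)}"

definition S0 :: "nat \<Rightarrow> (real^'d) set \<Rightarrow> (real^'d) set set \<Rightarrow> (real^'d \<Rightarrow> real) set" where
  "S0 m \<Omega> \<T> = {v \<in> H10 \<Omega>. continuous_on \<Omega> v \<and>
     (\<forall>K\<in>\<T>. \<exists>p\<in>polys m. \<forall>x\<in>K \<inter> \<Omega>. v x = p x)}"

definition mat_sqrt :: "real^'d^'d \<Rightarrow> real^'d^'d" where
  "mat_sqrt M = (THE B. transpose B = B \<and> (\<forall>y. 0 \<le> y \<bullet> (B *v y)) \<and> B ** B = M)"

definition Xop :: "(real^'d) set \<Rightarrow> (real^'d \<Rightarrow> real^'d) \<Rightarrow> (real^'d \<Rightarrow> real) \<Rightarrow>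
    (real^'d \<Rightarrow> real) \<Rightarrow> real^'d \<Rightarrow> real" where
  "Xop \<Omega> b c v x = b x \<bullet> weak_grad \<Omega> v x + c x * v x"

definition uniqueness :: "(real^'d) set \<Rightarrow> (real^'d \<Rightarrow> real^'d^'d) \<Rightarrow> (real^'d \<Rightarrow> real^'d) \<Rightarrow>
    (real^'d \<Rightarrow> real) \<Rightarrow> bool" where
  "uniqueness \<Omega> A b c \<longleftrightarrow> (\<forall>w\<in>H10 \<Omega>.
     (\<forall>v\<in>H10 \<Omega>. L2_inner \<Omega> (\<lambda>x. A x *v weak_grad \<Omega> w x) (weak_grad \<Omega> v)
                 + L2_inner \<Omega> (Xop \<Omega> b c w) v = 0)
     \<longrightarrow> (AE x in lebesgue_on \<Omega>. w x = 0))"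

definition weak_solution :: "(real^'d) set \<Rightarrow> (real^'d \<Rightarrow> real^'d^'d) \<Rightarrow> (real^'d \<Rightarrow> real^'d) \<Rightarrow>
    (real^'d \<Rightarrow> real) \<Rightarrow> (real^'d \<Rightarrow> real) \<Rightarrow> (real^'d \<Rightarrow> real^'d) \<Rightarrow> (real^'d \<Rightarrow> real) \<Rightarrow> bool" where
  "weak_solution \<Omega> A b c f1 f2 u \<longleftrightarrow> u \<in> H10 \<Omega> \<and>
     (\<forall>v\<in>H10 \<Omega>. L2_inner \<Omega> (\<lambda>x. A x *v weak_grad \<Omega> u x) (weak_grad \<Omega> v)
                 + L2_inner \<Omega> (Xop \<Omega> b c u) v
               = L2_inner \<Omega> f1 v + L2_inner \<Omega> (\<lambda>x. A x *v f2 x) (weak_grad \<Omega> v))"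

definition least_squares_solution :: "nat \<Rightarrow> (real^'d) set \<Rightarrow> (real^'d) set set \<Rightarrow>
    (real^'d \<Rightarrow> real^'d^'d) \<Rightarrow> (real^'d \<Rightarrow> real^'d) \<Rightarrow> (real^'d \<Rightarrow> real) \<Rightarrow>
    (real^'d \<Rightarrow> real) \<Rightarrow> (real^'d \<Rightarrow> real^'d) \<Rightarrow> (real^'d \<Rightarrow> real^'d) \<Rightarrow> (real^'d \<Rightarrow> real) \<Rightarrow> bool" where
  "least_squares_solution k \<Omega> \<T> A b c f1 f2 \<sigma>h uh \<longleftrightarrow>
     \<sigma>h \<in> RT k \<Omega> \<T> \<and> uh \<in> S0 (k + 1) \<Omega> \<T> \<and>
     (\<forall>\<tau>\<in>RT k \<Omega> \<T>. \<forall>v\<in>S0 (k + 1) \<Omega> \<T>.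
        L2_inner \<Omega> (\<lambda>x. \<sigma>h x + A x *v weak_grad \<Omega> uh x)
                   (\<lambda>x. matrix_inv (A x) *v \<tau> x + weak_grad \<Omega> v x)
        + L2_inner \<Omega> (\<lambda>x. weak_div \<Omega> \<sigma>h x + Xop \<Omega> b c uh x)
                     (\<lambda>x. weak_div \<Omega> \<tau> x + Xop \<Omega> b c v x)
        = L2_inner \<Omega> (\<lambda>x. A x *v f2 x)
                     (\<lambda>x. matrix_inv (A x) *v \<tau> x + weak_grad \<Omega> v x)
        + L2_inner \<Omega> f1 (\<lambda>x. weak_div \<Omega> \<tau> x + Xop \<Omega> b c v x))"

definition flux :: "(real^'d) set \<Rightarrow> (real^'d \<Rightarrow> real^'d^'d) \<Rightarrow> (real^'d \<Rightarrow> real^'d) \<Rightarrow>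
    (real^'d \<Rightarrow> real) \<Rightarrow> real^'d \<Rightarrow> real^'d" where
  "flux \<Omega> A f2 u x = A x *v f2 x - A x *v weak_grad \<Omega> u x"

definition local_estimator :: "(real^'d) set \<Rightarrow>
    (real^'d \<Rightarrow> real^'d^'d) \<Rightarrow> (real^'d \<Rightarrow> real^'d) \<Rightarrow> (real^'d \<Rightarrow> real) \<Rightarrow>
    (real^'d \<Rightarrow> real) \<Rightarrow> (real^'d \<Rightarrow> real^'d) \<Rightarrow> (real^'d \<Rightarrow> real^'d) \<Rightarrow> (real^'d \<Rightarrow> real) \<Rightarrow>
    (real^'d) set \<Rightarrow> real" where
  "local_estimator \<Omega> A b c f1 f2 \<sigma>h uh K = sqrt (
     (L2_norm K (\<lambda>x. matrix_inv (mat_sqrt (A x)) *v \<sigma>h x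
                     + mat_sqrt (A x) *v weak_grad \<Omega> uh x - mat_sqrt (A x) *v f2 x))^2
     + (L2_norm K (\<lambda>x. weak_div \<Omega> \<sigma>h x + Xop \<Omega> b c uh x - f1 x))^2)"

definition estimator :: "(real^'d) set \<Rightarrow> (real^'d) set set \<Rightarrow>
    (real^'d \<Rightarrow> real^'d^'d) \<Rightarrow> (real^'d \<Rightarrow> real^'d) \<Rightarrow> (real^'d \<Rightarrow> real) \<Rightarrow>
    (real^'d \<Rightarrow> real) \<Rightarrow> (real^'d \<Rightarrow> real^'d) \<Rightarrow> (real^'d \<Rightarrow> real^'d) \<Rightarrow> (real^'d \<Rightarrow> real) \<Rightarrow> real" where
  "estimator \<Omega> \<T> A b c f1 f2 \<sigma>h uh =
     sqrt (\<Sum>K\<in>\<T>. (local_estimator \<Omega> A b c f1 f2 \<sigma>h uh K)^2)"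

end

theory Submission
  imports Defs
begin

text \<open>
  Write \<open>E = \<sigma> - \<sigma>\<^sub>h\<close>, \<open>e = u - u\<^sub>h\<close>, \<open>r\<^sub>1 = E + A \<nabla>e\<close> and \<open>r\<^sub>2 = div E + Xe\<close>.  The exact pair \<open>(\<sigma>, u)\<close>
  makes both least-squares residuals vanish, so up to sign the residuals that enter the estimator
  are \<open>A\<^sup>-\<^sup>1\<^sup>/\<^sup>2 r\<^sub>1\<close> and \<open>r\<^sub>2\<close>.  The simplices overlap in null sets and fill the closure of the domain,
  whose frontier is null because it is locally a Lipschitz graph (\<open>mesh_integral\<close>).  Hence the
  squared estimator is comparable to \<open>\<parallel>r\<^sub>1\<parallel>\<^sup>2 + \<parallel>r\<^sub>2\<parallel>\<^sup>2\<close> with constants depending on the ellipticity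
  bounds only (\<open>estimator_sq\<close>).  The discrete pair is conforming, that is \<open>\<sigma>\<^sub>h \<in> H(div)\<close> and
  \<open>u\<^sub>h \<in> H10\<close>, so the error \<open>(E, e)\<close> lies in the continuous spaces and can be estimated there, with
  constants that do not see the mesh.

  Efficiency is the triangle inequality together with the Poincare inequality.  For reliability,
  integration by parts of \<open>E\<close> against \<open>v \<in> H10\<close> gives
  \<open>(A \<nabla>e, \<nabla>v) + (Xe, v) = (r\<^sub>1, \<nabla>v) + (r\<^sub>2, v)\<close>, so \<open>e\<close> solves the weak problem with a right-hand side of
  dual norm at most a multiple of \<open>\<parallel>r\<^sub>1\<parallel> + \<parallel>r\<^sub>2\<parallel>\<close>.  What is needed is therefore the a priori bound of
  \<open>\<nabla>e\<close> by this dual norm (\<open>stability\<close>); then \<open>E = r\<^sub>1 - A \<nabla>e\<close> and \<open>div E = r\<^sub>2 - Xe\<close> are bounded too.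

  The form need not be coercive, so stability has to come from uniqueness by compactness.  For every
  \<open>\<epsilon> > 0\<close> there are finitely many functionals with
  \<open>\<parallel>v\<parallel>\<^sup>2 \<le> \<epsilon> \<parallel>\<nabla>v\<parallel>\<^sup>2 + C \<Sum>\<^sub>j (v, q\<^sub>j)\<^sup>2\<close> on \<open>H10\<close> (\<open>H10_compactness\<close>); the \<open>q\<^sub>j\<close> are indicators of the cubes of a
  fine grid.  With Garding's inequality this makes the form coercive up to a finite-rank term.
  If stability failed, a sequence \<open>w\<^sub>n\<close> with \<open>\<parallel>\<nabla>w\<^sub>n\<parallel> = 1\<close> would have functionals \<open>a(w\<^sub>n, \<cdot>)\<close> tending to zero;
  after passing to a subsequence along which the finitely many numbers \<open>(w\<^sub>n, q\<^sub>j)\<close> converge,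
  \<open>\<nabla>w\<^sub>n\<close> is Cauchy in norm, and the limit would be a nonzero solution of the homogeneous
  problem.

  Integration by parts and the estimates on \<open>H10\<close> rest on two facts on smooth functions of compact support.  Difference
  quotients have integral zero by translation invariance, and passing to the limit yields
  integration by parts; and their norms satisfy
  \<open>\<parallel>\<phi>(\<cdot> + v) - \<phi>\<parallel> \<le> |v| \<parallel>\<nabla>\<phi>\<parallel>\<close> (\<open>C1c_translation_bound\<close>).  The latter yields the Poincare inequality, by
  translating \<open>\<phi>\<close> off its support, and the estimate on the cubes.
\<close>

section \<open>Algebra of L2\<close>

lemma L2_measurable: "f \<in> L2 S \<Longrightarrow> f \<in> borel_measurable (lebesgue_on S)"
  and L2_integrable_sq: "f \<in> L2 S \<Longrightarrow> integrable (lebesgue_on S) (\<lambda>x. (norm (f x))^2)"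
  by (auto simp: L2_def)

lemma L2_integrable_inner:
  assumes "f \<in> L2 S" "g \<in> L2 S"
  shows "integrable (lebesgue_on S) (\<lambda>x. f x \<bullet> g x)"
proof (rule Bochner_Integration.integrable_bound)
  show "integrable (lebesgue_on S) (\<lambda>x. (norm (f x))^2 + (norm (g x))^2)"
    by (intro Bochner_Integration.integrable_add L2_integrable_sq assms)
  show "(\<lambda>x. f x \<bullet> g x) \<in> borel_measurable (lebesgue_on S)"
    by (intro borel_measurable_inner L2_measurable assms)
  have "\<bar>f x \<bullet> g x\<bar> \<le> (norm (f x))\<^sup>2 + (norm (g x))\<^sup>2" for x
  proof -
    have "\<bar>f x \<bullet> g x\<bar> \<le> norm (f x) * norm (g x)" by (rule Cauchy_Schwarz_ineq2)
    also have "\<dots> \<le> (norm (f x))\<^sup>2 + (norm (g x))\<^sup>2"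
      using sum_squares_bound[of "norm (f x)" "norm (g x)"]
        mult_nonneg_nonneg[OF norm_ge_zero[of "f x"] norm_ge_zero[of "g x"]] by linarith
    finally show ?thesis .
  qed
  then show "AE x in lebesgue_on S. norm (f x \<bullet> g x) \<le> norm ((norm (f x))\<^sup>2 + (norm (g x))\<^sup>2)"
    by (auto intro!: AE_I2 order_trans[OF _ abs_ge_self])
qed

lemma L2_scaleR: "f \<in> L2 S \<Longrightarrow> (\<lambda>x. r *\<^sub>R f x) \<in> L2 S"
  by (auto simp: L2_def power_mult_distrib)

lemma L2_add:
  assumes "f \<in> L2 S" "g \<in> L2 S"
  shows "(\<lambda>x. f x + g x) \<in> L2 S"
proof -
  have "(norm (f x + g x))\<^sup>2 = (norm (f x))\<^sup>2 + 2 * (f x \<bullet> g x) + (norm (g x))\<^sup>2" for x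
    by (simp add: power2_norm_eq_inner inner_add inner_commute)
  then have "integrable (lebesgue_on S) (\<lambda>x. (norm (f x + g x))\<^sup>2)"
    using L2_integrable_inner[OF assms] L2_integrable_sq[OF assms(1)] L2_integrable_sq[OF assms(2)]
    by (simp only:) (intro Bochner_Integration.integrable_add integrable_mult_right)
  moreover have "(\<lambda>x. f x + g x) \<in> borel_measurable (lebesgue_on S)"
    by (intro borel_measurable_add L2_measurable assms)
  ultimately show ?thesis unfolding L2_def by blast
qed

lemma L2_uminus: "f \<in> L2 S \<Longrightarrow> (\<lambda>x. - f x) \<in> L2 S"
  using L2_scaleR[of f S "-1"] by simp

lemma L2_diff: "f \<in> L2 S \<Longrightarrow> g \<in> L2 S \<Longrightarrow> (\<lambda>x. f x - g x) \<in> L2 S"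
  using L2_add[OF _ L2_uminus, of f S g] by simp

lemma L2_zero: "(\<lambda>x. 0) \<in> L2 S"
  by (simp add: L2_def)

lemmas L2_intros = L2_add L2_diff L2_uminus L2_scaleR L2_zero

lemma L2_scale: "f \<in> L2 S \<Longrightarrow> (\<lambda>x. r * f x :: real) \<in> L2 S"
  using L2_scaleR[of f S r] by simp

lemma L2_component:
  assumes "(f :: real^'d \<Rightarrow> real^'n) \<in> L2 S"
  shows "(\<lambda>x. f x $ i) \<in> L2 S"
proof -
  have "(\<lambda>x. f x \<bullet> axis i 1) \<in> borel_measurable (lebesgue_on S)"
    by (intro borel_measurable_inner L2_measurable assms borel_measurable_const)
  then have m: "(\<lambda>x. f x $ i) \<in> borel_measurable (lebesgue_on S)" by (simp add: inner_axis)
  have "integrable (lebesgue_on S) (\<lambda>x. (norm (f x $ i))^2)"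
  proof (rule Bochner_Integration.integrable_bound[OF L2_integrable_sq[OF assms]])
    show "(\<lambda>x. (norm (f x $ i))\<^sup>2) \<in> borel_measurable (lebesgue_on S)"
      using borel_measurable_power[OF m, of 2] by simp
    show "AE x in lebesgue_on S. norm ((norm (f x $ i))\<^sup>2) \<le> norm ((norm (f x))\<^sup>2)"
    proof (intro AE_I2)
      fix x
      have "(norm (f x $ i))\<^sup>2 \<le> (norm (f x))\<^sup>2"
        by (rule power_mono) (simp_all add: component_le_norm_cart)
      then show "norm ((norm (f x $ i))\<^sup>2) \<le> norm ((norm (f x))\<^sup>2)" by simp
    qed
  qed
  with m show ?thesis by (simp add: L2_def)
qed

lemma L2_inner_commute: "L2_inner S f g = L2_inner S g f"
  by (simp add: L2_inner_def inner_commute)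

lemma L2_inner_add_left:
  "f \<in> L2 S \<Longrightarrow> g \<in> L2 S \<Longrightarrow> h \<in> L2 S \<Longrightarrow>
    L2_inner S (\<lambda>x. f x + g x) h = L2_inner S f h + L2_inner S g h"
  by (simp add: L2_inner_def inner_add_left L2_integrable_inner)

lemma L2_inner_diff_left:
  "f \<in> L2 S \<Longrightarrow> g \<in> L2 S \<Longrightarrow> h \<in> L2 S \<Longrightarrow>
    L2_inner S (\<lambda>x. f x - g x) h = L2_inner S f h - L2_inner S g h"
  by (simp add: L2_inner_def inner_diff_left L2_integrable_inner)

lemma L2_inner_scaleR_left: "L2_inner S (\<lambda>x. r *\<^sub>R f x) h = r * L2_inner S f h"
  by (simp add: L2_inner_def)

lemma L2_inner_add_right:
  "f \<in> L2 S \<Longrightarrow> g \<in> L2 S \<Longrightarrow> h \<in> L2 S \<Longrightarrow>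
    L2_inner S h (\<lambda>x. f x + g x) = L2_inner S h f + L2_inner S h g"
  by (simp add: L2_inner_def inner_add_right L2_integrable_inner)

lemma L2_inner_diff_right:
  "f \<in> L2 S \<Longrightarrow> g \<in> L2 S \<Longrightarrow> h \<in> L2 S \<Longrightarrow>
    L2_inner S h (\<lambda>x. f x - g x) = L2_inner S h f - L2_inner S h g"
  by (simp add: L2_inner_def inner_diff_right L2_integrable_inner)

lemma L2_inner_scaleR_right: "L2_inner S h (\<lambda>x. r *\<^sub>R f x) = r * L2_inner S h f"
  by (simp add: L2_inner_def)

lemma L2_inner_cong_AE:
  assumes "f \<in> L2 S" "f' \<in> L2 S" "g \<in> L2 S" "g' \<in> L2 S"
    and "AE x in lebesgue_on S. f x = f' x" "AE x in lebesgue_on S. g x = g' x"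
  shows "L2_inner S f g = L2_inner S f' g'"
  unfolding L2_inner_def
  by (rule integral_cong_AE)
     (use assms L2_integrable_inner in \<open>auto intro: borel_measurable_integrable\<close>)

lemma L2_norm_sq: "(L2_norm S f)^2 = L2_inner S f f"
  by (simp add: L2_norm_def L2_inner_def power2_norm_eq_inner)

lemma L2_norm_nonneg: "0 \<le> L2_norm S f"
  by (simp add: L2_norm_def)

lemma L2_norm_cong_AE:
  assumes "f \<in> L2 S" "g \<in> L2 S" "AE x in lebesgue_on S. f x = g x"
  shows "L2_norm S f = L2_norm S g"
proof -
  have "(L2_norm S f)^2 = (L2_norm S g)^2"
    unfolding L2_norm_sq by (intro L2_inner_cong_AE) (use assms in auto)
  then show ?thesis by (metis L2_norm_nonneg power2_eq_iff_nonneg)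
qed

lemma L2_norm_eq_0_iff:
  assumes "f \<in> L2 S"
  shows "L2_norm S f = 0 \<longleftrightarrow> (AE x in lebesgue_on S. f x = 0)"
  using assms by (simp add: L2_norm_def L2_def integral_nonneg_eq_0_iff_AE)

lemma L2_Cauchy_Schwarz:
  assumes "f \<in> L2 S" "g \<in> L2 S"
  shows "\<bar>L2_inner S f g\<bar> \<le> L2_norm S f * L2_norm S g"
proof (cases "L2_norm S g = 0")
  case True
  then have "AE x in lebesgue_on S. g x = 0" using L2_norm_eq_0_iff assms by blast
  then have "L2_inner S f g = L2_inner S f (\<lambda>x. 0)"
    by (intro L2_inner_cong_AE) (use assms L2_zero in auto)
  then show ?thesis using True by (simp add: L2_inner_def)
next
  case False
  define a b t where "a = L2_norm S f" "b = L2_norm S g" "t = L2_inner S f g"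
  have b: "b > 0" using False L2_norm_nonneg[of S g] by (simp add: a_b_t_def)
  define h where "h = (\<lambda>x. b^2 *\<^sub>R f x - t *\<^sub>R g x)"
  have "0 \<le> L2_inner S h h" using L2_norm_sq[of S h] by (metis zero_le_power2)
  also have "L2_inner S h h = b^4 * a^2 - b^2 * t^2"
  proof -
    have "L2_inner S h h = b^2 * (b^2 * L2_inner S f f) - t * (b^2 * t)
        - (b^2 * (t * t) - t * (t * L2_inner S g g))"
      unfolding h_def using assms
      by (simp add: L2_inner_diff_left L2_inner_diff_right L2_intros L2_inner_scaleR_left
          L2_inner_scaleR_right L2_inner_commute[of S g f] a_b_t_def(3) algebra_simps)
    also have "\<dots> = b^4 * a^2 - b^2 * t^2"
      unfolding L2_norm_sq[symmetric] a_b_t_def[symmetric] by (simp add: power2_eq_square power4_eq_xxxx)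
    finally show ?thesis .
  qed
  finally have "b^2 * t^2 \<le> b^2 * (a * b)^2" by (simp add: power_mult_distrib power4_eq_xxxx power2_eq_square algebra_simps)
  then have "t^2 \<le> (a*b)^2" using b by simp
  then have "\<bar>t\<bar>\<^sup>2 \<le> (a * b)\<^sup>2" by (simp only: power2_abs)
  then have "\<bar>t\<bar> \<le> a * b"
    by (rule power2_le_imp_le) (simp add: a_b_t_def L2_norm_nonneg)
  then show ?thesis by (simp add: a_b_t_def)
qed

lemma L2_norm_scaleR: "L2_norm S (\<lambda>x. r *\<^sub>R f x) = \<bar>r\<bar> * L2_norm S f"
  by (simp add: L2_norm_def power_mult_distrib real_sqrt_mult)

lemma L2_norm_uminus: "L2_norm S (\<lambda>x. - f x) = L2_norm S f"
  by (simp add: L2_norm_def)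

lemma L2_norm_minus_commute: "L2_norm S (\<lambda>x. f x - g x) = L2_norm S (\<lambda>x. g x - f x)"
  by (simp add: L2_norm_def norm_minus_commute)

lemma L2_norm_triangle:
  assumes "f \<in> L2 S" "g \<in> L2 S"
  shows "L2_norm S (\<lambda>x. f x + g x) \<le> L2_norm S f + L2_norm S g"
proof (rule power2_le_imp_le)
  have "(L2_norm S (\<lambda>x. f x + g x))\<^sup>2 = (L2_norm S f)^2 + 2 * L2_inner S f g + (L2_norm S g)^2"
    using assms by (simp add: L2_norm_sq L2_inner_add_left L2_inner_add_right L2_intros L2_inner_commute[of S g f])
  also have "\<dots> \<le> (L2_norm S f + L2_norm S g)\<^sup>2"
    using L2_Cauchy_Schwarz[OF assms] by (simp add: power2_sum)
  finally show "(L2_norm S (\<lambda>x. f x + g x))\<^sup>2 \<le> (L2_norm S f + L2_norm S g)\<^sup>2" .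
qed (simp add: L2_norm_nonneg)

lemma L2_norm_triangle_diff:
  assumes "f \<in> L2 S" "g \<in> L2 S"
  shows "L2_norm S (\<lambda>x. f x - g x) \<le> L2_norm S f + L2_norm S g"
  using L2_norm_triangle[OF assms(1) L2_uminus[OF assms(2)]] by (simp add: L2_norm_uminus)

lemma L2_norm_triangle_sub:
  assumes "f \<in> L2 S" "g \<in> L2 S"
  shows "L2_norm S f \<le> L2_norm S g + L2_norm S (\<lambda>x. f x - g x)"
  using L2_norm_triangle[OF assms(2) L2_diff[OF assms]] by simp

text \<open>
  Every membership of L2 below that involves a coefficient of the equation is obtained from this
  comparison, which gives the norm bound at the same time.
\<close>

lemma L2_dominated:
  assumes g: "g \<in> borel_measurable (lebesgue_on S)" and f: "f \<in> L2 S" and "0 \<le> M"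
    and le: "AE x in lebesgue_on S. norm (g x) \<le> M * norm (f x)"
  shows "g \<in> L2 S" and "L2_norm S g \<le> M * L2_norm S f"
proof -
  have le2: "AE x in lebesgue_on S. (norm (g x))^2 \<le> M^2 * (norm (f x))^2"
    using le
  proof eventually_elim
    case (elim x)
    then have "(norm (g x))^2 \<le> (M * norm (f x))^2" by (intro power_mono) auto
    then show ?case by (simp add: power_mult_distrib)
  qed
  have int: "integrable (lebesgue_on S) (\<lambda>x. M^2 * (norm (f x))^2)"
    using L2_integrable_sq[OF f] by simp
  have "integrable (lebesgue_on S) (\<lambda>x. (norm (g x))^2)"
    by (rule Bochner_Integration.integrable_bound[OF int]) (use g le2 in auto)
  with g show gL: "g \<in> L2 S" by (simp add: L2_def)
  have "(LINT x|lebesgue_on S. (norm (g x))^2) \<le> (LINT x|lebesgue_on S. M^2 * (norm (f x))^2)"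
    by (intro integral_mono_AE int le2) (use gL in \<open>auto simp: L2_def\<close>)
  then have "(L2_norm S g)^2 \<le> (M * L2_norm S f)^2"
    by (simp add: L2_norm_def power_mult_distrib)
  then show "L2_norm S g \<le> M * L2_norm S f"
    by (rule power2_le_imp_le) (simp add: L2_norm_nonneg \<open>0 \<le> M\<close>)
qed

section \<open>Completeness of L2\<close>

lemma L2_nn_integral:
  assumes "f \<in> L2 S"
  shows "(\<integral>\<^sup>+x. ennreal ((norm (f x))^2) \<partial>lebesgue_on S) = ennreal ((L2_norm S f)^2)"
proof -
  have "0 \<le> (LINT x|lebesgue_on S. (norm (f x))^2)" by (intro integral_nonneg_AE) auto
  then show ?thesis
    unfolding L2_norm_def
    by (subst nn_integral_eq_integral[OF L2_integrable_sq[OF assms]]) auto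
qed

lemma L2_I_nn_integral:
  assumes "f \<in> borel_measurable (lebesgue_on S)" "0 \<le> C"
    and "(\<integral>\<^sup>+x. ennreal ((norm (f x))^2) \<partial>lebesgue_on S) \<le> ennreal (C^2)"
  shows "f \<in> L2 S" and "L2_norm S f \<le> C"
proof -
  have m: "(\<lambda>x. (norm (f x))^2) \<in> borel_measurable (lebesgue_on S)"
    by (intro borel_measurable_power measurable_compose[OF assms(1)]) simp
  have "integrable (lebesgue_on S) (\<lambda>x. (norm (f x))^2)"
  proof (rule integrableI_nonneg[OF m])
    show "(\<integral>\<^sup>+x. ennreal ((norm (f x))^2) \<partial>lebesgue_on S) < \<infinity>"
      using assms(3) by (simp add: order_le_less_trans)
  qed auto
  then show f: "f \<in> L2 S" using assms(1) by (simp add: L2_def)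
  have "(L2_norm S f)^2 \<le> C^2"
    using assms(3) L2_nn_integral[OF f] by (simp add: ennreal_le_iff)
  then show "L2_norm S f \<le> C" using \<open>0 \<le> C\<close> by (rule power2_le_imp_le)
qed

text \<open>
  Fatou's lemma for the squared norms.  It serves twice in the proof of completeness: it puts the
  pointwise limit into L2, and it turns the Cauchy condition into convergence.
\<close>

lemma L2_Fatou:
  assumes u: "\<And>k. u k \<in> L2 S" and v: "v \<in> borel_measurable (lebesgue_on S)"
    and lim: "AE x in lebesgue_on S. (\<lambda>k. u k x) \<longlonglongrightarrow> v x"
    and bd: "\<forall>\<^sub>F k in sequentially. L2_norm S (u k) \<le> C" and "0 \<le> C"
  shows "v \<in> L2 S" and "L2_norm S v \<le> C"
proof -
  have m: "(\<lambda>x. ennreal ((norm (u k x))^2)) \<in> borel_measurable (lebesgue_on S)" for k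
  proof -
    have "(\<lambda>x. (norm (u k x))^2) \<in> borel_measurable (lebesgue_on S)"
      by (intro borel_measurable_power measurable_compose[OF L2_measurable[OF u]]) simp
    then show ?thesis by simp
  qed
  have "(\<integral>\<^sup>+x. ennreal ((norm (v x))^2) \<partial>lebesgue_on S)
      = (\<integral>\<^sup>+x. liminf (\<lambda>k. ennreal ((norm (u k x))^2)) \<partial>lebesgue_on S)"
  proof (rule nn_integral_cong_AE)
    show "AE x in lebesgue_on S. ennreal ((norm (v x))^2) = liminf (\<lambda>k. ennreal ((norm (u k x))^2))"
      using lim
    proof eventually_elim
      case (elim x)
      then have "(\<lambda>k. ennreal ((norm (u k x))^2)) \<longlonglongrightarrow> ennreal ((norm (v x))^2)"
        by (intro tendsto_intros)
      from lim_imp_Liminf[OF sequentially_bot this] show ?case by simp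
    qed
  qed
  also have "\<dots> \<le> liminf (\<lambda>k. \<integral>\<^sup>+x. ennreal ((norm (u k x))^2) \<partial>lebesgue_on S)"
    by (intro nn_integral_liminf m)
  also have "\<dots> \<le> ennreal (C^2)"
  proof (rule Liminf_le)
    show "\<forall>\<^sub>F k in sequentially. (\<integral>\<^sup>+x. ennreal ((norm (u k x))^2) \<partial>lebesgue_on S) \<le> ennreal (C^2)"
      using bd
    proof eventually_elim
      case (elim k)
      then show ?case
        by (simp add: L2_nn_integral[OF u] ennreal_leI power_mono L2_norm_nonneg)
    qed
  qed simp
  finally have "(\<integral>\<^sup>+x. ennreal ((norm (v x))^2) \<partial>lebesgue_on S) \<le> ennreal (C^2)" .
  from L2_I_nn_integral[OF v \<open>0 \<le> C\<close> this] show "v \<in> L2 S" "L2_norm S v \<le> C" .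
qed

lemma L2_const:
  assumes "S \<in> lmeasurable" shows "(\<lambda>x. c) \<in> L2 S"
proof -
  have "integrable (lebesgue_on S) (\<lambda>x. (norm c)^2)"
    by (rule finite_measure.integrable_const[OF finite_measure_lebesgue_on[OF assms]])
  then show ?thesis unfolding L2_def by (intro CollectI conjI borel_measurable_const)
qed

text \<open>
  The classical argument: the increments of a fast subsequence have summable norms, hence, the
  domain having finite measure, summable integrals, so the subsequence converges almost
  everywhere.
\<close>

theorem L2_complete:
  fixes f :: "nat \<Rightarrow> real^'d \<Rightarrow> 'a::euclidean_space"
  assumes S: "S \<in> lmeasurable" and f: "\<And>n. f n \<in> L2 S"
    and Cauchy: "\<And>\<epsilon>. \<epsilon> > 0 \<Longrightarrow> \<exists>N. \<forall>m\<ge>N. \<forall>n\<ge>N. L2_norm S (\<lambda>x. f m x - f n x) < \<epsilon>"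
  shows "\<exists>g\<in>L2 S. (\<lambda>n. L2_norm S (\<lambda>x. f n x - g x)) \<longlonglongrightarrow> 0"
proof -
  have "\<exists>N. \<forall>m\<ge>N. \<forall>n\<ge>N. L2_norm S (\<lambda>x. f m x - f n x) < (1/2)^k" for k :: nat
    by (rule Cauchy) simp
  then obtain N where N: "\<And>k m n. m \<ge> N k \<Longrightarrow> n \<ge> N k \<Longrightarrow> L2_norm S (\<lambda>x. f m x - f n x) < (1/2)^k"
    by metis
  \<comment> \<open>Adding \<open>k\<close> to the partial sums of \<open>N\<close> makes \<open>r\<close> dominate both \<open>N\<close> and the identity.\<close>
  define r where "r k = k + sum N {..k}" for k
  have r_ge: "r k \<ge> N k" for k unfolding r_def by (simp add: trans_le_add2 member_le_sum)
  have r_ge': "r (Suc k) \<ge> N k" for k using r_ge[of k] by (simp add: r_def)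
  have r_id: "r k \<ge> k" for k by (simp add: r_def)
  define h where "h k x = norm (f (r (Suc k)) x - f (r k) x)" for k x
  define c where "c = L2_norm S (\<lambda>x. 1::real)"
  have d: "(\<lambda>x. f (r (Suc k)) x - f (r k) x) \<in> L2 S" for k by (intro L2_diff f)
  have hm: "h k \<in> borel_measurable (lebesgue_on S)" for k
    unfolding h_def by (intro measurable_compose[OF L2_measurable[OF d]]) simp
  have hL: "h k \<in> L2 S" and hn: "L2_norm S (h k) \<le> (1/2)^k" for k
  proof -
    have "AE x in lebesgue_on S. norm (h k x) \<le> 1 * norm (f (r (Suc k)) x - f (r k) x)"
      by (intro AE_I2) (simp add: h_def)
    from L2_dominated[OF hm d _ this] N[OF r_ge'[of k] r_ge[of k]]
    show "h k \<in> L2 S" "L2_norm S (h k) \<le> (1/2)^k" by auto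
  qed
  have one: "(\<lambda>x. 1::real) \<in> L2 S" by (rule L2_const[OF S])
  have h_int: "integrable (lebesgue_on S) (h k)" for k
    using L2_integrable_inner[OF hL[of k] one] by simp
  have h_le: "(\<integral>\<^sup>+x. ennreal (h k x) \<partial>lebesgue_on S) \<le> ennreal (c * (1/2)^k)" for k
  proof -
    have "(LINT x|lebesgue_on S. h k x) = L2_inner S (h k) (\<lambda>x. 1)" by (simp add: L2_inner_def)
    also have "\<dots> \<le> L2_norm S (h k) * c"
      using L2_Cauchy_Schwarz[OF hL[of k] one] by (simp add: c_def)
    also have "\<dots> \<le> (1/2)^k * c" using hn[of k] by (intro mult_right_mono) (auto simp: c_def L2_norm_nonneg)
    finally have le: "(LINT x|lebesgue_on S. h k x) \<le> c * (1/2)^k" by (simp add: mult.commute)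
    have "(\<integral>\<^sup>+x. ennreal (h k x) \<partial>lebesgue_on S) = ennreal (LINT x|lebesgue_on S. h k x)"
      by (rule nn_integral_eq_integral[OF h_int]) (simp add: h_def)
    with le show ?thesis by (simp add: ennreal_leI)
  qed
  have c0: "0 \<le> c" by (simp add: c_def L2_norm_nonneg)
  have hme: "(\<lambda>x. ennreal (h k x)) \<in> borel_measurable (lebesgue_on S)" for k
    using hm[of k] by simp
  have "(\<integral>\<^sup>+x. (\<Sum>k. ennreal (h k x)) \<partial>lebesgue_on S) = (\<Sum>k. \<integral>\<^sup>+x. ennreal (h k x) \<partial>lebesgue_on S)"
    by (intro nn_integral_suminf hme)
  also have "\<dots> \<le> (\<Sum>k. ennreal (c * (1/2)^k))" by (intro suminf_le h_le) auto
  also have "\<dots> = ennreal (\<Sum>k. c * (1/2)^k)"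
    by (intro suminf_ennreal2) (auto simp: c0 intro!: summable_mult summable_geometric)
  finally have "(\<integral>\<^sup>+x. (\<Sum>k. ennreal (h k x)) \<partial>lebesgue_on S) \<noteq> \<infinity>"
    by (metis ennreal_less_top infinity_ennreal_def not_le top.not_eq_extremum)
  then have "AE x in lebesgue_on S. (\<Sum>k. ennreal (h k x)) \<noteq> \<infinity>"
    by (intro nn_integral_PInf_AE borel_measurable_suminf_order hme)
  then have conv: "AE x in lebesgue_on S. convergent (\<lambda>k. f (r k) x)"
  proof eventually_elim
    case (elim x)
    have "summable (\<lambda>k. h k x)"
      by (rule summable_suminf_not_top) (use elim in \<open>auto simp: h_def\<close>)
    then have "summable (\<lambda>k. f (r (Suc k)) x - f (r k) x)"
      unfolding h_def by (rule summable_norm_cancel)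
    then have "convergent (\<lambda>n. \<Sum>k<n. f (r (Suc k)) x - f (r k) x)"
      by (simp add: summable_iff_convergent)
    then have "convergent (\<lambda>n. f (r n) x - f (r 0) x)"
      by (simp add: sum_lessThan_telescope[of "\<lambda>k. f (r k) x"])
    then have "convergent (\<lambda>n. (f (r n) x - f (r 0) x) + f (r 0) x)"
      by (intro convergent_add convergent_const)
    then show ?case by simp
  qed
  define g where "g x = lim (\<lambda>k. f (r k) x)" for x
  have gm: "g \<in> borel_measurable (lebesgue_on S)"
    unfolding g_def by (intro borel_measurable_lim_metric L2_measurable f)
  have close: "(\<lambda>x. g x - f n x) \<in> L2 S \<and> L2_norm S (\<lambda>x. g x - f n x) \<le> \<epsilon>"
    if "\<epsilon> > 0" and M: "\<forall>m\<ge>M. \<forall>n\<ge>M. L2_norm S (\<lambda>x. f m x - f n x) < \<epsilon>" and "n \<ge> M" for n M \<epsilon>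
  proof -
    have "\<forall>\<^sub>F k in sequentially. L2_norm S (\<lambda>x. f (r k) x - f n x) \<le> \<epsilon>"
      using eventually_ge_at_top[of M]
    proof eventually_elim
      case (elim k)
      then have "r k \<ge> M" using r_id[of k] by linarith
      then show ?case using M \<open>n \<ge> M\<close> less_imp_le by blast
    qed
    moreover have "AE x in lebesgue_on S. (\<lambda>k. f (r k) x - f n x) \<longlonglongrightarrow> g x - f n x"
      using conv unfolding g_def
      by eventually_elim (auto intro!: tendsto_diff simp: convergent_LIMSEQ_iff)
    moreover have "(\<lambda>x. g x - f n x) \<in> borel_measurable (lebesgue_on S)"
      by (intro borel_measurable_diff gm L2_measurable f)
    ultimately show ?thesis
      using L2_Fatou[where u = "\<lambda>k x. f (r k) x - f n x" and C = \<epsilon> and v = "\<lambda>x. g x - f n x" and S = S]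
        L2_diff[OF f f] \<open>\<epsilon> > 0\<close> by auto
  qed
  obtain M where "\<forall>m\<ge>M. \<forall>n\<ge>M. L2_norm S (\<lambda>x. f m x - f n x) < 1" using Cauchy[of 1] by auto
  then have "(\<lambda>x. g x - f M x) \<in> L2 S" using close[of 1 M M] by auto
  from L2_add[OF this f[of M]] have gL: "g \<in> L2 S" by simp
  have "(\<lambda>n. L2_norm S (\<lambda>x. f n x - g x)) \<longlonglongrightarrow> 0"
  proof (rule LIMSEQ_I)
    fix e :: real assume "0 < e"
    then obtain M where "\<forall>m\<ge>M. \<forall>n\<ge>M. L2_norm S (\<lambda>x. f m x - f n x) < e/2" using Cauchy[of "e/2"] by auto
    then have "L2_norm S (\<lambda>x. g x - f n x) \<le> e/2" if "n \<ge> M" for n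
      using close[of "e/2" M n] that \<open>0 < e\<close> by auto
    then have "norm (L2_norm S (\<lambda>x. f n x - g x) - 0) < e" if "n \<ge> M" for n
      using \<open>0 < e\<close> that L2_norm_nonneg[of S "\<lambda>x. f n x - g x"] L2_norm_minus_commute[of S "f n" g] by fastforce
    then show "\<exists>no. \<forall>n\<ge>no. norm (L2_norm S (\<lambda>x. f n x - g x) - 0) < e" by blast
  qed
  with gL show ?thesis by blast
qed

section \<open>Smooth functions\<close>

lemma partial_deriv_eqI: "(f has_derivative D) (at x) \<Longrightarrow> partial_deriv i f x = D (axis i 1)"
  unfolding partial_deriv_def by (simp add: frechet_derivative_at[symmetric])

lemma Ck_imp_continuous: "Ck n f \<Longrightarrow> continuous_on UNIV f"
  by (cases n) (auto intro!: differentiable_imp_continuous_on simp: differentiable_on_def)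

lemma Ck_Suc_imp: "Ck (Suc n) f \<Longrightarrow> Ck n f"
proof (induction n arbitrary: f)
  case 0
  then show ?case using Ck_imp_continuous[of "Suc 0" f] by simp
next
  case (Suc n)
  from Suc.prems have d: "\<forall>x. f differentiable (at x)" and p: "\<And>i. Ck (Suc n) (partial_deriv i f)"
    unfolding Ck.simps(2)[of "Suc n"] by blast+
  show ?case using d Suc.IH[OF p] by simp
qed

lemma Ck_const: "Ck n (\<lambda>x::real^'d. c)"
proof (induction n arbitrary: c)
  case (Suc n)
  have "partial_deriv i (\<lambda>x::real^'d. c) = (\<lambda>x. 0)" for i
    by (rule ext) (simp add: partial_deriv_eqI[where D = "\<lambda>_. 0"])
  then have "Ck n (partial_deriv i (\<lambda>x::real^'d. c))" for i using Suc by metis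
  then show ?case by simp
qed simp

lemma Ck_add: "Ck n f \<Longrightarrow> Ck n g \<Longrightarrow> Ck n (\<lambda>x. f x + g x)"
proof (induction n arbitrary: f g)
  case (Suc n)
  have f: "f differentiable (at x)" and g: "g differentiable (at x)" for x
    using Suc.prems by auto
  have "partial_deriv i (\<lambda>x. f x + g x) = (\<lambda>x. partial_deriv i f x + partial_deriv i g x)" for i
  proof (rule ext)
    fix x
    have "((\<lambda>x. f x + g x) has_derivative (\<lambda>h. frechet_derivative f (at x) h + frechet_derivative g (at x) h)) (at x)"
      using f[of x] g[of x] unfolding frechet_derivative_works by (rule has_derivative_add)
    from partial_deriv_eqI[OF this]
    show "partial_deriv i (\<lambda>x. f x + g x) x = partial_deriv i f x + partial_deriv i g x" by (simp add: partial_deriv_def)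
  qed
  then show ?case using Suc f g by (auto intro!: differentiable_add)
qed (auto intro: continuous_on_add)

lemma Ck_mult: "Ck n f \<Longrightarrow> Ck n g \<Longrightarrow> Ck n (\<lambda>x. f x * g x)"
proof (induction n arbitrary: f g)
  case (Suc n)
  have f: "f differentiable (at x)" and g: "g differentiable (at x)" for x
    using Suc.prems by auto
  have eq: "partial_deriv i (\<lambda>x. f x * g x) = (\<lambda>x. f x * partial_deriv i g x + partial_deriv i f x * g x)" for i
  proof (rule ext)
    fix x
    have "((\<lambda>x. f x * g x) has_derivative (\<lambda>h. f x * frechet_derivative g (at x) h + frechet_derivative f (at x) h * g x)) (at x)"
      using f[of x] g[of x] unfolding frechet_derivative_works by (rule has_derivative_mult)
    from partial_deriv_eqI[OF this]
    show "partial_deriv i (\<lambda>x. f x * g x) x = f x * partial_deriv i g x + partial_deriv i f x * g x" by (simp add: partial_deriv_def)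
  qed
  have "Ck n f" "Ck n g" using Suc.prems Ck_Suc_imp by blast+
  moreover have "Ck n (partial_deriv i f)" "Ck n (partial_deriv i g)" for i using Suc.prems by auto
  ultimately have "Ck n (\<lambda>x. f x * partial_deriv i g x + partial_deriv i f x * g x)" for i
    by (intro Ck_add Suc.IH) auto
  then show ?case using f g by (auto simp: eq intro!: differentiable_mult)
qed (auto intro: continuous_on_mult)

lemma Ck_prod: "finite I \<Longrightarrow> (\<And>i. i \<in> I \<Longrightarrow> Ck n (f i)) \<Longrightarrow> Ck n (\<lambda>x. \<Prod>i\<in>I. f i x)"
  by (induction I rule: finite_induct) (auto intro: Ck_const Ck_mult)

text \<open>
  The functions \<open>exp (- 1 / t) / t ^ k\<close>, extended by zero, span a space closed under
  differentiation.  Carrying the exponent \<open>k\<close> along therefore replaces the usual polynomials in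
  \<open>1 / t\<close> in the proof of smoothness.
\<close>

definition flat_exp :: "nat \<Rightarrow> real \<Rightarrow> real" where
  "flat_exp k t = (if t > 0 then exp (- 1 / t) / t ^ k else 0)"

text \<open>
  One Taylor term of \<open>exp (1 / t)\<close> suffices.  The linear bound, applied with \<open>Suc k\<close>, is exactly
  what makes the difference quotient at the origin tend to zero.
\<close>

lemma flat_exp_bound: "\<bar>flat_exp k t\<bar> \<le> fact (Suc k) * \<bar>t\<bar>"
proof (cases "t > 0")
  case True
  have "(1/t)^(Suc k) /\<^sub>R fact (Suc k) \<le> (\<Sum>n. (1/t)^n /\<^sub>R fact n)"
    using sum_le_suminf[OF summable_exp_generic[of "1/t"], of "{Suc k}"] True by simp
  then have "(1/t)^(Suc k) / fact (Suc k) \<le> exp (1/t)"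
    by (simp add: exp_def divide_inverse mult.commute)
  then have "1 / (t ^ Suc k * fact (Suc k)) \<le> exp (1/t)" by (simp only: power_one_over divide_divide_eq_left)
  moreover have "0 < t ^ Suc k * fact (Suc k)" using True by (intro mult_pos_pos zero_less_power) auto
  ultimately have "1 \<le> (fact (Suc k) * t ^ Suc k) * exp (1/t)"
    by (simp only: pos_divide_le_eq mult_ac)
  then have "exp (-1/t) * 1 \<le> exp (-1/t) * ((fact (Suc k) * t ^ Suc k) * exp (1/t))"
    by (intro mult_left_mono) auto
  also have "\<dots> = fact (Suc k) * t ^ Suc k * (exp (-1/t) * exp (1/t))" by simp
  also have "exp (-1/t) * exp (1/t) = 1" by (simp flip: exp_add)
  finally have "exp (-1/t) \<le> fact (Suc k) * t ^ Suc k" by simp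
  then have "exp (-1/t) / t^k \<le> fact (Suc k) * t"
    using True by (simp add: field_simps)
  then show ?thesis using True by (simp add: flat_exp_def)
next
  case False
  then show ?thesis by (simp only: flat_exp_def if_False abs_zero) (intro mult_nonneg_nonneg, auto)
qed

lemma flat_exp_deriv:
  "(flat_exp k has_real_derivative (flat_exp (k + 2) t - real k * flat_exp (k + 1) t)) (at t)"
proof -
  consider "t > 0" | "t < 0" | "t = 0" by linarith
  then show ?thesis
  proof cases
    case 1
    have "((\<lambda>t. exp (- 1 / t)) has_real_derivative exp (- 1 / t) * (1 / t^2)) (at t)"
      using 1 by (auto intro!: derivative_eq_intros simp: power2_eq_square)
    moreover have "((\<lambda>t. t ^ k) has_real_derivative real k * t ^ (k - 1)) (at t)"
      by (auto intro!: derivative_eq_intros)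
    ultimately have "((\<lambda>t. exp (- 1 / t) / t ^ k) has_real_derivative
        (exp (- 1 / t) * (1 / t^2) * t ^ k - exp (- 1 / t) * (real k * t ^ (k - 1))) / (t ^ k * t ^ k)) (at t)"
      by (rule DERIV_divide) (use 1 in auto)
    also have "(exp (- 1 / t) * (1 / t^2) * t ^ k - exp (- 1 / t) * (real k * t ^ (k - 1))) / (t ^ k * t ^ k)
        = flat_exp (k + 2) t - real k * flat_exp (k + 1) t"
      using 1 by (cases k) (simp_all add: flat_exp_def field_simps power2_eq_square)
    finally have "((\<lambda>t. exp (- 1 / t) / t ^ k) has_real_derivative
        (flat_exp (k + 2) t - real k * flat_exp (k + 1) t)) (at t)" .
    then show ?thesis
      by (rule has_field_derivative_transform_within_open[where S = "{0<..}"])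
         (use 1 in \<open>auto simp: flat_exp_def\<close>)
  next
    case 2
    have "((\<lambda>t. 0) has_real_derivative (flat_exp (k + 2) t - real k * flat_exp (k + 1) t)) (at t)"
      using 2 by (simp add: flat_exp_def)
    then show ?thesis
      by (rule has_field_derivative_transform_within_open[where S = "{..<0}"])
         (use 2 in \<open>auto simp: flat_exp_def\<close>)
  next
    case 3
    have "((\<lambda>h. (flat_exp k (0 + h) - flat_exp k 0) / h) \<longlongrightarrow> 0) (at 0)"
    proof (rule Lim_null_comparison)
      show "\<forall>\<^sub>F h in at 0. norm ((flat_exp k (0 + h) - flat_exp k 0) / h) \<le> fact (Suc (Suc k)) * \<bar>h\<bar>"
      proof (intro always_eventually allI)
        fix h :: real
        have "(flat_exp k (0 + h) - flat_exp k 0) / h = flat_exp (Suc k) h"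
          by (auto simp: flat_exp_def field_simps)
        then show "norm ((flat_exp k (0 + h) - flat_exp k 0) / h) \<le> fact (Suc (Suc k)) * \<bar>h\<bar>"
          using flat_exp_bound[of "Suc k" h] by (simp only: real_norm_def)
      qed
      show "((\<lambda>h. fact (Suc (Suc k)) * \<bar>h\<bar>) \<longlongrightarrow> (0::real)) (at 0)"
        by (auto intro!: tendsto_eq_intros)
    qed
    then show ?thesis using 3 by (simp add: DERIV_def flat_exp_def)
  qed
qed

lemma Ck_flat_exp: "Ck n (\<lambda>x::real^'d. flat_exp k (\<alpha> * x $ i + \<beta>))"
proof (induction n arbitrary: k)
  case 0
  have "continuous_on UNIV (flat_exp k)"
    by (rule DERIV_continuous_on[where D = "\<lambda>t. flat_exp (k + 2) t - real k * flat_exp (k + 1) t"])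
       (rule DERIV_subset[OF flat_exp_deriv], simp)
  then have "continuous_on UNIV (\<lambda>x::real^'d. flat_exp k (\<alpha> * x $ i + \<beta>))"
    by (rule continuous_on_compose2) (auto intro!: continuous_intros)
  then show ?case by simp
next
  case (Suc n)
  have der: "((\<lambda>x::real^'d. flat_exp k (\<alpha> * x $ i + \<beta>)) has_derivative
      (\<lambda>h. (\<alpha> * h $ i) * (flat_exp (k + 2) (\<alpha> * x $ i + \<beta>) - real k * flat_exp (k + 1) (\<alpha> * x $ i + \<beta>)))) (at x)" for x
  proof -
    have "((\<lambda>x::real^'d. \<alpha> * x $ i + \<beta>) has_derivative (\<lambda>h. \<alpha> * h $ i)) (at x)"
      by (auto intro!: derivative_eq_intros bounded_linear.has_derivative[OF bounded_linear_vec_nth])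
    from DERIV_compose_FDERIV[OF flat_exp_deriv this] show ?thesis .
  qed
  have "partial_deriv j (\<lambda>x::real^'d. flat_exp k (\<alpha> * x $ i + \<beta>)) =
     (\<lambda>x. (if i = j then \<alpha> else 0) * flat_exp (k + 2) (\<alpha> * x $ i + \<beta>)
        + (- real k * (if i = j then \<alpha> else 0)) * flat_exp (k + 1) (\<alpha> * x $ i + \<beta>))" for j
    by (rule ext, subst partial_deriv_eqI[OF der]) (simp add: axis_def algebra_simps)
  moreover have "Ck n (\<lambda>x::real^'d. (if i = j then \<alpha> else 0) * flat_exp (k + 2) (\<alpha> * x $ i + \<beta>)
        + (- real k * (if i = j then \<alpha> else 0)) * flat_exp (k + 1) (\<alpha> * x $ i + \<beta>))" for j
    by (intro Ck_add Ck_mult Ck_const Suc.IH)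
  ultimately show ?case using der by (auto simp: differentiable_def)
qed

text \<open>
  Scaling the argument of \<open>exp (- 1 / t)\<close> by \<open>n\<close> is the same as taking an \<open>n\<close>-th root, so these test
  functions increase to the indicator of the open box.
\<close>

definition box_bump :: "nat \<Rightarrow> real^'d \<Rightarrow> real^'d \<Rightarrow> real^'d \<Rightarrow> real" where
  "box_bump n a b x = (\<Prod>i\<in>UNIV. flat_exp 0 (real n * x $ i + - real n * a $ i)
      * flat_exp 0 (- real n * x $ i + real n * b $ i))"

lemma flat_exp_0_range: "0 \<le> flat_exp 0 t" "flat_exp 0 t \<le> 1"
  by (auto simp: flat_exp_def)

lemma box_bump_range: "0 \<le> box_bump n a b x" "box_bump n a b x \<le> 1"
  unfolding box_bump_def
  by (auto intro!: prod_nonneg prod_le_1 mult_nonneg_nonneg mult_le_one simp: flat_exp_0_range)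

lemma box_bump_outside:
  assumes "x \<notin> box a b" shows "box_bump n a b x = 0"
proof -
  obtain i where "\<not> (a $ i < x $ i \<and> x $ i < b $ i)" using assms by (auto simp: mem_box_cart)
  then have "real n * (x $ i - a $ i) \<le> 0 \<or> real n * (b $ i - x $ i) \<le> 0"
    by (auto simp: not_less mult_le_0_iff)
  then have "flat_exp 0 (real n * x $ i + - real n * a $ i) * flat_exp 0 (- real n * x $ i + real n * b $ i) = 0"
    by (auto simp: flat_exp_def algebra_simps)
  then show ?thesis unfolding box_bump_def by (intro prod_zero) auto
qed

lemma box_bump_tendsto: "(\<lambda>n. box_bump n a b x) \<longlonglongrightarrow> indicator (box a b) x"
proof (cases "x \<in> box a b")
  case True
  have lim: "(\<lambda>n. flat_exp 0 (real n * s)) \<longlonglongrightarrow> 1" if "s > 0" for s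
  proof -
    have "(\<lambda>n. exp (- ((1 / s) * inverse (real n)))) \<longlonglongrightarrow> exp (- ((1 / s) * 0))"
      by (intro tendsto_intros lim_inverse_n)
    then have "(\<lambda>n. exp (- ((1 / s) * inverse (real n)))) \<longlonglongrightarrow> 1" by simp
    moreover have "\<forall>\<^sub>F n in sequentially. exp (- ((1 / s) * inverse (real n))) = flat_exp 0 (real n * s)"
      using eventually_gt_at_top[of 0]
      by eventually_elim (use that in \<open>simp add: flat_exp_def field_simps\<close>)
    ultimately show ?thesis by (rule Lim_transform_eventually)
  qed
  have "(\<lambda>n. \<Prod>i\<in>UNIV. flat_exp 0 (real n * (x $ i - a $ i)) * flat_exp 0 (real n * (b $ i - x $ i)))
      \<longlonglongrightarrow> (\<Prod>i\<in>(UNIV :: 'a set). 1 * 1)"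
    by (intro tendsto_prod tendsto_mult lim) (use True in \<open>auto simp: mem_box_cart\<close>)
  then show ?thesis using True by (simp add: box_bump_def algebra_simps)
qed (simp add: box_bump_outside)

lemma box_bump_test_function:
  assumes "cbox a b \<subseteq> \<Omega>" shows "box_bump n a b \<in> test_functions \<Omega>"
proof -
  have "{x. box_bump n a b x \<noteq> 0} \<subseteq> cbox a b"
    using box_bump_outside box_subset_cbox by blast
  then have sub: "closure {x. box_bump n a b x \<noteq> 0} \<subseteq> cbox a b"
    by (rule closure_minimal) (rule closed_cbox)
  then have "compact (closure {x. box_bump n a b x \<noteq> 0})"
    using compact_eq_bounded_closed bounded_cbox bounded_subset closed_closure by blast
  moreover have "Ck m (box_bump n a b)" for m
    unfolding box_bump_def[abs_def] by (intro Ck_prod Ck_mult Ck_flat_exp) auto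
  ultimately show ?thesis using sub assms by (auto simp: test_functions_def)
qed

section \<open>Functions with vanishing integrals over boxes\<close>

text \<open>
  The positive and the negative part are densities of finite measures that agree on the boxes, an
  intersection-stable generator of the Borel sets; equal measures have equal densities.
\<close>

lemma AE_zero_if_box_integrals_zero:
  fixes f :: "'a::euclidean_space \<Rightarrow> real"
  assumes f: "integrable lborel f"
    and zero: "\<And>a b. (LINT x|lborel. indicator (box a b) x * f x) = 0"
  shows "AE x in lborel. f x = 0"
proof -
  define p q where "p x = max 0 (f x)" and "q x = max 0 (- f x)" for x
  have fm: "f \<in> borel_measurable borel" using borel_measurable_integrable[OF f] by simp
  have pm: "p \<in> borel_measurable borel" and qm: "q \<in> borel_measurable borel"
    unfolding p_def q_def using fm by (auto intro!: borel_measurable_max)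
  have pi: "integrable lborel p" and qi: "integrable lborel q"
    unfolding p_def q_def using f by (auto intro!: integrable_max)
  have pe: "(\<lambda>x. ennreal (p x)) \<in> borel_measurable lborel" and qe: "(\<lambda>x. ennreal (q x)) \<in> borel_measurable lborel"
    using pm qm by auto
  have box_int: "emeasure (density lborel (\<lambda>x. ennreal (h x))) (box a b)
      = ennreal (LINT x|lborel. indicator (box a b) x * h x)"
    if "integrable lborel h" and "\<And>x. 0 \<le> h x" for h and a b :: 'a
  proof -
    have "integrable lborel (\<lambda>x. indicator (box a b) x * h x)"
      using integrable_mult_indicator[OF _ that(1), of "box a b"] by simp
    then have "(\<integral>\<^sup>+x. ennreal (indicator (box a b) x * h x) \<partial>lborel)
        = ennreal (LINT x|lborel. indicator (box a b) x * h x)"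
      by (rule nn_integral_eq_integral) (use that(2) in auto)
    moreover have "(\<integral>\<^sup>+x. ennreal (indicator (box a b) x * h x) \<partial>lborel)
        = (\<integral>\<^sup>+x. ennreal (h x) * indicator (box a b) x \<partial>lborel)"
      by (intro nn_integral_cong) (simp split: split_indicator)
    ultimately show ?thesis
      using borel_measurable_integrable[OF that(1)] by (simp add: emeasure_density)
  qed
  have eq_box: "emeasure (density lborel (\<lambda>x. ennreal (p x))) (box a b)
      = emeasure (density lborel (\<lambda>x. ennreal (q x))) (box a b)" for a b
  proof -
    have i: "integrable lborel (\<lambda>x. indicator (box a b) x * p x)" "integrable lborel (\<lambda>x. indicator (box a b) x * q x)"
      using integrable_mult_indicator[OF _ pi, of "box a b"] integrable_mult_indicator[OF _ qi, of "box a b"] by simp_all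
    have "(LINT x|lborel. indicator (box a b) x * p x) - (LINT x|lborel. indicator (box a b) x * q x)
        = (LINT x|lborel. indicator (box a b) x * p x - indicator (box a b) x * q x)"
      using i by simp
    also have "\<dots> = (LINT x|lborel. indicator (box a b) x * f x)"
      by (intro Bochner_Integration.integral_cong) (auto simp: p_def q_def max_def split: split_indicator)
    finally have "(LINT x|lborel. indicator (box a b) x * p x) = (LINT x|lborel. indicator (box a b) x * q x)"
      using zero by simp
    then show ?thesis using box_int[OF pi] box_int[OF qi] by (simp add: p_def q_def)
  qed
  have "density lborel (\<lambda>x. ennreal (p x)) = density lborel (\<lambda>x. ennreal (q x))"
  proof (rule measure_eqI_generator_eq)
    let ?E = "range (\<lambda>(a, b). box a b::'a set)"
    show "Int_stable ?E"
      by (auto simp: Int_stable_def box_Int_box)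
    show "?E \<subseteq> Pow UNIV" "sets (density lborel (\<lambda>x. ennreal (p x))) = sigma_sets UNIV ?E"
      "sets (density lborel (\<lambda>x. ennreal (q x))) = sigma_sets UNIV ?E"
      by (simp_all add: borel_eq_box)
    let ?A = "\<lambda>n::nat. box (- (real n *\<^sub>R One)) (real n *\<^sub>R One) :: 'a set"
    show "range ?A \<subseteq> ?E" "(\<Union>i. ?A i) = UNIV"
      unfolding UN_box_eq_UNIV by auto
    show "emeasure (density lborel (\<lambda>x. ennreal (p x))) (?A i) \<noteq> \<infinity>" for i
      using box_int[OF pi] by (simp add: p_def)
    show "emeasure (density lborel (\<lambda>x. ennreal (p x))) X = emeasure (density lborel (\<lambda>x. ennreal (q x))) X"
      if "X \<in> ?E" for X
      using that eq_box by auto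
  qed
  then have "AE x in lborel. ennreal (p x) = ennreal (q x)"
    by (rule sigma_finite_measure.density_unique[OF sigma_finite_lborel pe qe])
  then show ?thesis
    by eventually_elim (auto simp: p_def q_def max_def split: if_splits)
qed

lemma AE_lebesgue_zero_if_box_integrals_zero:
  fixes f :: "'a::euclidean_space \<Rightarrow> real"
  assumes f: "integrable lebesgue f"
    and zero: "\<And>a b. (LINT x|lebesgue. indicator (box a b) x * f x) = 0"
  shows "AE x in lebesgue. f x = 0"
proof -
  obtain g where g: "g \<in> borel_measurable lborel" and fg: "AE x in lborel. f x = g x"
    using completion_ex_borel_measurable_real[OF borel_measurable_integrable[OF f]] by blast
  have fg': "AE x in lebesgue. f x = g x" using fg by (rule AE_completion)
  have gm: "g \<in> borel_measurable lebesgue" using g by (rule measurable_completion)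
  have "integrable lebesgue g"
    using integrable_cong_AE_imp[OF f gm] fg' by (simp add: eq_commute)
  then have gi: "integrable lborel g" by (simp only: integrable_completion[OF g])
  have "(LINT x|lborel. indicator (box a b) x * g x) = 0" for a b
  proof -
    have m: "(\<lambda>x. indicator (box a b) x * g x) \<in> borel_measurable lborel" using g by simp
    have "(LINT x|lborel. indicator (box a b) x * g x) = (LINT x|lebesgue. indicator (box a b) x * g x)"
      by (rule integral_completion[OF m, symmetric])
    also have "\<dots> = (LINT x|lebesgue. indicator (box a b) x * f x)"
    proof (rule integral_cong_AE)
      show "(\<lambda>x. indicator (box a b) x * g x) \<in> borel_measurable lebesgue" using m by (rule measurable_completion)
      have "(\<lambda>x. indicator (box a b) x :: real) \<in> borel_measurable lebesgue"
        by (rule measurable_completion) simp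
      then show "(\<lambda>x. indicator (box a b) x * f x) \<in> borel_measurable lebesgue"
        by (intro borel_measurable_times borel_measurable_integrable[OF f])
      show "AE x in lebesgue. indicator (box a b) x * g x = indicator (box a b) x * f x"
        using fg' by eventually_elim simp
    qed
    finally show ?thesis using zero by simp
  qed
  from AE_zero_if_box_integrals_zero[OF gi this]
  have "AE x in lebesgue. g x = 0" by (rule AE_completion)
  with fg' show ?thesis by eventually_elim simp
qed

section \<open>Continuously differentiable functions of bounded support\<close>

lemma continuous_bounded_support_L2:
  fixes f :: "real^'d \<Rightarrow> 'a::euclidean_space"
  assumes "continuous_on UNIV f" and "\<And>x. norm x > R \<Longrightarrow> f x = 0" and S: "S \<in> sets lebesgue"
  shows "f \<in> L2 S"
proof -
  have fm: "f \<in> borel_measurable borel" using assms(1) by (rule borel_measurable_continuous_onI)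
  have fl: "f \<in> borel_measurable lebesgue"
    by (rule measurable_completion) (use fm in simp)
  then have m: "f \<in> borel_measurable (lebesgue_on S)"
    by (rule measurable_restrict_space1)
  have "bounded (f ` cball 0 R)"
    by (intro compact_imp_bounded compact_continuous_image continuous_on_subset[OF assms(1)]) auto
  then obtain K where "\<forall>y\<in>f ` cball 0 R. norm y \<le> K" unfolding bounded_iff by blast
  then have K: "norm (f x) \<le> K" if "norm x \<le> R" for x using that by simp
  have "integrable lebesgue (\<lambda>x. K^2 * indicator (cball 0 R) x)"
    by (intro integrable_mult_right integrable_real_indicator) (auto intro: emeasure_bounded_finite[unfolded infinity_ennreal_def])
  then have "integrable lebesgue (\<lambda>x. (norm (f x))^2)"
  proof (rule Bochner_Integration.integrable_bound)
    show "(\<lambda>x. (norm (f x))\<^sup>2) \<in> borel_measurable lebesgue"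
      by (intro borel_measurable_power measurable_compose[OF fl]) simp
    have "(norm (f x))^2 \<le> K^2 * indicator (cball 0 R) x" for x
      using K[of x] assms(2)[of x] by (cases "norm x \<le> R") (auto intro: power_mono)
    then show "AE x in lebesgue. norm ((norm (f x))\<^sup>2) \<le> norm (K\<^sup>2 * indicator (cball 0 R) x)"
      by (intro AE_I2) (simp add: order_trans[OF _ abs_ge_self])
  qed
  then have "integrable lebesgue (\<lambda>x. indicator S x *\<^sub>R (norm (f x))^2)"
    by (rule integrable_mult_indicator[OF S])
  then have "integrable (lebesgue_on S) (\<lambda>x. (norm (f x))^2)"
    using S by (subst integrable_restrict_space) auto
  with m show ?thesis unfolding L2_def by blast
qed

text \<open>
  Of the test functions only this much is used for calculus; unlike them, the functions of this class
  are not attached to a domain.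
\<close>

definition C1c :: "(real^'d \<Rightarrow> real) set" where
  "C1c = {\<phi>. (\<forall>x. \<phi> differentiable (at x)) \<and> (\<forall>i. continuous_on UNIV (partial_deriv i \<phi>)) \<and>
     bounded {x. \<phi> x \<noteq> 0}}"

lemma test_function_C1c: "\<phi> \<in> test_functions \<Omega> \<Longrightarrow> \<phi> \<in> C1c"
proof -
  assume \<phi>: "\<phi> \<in> test_functions \<Omega>"
  then have "Ck (Suc 0) \<phi>" "bounded (closure {x. \<phi> x \<noteq> 0})" unfolding test_functions_def
    by (blast, blast intro: compact_imp_bounded)
  then show ?thesis unfolding C1c_def using bounded_subset[OF _ closure_subset] by auto
qed

lemma C1c_has_derivative: "\<phi> \<in> C1c \<Longrightarrow> (\<phi> has_derivative (\<lambda>h. gradient \<phi> x \<bullet> h)) (at x)"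
proof -
  assume "\<phi> \<in> C1c"
  then have d: "(\<phi> has_derivative frechet_derivative \<phi> (at x)) (at x)"
    by (simp add: C1c_def frechet_derivative_works)
  have "frechet_derivative \<phi> (at x) h = gradient \<phi> x \<bullet> h" for h
  proof -
    note lin = has_derivative_linear[OF d]
    have "(\<Sum>i\<in>UNIV. h $ i *\<^sub>R axis i 1) = h"
      using basis_expansion[of h] by (simp only: scalar_mult_eq_scaleR)
    then have "frechet_derivative \<phi> (at x) h = frechet_derivative \<phi> (at x) (\<Sum>i\<in>UNIV. h $ i *\<^sub>R axis i 1)"
      by (simp only:)
    also have "\<dots> = (\<Sum>i\<in>UNIV. h $ i * frechet_derivative \<phi> (at x) (axis i 1))"
      by (simp add: linear_sum[OF lin] linear_cmul[OF lin])
    also have "\<dots> = gradient \<phi> x \<bullet> h"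
      by (simp add: gradient_def partial_deriv_def inner_vec_def mult.commute)
    finally show ?thesis .
  qed
  then have eq: "frechet_derivative \<phi> (at x) = (\<lambda>h. gradient \<phi> x \<bullet> h)" by (rule ext)
  show ?thesis using d unfolding eq .
qed

lemma C1c_continuous: "\<phi> \<in> C1c \<Longrightarrow> continuous_on UNIV \<phi>"
  by (rule has_derivative_continuous_on) (rule has_derivative_at_withinI[OF C1c_has_derivative])

lemma C1c_gradient_continuous: "\<phi> \<in> C1c \<Longrightarrow> continuous_on UNIV (gradient \<phi>)"
  unfolding gradient_def[abs_def] C1c_def by (auto intro!: continuous_on_vec_lambda)

lemma gradient_nth: "gradient f x $ i = partial_deriv i f x"
  by (simp add: gradient_def)

lemma C1c_gradient_zero:
  assumes \<phi>: "\<phi> \<in> C1c" and "open U" "x \<in> U" and z: "\<And>y. y \<in> U \<Longrightarrow> \<phi> y = 0"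
  shows "gradient \<phi> x = 0"
proof -
  have "((\<lambda>_. 0) has_derivative (\<lambda>h. gradient \<phi> x \<bullet> h)) (at x)"
    by (rule has_derivative_transform_within_open[OF C1c_has_derivative[OF \<phi>] assms(2,3)]) (simp add: z)
  then have "(\<lambda>h. gradient \<phi> x \<bullet> h) = (\<lambda>h. 0)"
    by (rule has_derivative_unique) (rule has_derivative_const)
  then have "gradient \<phi> x \<bullet> gradient \<phi> x = 0" by (rule fun_cong)
  then show ?thesis by simp
qed

lemma test_function_gradient_zero:
  assumes "\<phi> \<in> test_functions \<Omega>" "x \<notin> \<Omega>" shows "\<phi> x = 0" "gradient \<phi> x = 0"
proof -
  have c: "x \<in> - closure {x. \<phi> x \<noteq> 0}" using assms by (auto simp: test_functions_def)
  then show "\<phi> x = 0" using closure_subset[of "{x. \<phi> x \<noteq> 0}"] by blast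
  show "gradient \<phi> x = 0"
    using test_function_C1c[OF assms(1)] _ c
  proof (rule C1c_gradient_zero)
    fix y assume "y \<in> - closure {x. \<phi> x \<noteq> 0}"
    then show "\<phi> y = 0" using closure_subset[of "{x. \<phi> x \<noteq> 0}"] by blast
  qed (simp add: open_Compl)
qed

lemma C1c_bounds:
  assumes \<phi>: "\<phi> \<in> C1c"
  obtains R K where "R > 0" "K \<ge> 0" "\<And>x. norm x > R \<Longrightarrow> \<phi> x = 0" "\<And>x. norm x > R \<Longrightarrow> gradient \<phi> x = 0"
    "\<And>x. norm (gradient \<phi> x) \<le> K"
proof -
  have "bounded {x. \<phi> x \<noteq> 0}" using \<phi> by (simp add: C1c_def)
  then obtain R where R: "R > 0" "\<And>x. \<phi> x \<noteq> 0 \<Longrightarrow> norm x \<le> R"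
    unfolding bounded_pos by blast
  then have z: "\<phi> x = 0" if "norm x > R" for x using that by fastforce
  have gz: "gradient \<phi> x = 0" if "norm x > R" for x
  proof (rule C1c_gradient_zero[OF \<phi>])
    show "open (- cball (0::real^'a) R)" by (simp add: open_Compl)
  qed (use that z in auto)
  have "bounded (gradient \<phi> ` cball 0 R)"
    by (intro compact_imp_bounded compact_continuous_image continuous_on_subset[OF C1c_gradient_continuous[OF \<phi>]]) auto
  then obtain K where K: "K > 0" "\<And>x. norm x \<le> R \<Longrightarrow> norm (gradient \<phi> x) \<le> K" by (auto simp: bounded_pos)
  then have "norm (gradient \<phi> x) \<le> K" for x using gz[of x] by (cases "norm x \<le> R") auto
  with R z gz K show ?thesis using that[of R K] by auto
qed

lemma C1c_Lipschitz:
  assumes \<phi>: "\<phi> \<in> C1c" and K: "\<And>x. norm (gradient \<phi> x) \<le> K"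
  shows "\<bar>\<phi> (x + h) - \<phi> x\<bar> \<le> K * norm h"
proof -
  have "norm (\<phi> (x + h) - \<phi> x) \<le> K * norm (x + h - x)"
  proof (rule differentiable_bound[where S = UNIV])
    fix y :: "real^'a"
    show "(\<phi> has_derivative (\<lambda>h. gradient \<phi> y \<bullet> h)) (at y within UNIV)" using C1c_has_derivative[OF \<phi>] by simp
    show "onorm (\<lambda>h. gradient \<phi> y \<bullet> h) \<le> K"
    proof (rule onorm_le)
      fix h :: "real^'a"
      have "norm (gradient \<phi> y \<bullet> h) \<le> norm (gradient \<phi> y) * norm h" by (simp add: Cauchy_Schwarz_ineq2)
      also have "\<dots> \<le> K * norm h" by (intro mult_right_mono K) simp
      finally show "norm (gradient \<phi> y \<bullet> h) \<le> K * norm h" .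
    qed
  qed auto
  then show ?thesis by simp
qed

lemma C1c_L2:
  assumes "\<phi> \<in> C1c" and S: "S \<in> sets lebesgue" shows "\<phi> \<in> L2 S"
proof (rule C1c_bounds[OF assms(1)])
  fix R :: real assume z: "\<And>x. norm x > R \<Longrightarrow> \<phi> x = 0"
  from continuous_bounded_support_L2[OF C1c_continuous[OF assms(1)] z S] show ?thesis .
qed

lemma C1c_gradient_L2:
  assumes "\<phi> \<in> C1c" and S: "S \<in> sets lebesgue" shows "gradient \<phi> \<in> L2 S"
proof (rule C1c_bounds[OF assms(1)])
  fix R :: real assume z: "\<And>x. norm x > R \<Longrightarrow> gradient \<phi> x = 0"
  from continuous_bounded_support_L2[OF C1c_gradient_continuous[OF assms(1)] z S] show ?thesis .
qed

section \<open>The fundamental lemma of the calculus of variations\<close>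

lemma open_in_sets_lebesgue: "open S \<Longrightarrow> S \<in> sets lebesgue"
  by (simp add: borel_open sets_completionI_sets)

text \<open>
  Testing with \<open>box_bump\<close> gives vanishing integrals over all boxes whose closure lies in the
  domain.  To have all boxes available, the function is first cut off to such a box, which works
  because boxes are closed under intersection; countably many of them cover the domain.
\<close>

theorem fundamental_lemma:
  assumes \<Omega>: "open \<Omega>" and g: "g \<in> L2 \<Omega>"
    and zero: "\<And>\<phi>. \<phi> \<in> test_functions \<Omega> \<Longrightarrow> L2_inner \<Omega> g \<phi> = 0"
  shows "AE x in lebesgue_on \<Omega>. g x = (0::real)"
proof -
  note \<Omega>L = open_in_sets_lebesgue[OF \<Omega>]
  have ind: "(\<lambda>x. indicator (box a b) x :: real) \<in> L2 \<Omega>" for a b :: "real^'a"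
  proof -
    have "integrable lebesgue (\<lambda>x. indicator (box a b) x :: real)"
      by (intro integrable_real_indicator) (auto intro: emeasure_bounded_finite[unfolded infinity_ennreal_def])
    from integrable_mult_indicator[OF \<Omega>L this]
    have i: "integrable (lebesgue_on \<Omega>) (\<lambda>x. indicator (box a b) x :: real)"
      using \<Omega>L by (subst integrable_restrict_space) auto
    have "(\<lambda>x. (norm (indicator (box a b) x :: real))^2) = (\<lambda>x. indicator (box a b) x)"
      by (auto split: split_indicator)
    with i borel_measurable_integrable[OF i] show ?thesis unfolding L2_def by simp
  qed
  have sub_zero: "(LINT x|lebesgue_on \<Omega>. g x * indicator (box a b) x) = 0" if ab: "cbox a b \<subseteq> \<Omega>" for a b
  proof -
    have test: "box_bump n a b \<in> test_functions \<Omega>" for n by (rule box_bump_test_function[OF ab])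
    have bL: "box_bump n a b \<in> L2 \<Omega>" for n by (rule C1c_L2[OF test_function_C1c[OF test] \<Omega>L])
    have "(\<lambda>n. LINT x|lebesgue_on \<Omega>. g x * box_bump n a b x) \<longlonglongrightarrow> (LINT x|lebesgue_on \<Omega>. g x * indicator (box a b) x)"
    proof (rule integral_dominated_convergence)
      have i: "integrable (lebesgue_on \<Omega>) (\<lambda>x. g x * indicator (box a b) x)"
        using L2_integrable_inner[OF g ind] by simp
      show "integrable (lebesgue_on \<Omega>) (\<lambda>x. \<bar>g x * indicator (box a b) x\<bar>)"
        using integrable_abs[OF i] .
      show "(\<lambda>x. g x * indicator (box a b) x) \<in> borel_measurable (lebesgue_on \<Omega>)"
        using borel_measurable_integrable[OF i] .
      show "(\<lambda>x. g x * box_bump n a b x) \<in> borel_measurable (lebesgue_on \<Omega>)" for n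
        using borel_measurable_integrable[OF L2_integrable_inner[OF g bL]] by simp
      show "AE x in lebesgue_on \<Omega>. (\<lambda>n. g x * box_bump n a b x) \<longlonglongrightarrow> g x * indicator (box a b) x"
        by (intro AE_I2 tendsto_mult tendsto_const box_bump_tendsto)
      show "AE x in lebesgue_on \<Omega>. norm (g x * box_bump n a b x) \<le> \<bar>g x * indicator (box a b) x\<bar>" for n
      proof (intro AE_I2)
        fix x show "norm (g x * box_bump n a b x) \<le> \<bar>g x * indicator (box a b) x\<bar>"
          using box_bump_range[of n a b x] box_bump_outside[of x a b n]
          by (cases "x \<in> box a b") (auto simp: abs_mult mult_left_le)
      qed
    qed
    moreover have "(LINT x|lebesgue_on \<Omega>. g x * box_bump n a b x) = 0" for n
      using zero[OF test] by (simp add: L2_inner_def)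
    ultimately show ?thesis by (simp add: LIMSEQ_const_iff)
  qed
  have box_zero: "AE x in lebesgue. x \<in> box a b \<longrightarrow> g x = 0" if ab: "cbox a b \<subseteq> \<Omega>" for a b
  proof -
    have bsub: "box a b \<subseteq> \<Omega>" using ab box_subset_cbox by blast
    have eq: "indicator \<Omega> x *\<^sub>R (g x * indicator (box a b) x) = indicator (box a b) x * g x" for x
      using bsub by (auto split: split_indicator)
    have "integrable lebesgue (\<lambda>x. indicator (box a b) x * g x)"
      using L2_integrable_inner[OF g ind[of a b]] \<Omega>L
      by (simp only: integrable_restrict_space sets.Int_space_eq2 eq inner_real_def)
    moreover have "(LINT x|lebesgue. indicator (box c d) x * (indicator (box a b) x * g x)) = 0" for c d
    proof -
      define a' b' where "a' = (\<chi> i. max (a $ i) (c $ i))" and "b' = (\<chi> i. min (b $ i) (d $ i))"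
      have "cbox a' b' \<subseteq> cbox a b" by (auto simp: mem_box_cart a'_def b'_def)
      then have sub: "cbox a' b' \<subseteq> \<Omega>" using ab by blast
      have int: "box c d \<inter> box a b = box a' b'" by (auto simp: mem_box_cart a'_def b'_def)
      have "(LINT x|lebesgue. indicator (box c d) x * (indicator (box a b) x * g x))
          = (LINT x|lebesgue. indicator \<Omega> x *\<^sub>R (g x * indicator (box a' b') x))"
        unfolding int[symmetric] using bsub
        by (intro Bochner_Integration.integral_cong) (auto split: split_indicator)
      also have "\<dots> = (LINT x|lebesgue_on \<Omega>. g x * indicator (box a' b') x)"
        using \<Omega>L by (simp add: integral_restrict_space)
      also have "\<dots> = 0" by (rule sub_zero[OF sub])
      finally show ?thesis .
    qed
    ultimately have "AE x in lebesgue. indicator (box a b) x * g x = 0"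
      by (rule AE_lebesgue_zero_if_box_integrals_zero)
    then show ?thesis by eventually_elim (auto split: split_indicator)
  qed
  define \<F> where "\<F> = {box a b | a b. cbox a b \<subseteq> \<Omega>}"
  obtain \<F>' where F': "\<F>' \<subseteq> \<F>" "countable \<F>'" "\<Union>\<F>' = \<Union>\<F>"
  proof (rule Lindelof)
    show "open B" if "B \<in> \<F>" for B using that open_box unfolding \<F>_def by blast
  qed
  have cover: "\<Omega> \<subseteq> \<Union>\<F>"
  proof
    fix x assume "x \<in> \<Omega>"
    with \<Omega> obtain a b where "cbox a b \<subseteq> \<Omega>" "x \<in> box a b" by (rule open_contains_cbox)
    then show "x \<in> \<Union>\<F>" unfolding \<F>_def by blast
  qed
  have "AE x in lebesgue. \<forall>B\<in>\<F>'. x \<in> B \<longrightarrow> g x = 0"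
    unfolding AE_ball_countable[OF F'(2)]
  proof
    fix B assume "B \<in> \<F>'"
    then obtain a b where "B = box a b" "cbox a b \<subseteq> \<Omega>" using F'(1) unfolding \<F>_def by blast
    then show "AE x in lebesgue. x \<in> B \<longrightarrow> g x = 0" using box_zero[of a b] by simp
  qed
  then have "AE x in lebesgue. x \<in> \<Omega> \<longrightarrow> g x = 0"
    by eventually_elim (use cover F'(3) in blast)
  then show ?thesis using \<Omega>L by (simp add: AE_restrict_space_iff)
qed

section \<open>Difference quotients and integration by parts\<close>

lemma partial_deriv_mult:
  assumes "f differentiable (at x)" "g differentiable (at x)"
  shows "partial_deriv i (\<lambda>x. f x * g x) x = f x * partial_deriv i g x + partial_deriv i f x * g x"
proof -
  have "((\<lambda>x. f x * g x) has_derivative (\<lambda>h. f x * frechet_derivative g (at x) h + frechet_derivative f (at x) h * g x)) (at x)"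
    using assms unfolding frechet_derivative_works by (rule has_derivative_mult)
  from partial_deriv_eqI[OF this] show ?thesis by (simp add: partial_deriv_def)
qed

lemma C1c_mult:
  assumes f: "f \<in> C1c" and g: "g \<in> C1c"
  shows "(\<lambda>x. f x * g x) \<in> C1c"
proof -
  have d: "f differentiable (at x)" "g differentiable (at x)" for x using assms by (auto simp: C1c_def)
  have "partial_deriv i (\<lambda>x. f x * g x) = (\<lambda>x. f x * partial_deriv i g x + partial_deriv i f x * g x)" for i
    by (rule ext) (rule partial_deriv_mult[OF d])
  moreover have "continuous_on UNIV (\<lambda>x. f x * partial_deriv i g x + partial_deriv i f x * g x)" for i
    using C1c_continuous[OF f] C1c_continuous[OF g] f g unfolding C1c_def
    by (intro continuous_intros) auto
  moreover have "bounded {x. f x * g x \<noteq> 0}"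
    by (rule bounded_subset[of "{x. f x \<noteq> 0}"]) (use f in \<open>auto simp: C1c_def\<close>)
  ultimately show ?thesis using d by (simp add: C1c_def differentiable_mult)
qed

lemma lborel_integral_translate:
  fixes f :: "'a::euclidean_space \<Rightarrow> real"
  assumes "f \<in> borel_measurable borel"
  shows "(LINT x|lborel. f (x + h)) = (LINT x|lborel. f x)"
proof -
  have "(LINT x|lborel. f x) = (LINT x|distr lborel borel ((+) h). f x)" by (simp only: lborel_distr_plus)
  also have "\<dots> = (LINT x|lborel. f (h + x))"
    by (rule integral_distr) (use assms in auto)
  finally show ?thesis by (simp add: add.commute)
qed

lemma continuous_bounded_support_integrable:
  fixes f :: "real^'d \<Rightarrow> real"
  assumes c: "continuous_on UNIV f" and z: "\<And>x. norm x > R \<Longrightarrow> f x = 0"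
  shows "integrable lborel f"
proof -
  have "continuous_on UNIV (\<lambda>x. sqrt \<bar>f x\<bar>)"
    by (intro continuous_intros c)
  then have "(\<lambda>x. sqrt \<bar>f x\<bar>) \<in> L2 UNIV"
    by (rule continuous_bounded_support_L2[where R = R]) (use z in auto)
  then have "integrable lebesgue (\<lambda>x. (norm (sqrt \<bar>f x\<bar>))^2)"
    using L2_integrable_sq by (metis lebesgue_on_UNIV_eq)
  then have i: "integrable lebesgue (\<lambda>x. \<bar>f x\<bar>)" by simp
  have m: "f \<in> borel_measurable lborel" using borel_measurable_continuous_onI[OF c] by simp
  have "(\<lambda>x. \<bar>f x\<bar>) \<in> borel_measurable lborel" using m by simp
  from i[unfolded integrable_completion[OF this]] m show ?thesis
    by (simp only: integrable_abs_iff)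
qed

lemma L2_norm_UNIV_sq:
  fixes f :: "real^'d \<Rightarrow> 'a::euclidean_space"
  assumes "continuous_on UNIV f"
  shows "(L2_norm UNIV f)^2 = (LINT x|lborel. (norm (f x))^2)"
proof -
  have m: "(\<lambda>x. (norm (f x))^2) \<in> borel_measurable lborel"
    using borel_measurable_continuous_onI[of "\<lambda>x. (norm (f x))^2"] assms by (simp add: continuous_intros)
  have "0 \<le> (LINT x|lborel. (norm (f x))^2)" by (intro integral_nonneg_AE) simp
  then show ?thesis
    unfolding L2_norm_def lebesgue_on_UNIV_eq integral_completion[OF m] by simp
qed

lemma L2_norm_UNIV_translate:
  fixes f :: "real^'d \<Rightarrow> real"
  assumes c: "continuous_on UNIV f"
  shows "L2_norm UNIV (\<lambda>x. f (x + h)) = L2_norm UNIV f"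
proof -
  have c': "continuous_on UNIV (\<lambda>x. f (x + h))"
    by (rule continuous_on_compose2[OF c]) (auto intro!: continuous_intros)
  have "(\<lambda>x. (norm (f x))^2) \<in> borel_measurable borel"
    by (rule borel_measurable_continuous_onI) (intro continuous_intros c)
  from lborel_integral_translate[OF this, of h]
  have "(L2_norm UNIV (\<lambda>x. f (x + h)))^2 = (L2_norm UNIV f)^2"
    by (simp add: L2_norm_UNIV_sq[OF c] L2_norm_UNIV_sq[OF c'])
  then show ?thesis by (metis L2_norm_nonneg power2_eq_iff_nonneg)
qed

definition diff_quot :: "(real^'d \<Rightarrow> real) \<Rightarrow> real^'d \<Rightarrow> nat \<Rightarrow> real^'d \<Rightarrow> real" where
  "diff_quot \<phi> v n x = real (Suc n) * (\<phi> (x + (1 / real (Suc n)) *\<^sub>R v) - \<phi> x)"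

lemma diff_quot_tendsto:
  assumes "\<phi> \<in> C1c" shows "(\<lambda>n. diff_quot \<phi> v n x) \<longlonglongrightarrow> gradient \<phi> x \<bullet> v"
proof -
  have "((\<lambda>t. x + t *\<^sub>R v) has_derivative (\<lambda>t. t *\<^sub>R v)) (at 0)"
    by (auto intro!: derivative_eq_intros)
  moreover have "(\<phi> has_derivative (\<lambda>h. gradient \<phi> x \<bullet> h)) (at (x + 0 *\<^sub>R v))"
    using C1c_has_derivative[OF assms] by simp
  ultimately have "((\<lambda>t. \<phi> (x + t *\<^sub>R v)) has_derivative (\<lambda>t. gradient \<phi> x \<bullet> (t *\<^sub>R v))) (at 0)"
    by (rule has_derivative_compose)
  moreover have "(\<lambda>t. gradient \<phi> x \<bullet> (t *\<^sub>R v)) = (*) (gradient \<phi> x \<bullet> v)"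
    by (simp add: fun_eq_iff mult.commute)
  ultimately have "((\<lambda>t. \<phi> (x + t *\<^sub>R v)) has_real_derivative (gradient \<phi> x \<bullet> v)) (at 0)"
    unfolding has_field_derivative_def by simp
  then have "(\<lambda>t. (\<phi> (x + t *\<^sub>R v) - \<phi> x) / t) \<midarrow>0\<rightarrow> gradient \<phi> x \<bullet> v"
    by (simp add: DERIV_def)
  moreover have "filterlim (\<lambda>n. 1 / real (Suc n)) (at 0) sequentially"
    unfolding filterlim_at using LIMSEQ_Suc[OF lim_1_over_n[where 'a = real]] by auto
  ultimately have "(\<lambda>n. (\<phi> (x + (1 / real (Suc n)) *\<^sub>R v) - \<phi> x) / (1 / real (Suc n))) \<longlonglongrightarrow> gradient \<phi> x \<bullet> v"
    by (rule filterlim_compose)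
  then show ?thesis by (simp add: diff_quot_def mult.commute)
qed

lemma continuous_shift:
  fixes f :: "real^'d \<Rightarrow> 'b::topological_space"
  shows "continuous_on UNIV f \<Longrightarrow> continuous_on UNIV (\<lambda>x. f (x + h))"
  by (rule continuous_on_compose2[of UNIV f]) (auto intro!: continuous_intros)

text \<open>
  A common bound and a common bounded support: this is the integrable majorant for the two
  passages to the limit below.
\<close>

lemma diff_quot_bounds:
  assumes \<phi>: "\<phi> \<in> C1c"
  obtains R K where "K \<ge> 0" "\<And>n x. norm x > R \<Longrightarrow> diff_quot \<phi> v n x = 0"
    "\<And>n x. \<bar>diff_quot \<phi> v n x\<bar> \<le> K" "\<And>n. continuous_on UNIV (diff_quot \<phi> v n)"
proof -
  obtain R K where RK: "R > 0" "K \<ge> 0" "\<And>x. norm x > R \<Longrightarrow> \<phi> x = 0"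
    "\<And>x. norm (gradient \<phi> x) \<le> K" using C1c_bounds[OF \<phi>] by metis
  have z: "diff_quot \<phi> v n x = 0" if "norm x > R + norm v" for n x
  proof -
    have "norm ((1 / real (Suc n)) *\<^sub>R v) \<le> norm v"
      by (simp add: divide_le_eq_1 mult_left_le_one_le divide_simps) (simp add: mult_left_le algebra_simps)
    then have "norm (x + (1 / real (Suc n)) *\<^sub>R v) > R"
      using that norm_triangle_ineq2[of x "- ((1 / real (Suc n)) *\<^sub>R v)"] by simp
    moreover have "norm x > R" using that norm_ge_zero[of v] by linarith
    ultimately show ?thesis using RK(3) by (simp add: diff_quot_def)
  qed
  have b: "\<bar>diff_quot \<phi> v n x\<bar> \<le> K * norm v" for n x
  proof -
    have "\<bar>diff_quot \<phi> v n x\<bar> = real (Suc n) * \<bar>\<phi> (x + (1 / real (Suc n)) *\<^sub>R v) - \<phi> x\<bar>"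
      by (simp add: diff_quot_def abs_mult)
    also have "\<dots> \<le> real (Suc n) * (K * norm ((1 / real (Suc n)) *\<^sub>R v))"
      by (intro mult_left_mono C1c_Lipschitz[OF \<phi> RK(4)]) simp
    also have "\<dots> = K * norm v" by simp
    finally show ?thesis .
  qed
  have "continuous_on UNIV (diff_quot \<phi> v n)" for n
    unfolding diff_quot_def[abs_def] by (intro continuous_intros continuous_shift C1c_continuous[OF \<phi>])
  with z b RK(2) show ?thesis using that[of "K * norm v" "R + norm v"] by simp
qed

text \<open>
  The divergence theorem without boundary terms: the difference quotients have integral zero
  because the integral is invariant under translations.
\<close>

theorem C1c_integral_gradient:
  assumes \<phi>: "\<phi> \<in> C1c" shows "(LINT x|lborel. gradient \<phi> x \<bullet> v) = 0"
proof -
  obtain R K where RK: "K \<ge> 0" "\<And>n x. norm x > R \<Longrightarrow> diff_quot \<phi> v n x = 0"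
    "\<And>n x. \<bar>diff_quot \<phi> v n x\<bar> \<le> K" "\<And>n. continuous_on UNIV (diff_quot \<phi> v n)"
    using diff_quot_bounds[OF \<phi>] by metis
  obtain R' where R': "\<And>x. norm x > R' \<Longrightarrow> \<phi> x = 0" using C1c_bounds[OF \<phi>] by metis
  have pm: "\<phi> \<in> borel_measurable borel" by (rule borel_measurable_continuous_onI[OF C1c_continuous[OF \<phi>]])
  have "(\<lambda>n. LINT x|lborel. diff_quot \<phi> v n x) \<longlonglongrightarrow> (LINT x|lborel. gradient \<phi> x \<bullet> v)"
  proof (rule integral_dominated_convergence)
    show "integrable lborel (\<lambda>x. K * indicator (cball 0 R) x)"
      by (intro integrable_mult_right integrable_real_indicator)
         (auto intro: emeasure_bounded_finite[unfolded infinity_ennreal_def])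
    show "(\<lambda>x. gradient \<phi> x \<bullet> v) \<in> borel_measurable lborel"
      using borel_measurable_continuous_onI[OF C1c_gradient_continuous[OF \<phi>]] by simp
    show "diff_quot \<phi> v n \<in> borel_measurable lborel" for n
      using borel_measurable_continuous_onI[OF RK(4)] by simp
    show "AE x in lborel. (\<lambda>n. diff_quot \<phi> v n x) \<longlonglongrightarrow> gradient \<phi> x \<bullet> v"
      by (intro AE_I2 diff_quot_tendsto \<phi>)
    show "AE x in lborel. norm (diff_quot \<phi> v n x) \<le> K * indicator (cball 0 R) x" for n
    proof (intro AE_I2)
      fix x show "norm (diff_quot \<phi> v n x) \<le> K * indicator (cball 0 R) x"
        using RK(2)[of x n] RK(3)[of n x] by (cases "norm x \<le> R") auto
    qed
  qed
  moreover have "(LINT x|lborel. diff_quot \<phi> v n x) = 0" for n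
  proof -
    have i: "integrable lborel \<phi>" by (rule continuous_bounded_support_integrable[OF C1c_continuous[OF \<phi>] R'])
    have sh: "integrable lborel (\<lambda>x. \<phi> (x + h))" for h
    proof (rule continuous_bounded_support_integrable[OF continuous_shift[OF C1c_continuous[OF \<phi>]]])
      fix x :: "real^'a" assume "norm x > R' + norm h"
      then show "\<phi> (x + h) = 0" using norm_triangle_ineq2[of x "- h"] by (intro R') simp
    qed
    show ?thesis unfolding diff_quot_def using i sh lborel_integral_translate[OF pm] by simp
  qed
  ultimately show ?thesis by (simp add: LIMSEQ_const_iff)
qed

lemma L2_inner_eq_lborel:
  fixes f g :: "real^'d \<Rightarrow> 'a::euclidean_space"
  assumes \<Omega>: "open \<Omega>" and c: "continuous_on UNIV f" "continuous_on UNIV g"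
    and z: "\<And>x. x \<notin> \<Omega> \<Longrightarrow> f x \<bullet> g x = 0"
  shows "L2_inner \<Omega> f g = (LINT x|lborel. f x \<bullet> g x)"
proof -
  have m: "(\<lambda>x. f x \<bullet> g x) \<in> borel_measurable lborel"
    using borel_measurable_continuous_onI[OF c(1)] borel_measurable_continuous_onI[OF c(2)] by simp
  have "L2_inner \<Omega> f g = (LINT x|lebesgue. indicator \<Omega> x *\<^sub>R (f x \<bullet> g x))"
    unfolding L2_inner_def using open_in_sets_lebesgue[OF \<Omega>] by (subst integral_restrict_space) auto
  also have "\<dots> = (LINT x|lebesgue. f x \<bullet> g x)"
    by (intro Bochner_Integration.integral_cong) (use z in \<open>auto split: split_indicator\<close>)
  also have "\<dots> = (LINT x|lborel. f x \<bullet> g x)" by (rule integral_completion[OF m])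
  finally show ?thesis .
qed

lemma test_function_weak_grad:
  assumes \<Omega>: "open \<Omega>" and \<phi>: "\<phi> \<in> test_functions \<Omega>"
  shows "is_weak_grad \<Omega> \<phi> (gradient \<phi>)"
  unfolding is_weak_grad_def
proof (intro conjI ballI allI)
  note \<phi>C = test_function_C1c[OF \<phi>]
  show "gradient \<phi> \<in> L2 \<Omega>" by (rule C1c_gradient_L2[OF \<phi>C open_in_sets_lebesgue[OF \<Omega>]])
  fix \<psi> i assume \<psi>: "\<psi> \<in> test_functions \<Omega>"
  note \<psi>C = test_function_C1c[OF \<psi>]
  note prod = C1c_mult[OF \<phi>C \<psi>C]
  have d: "\<phi> differentiable (at x)" "\<psi> differentiable (at x)" for x using \<phi>C \<psi>C by (auto simp: C1c_def)
  have c: "continuous_on UNIV \<phi>" "continuous_on UNIV \<psi>" "continuous_on UNIV (partial_deriv i \<phi>)" "continuous_on UNIV (partial_deriv i \<psi>)"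
    using \<phi>C \<psi>C C1c_continuous[OF \<phi>C] C1c_continuous[OF \<psi>C] by (auto simp: C1c_def)
  obtain R where R: "\<And>x. norm x > R \<Longrightarrow> \<phi> x = 0" using C1c_bounds[OF \<phi>C] by metis
  obtain R' where R': "\<And>x. norm x > R' \<Longrightarrow> \<psi> x = 0" using C1c_bounds[OF \<psi>C] by metis
  have i1: "integrable lborel (\<lambda>x. \<phi> x * partial_deriv i \<psi> x)"
    by (rule continuous_bounded_support_integrable[where R = R]) (use R c in \<open>auto intro!: continuous_intros\<close>)
  have i2: "integrable lborel (\<lambda>x. partial_deriv i \<phi> x * \<psi> x)"
    by (rule continuous_bounded_support_integrable[where R = R']) (use R' c in \<open>auto intro!: continuous_intros\<close>)
  \<comment> \<open>Integration by parts is the product rule under a vanishing integral.\<close>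
  have "0 = (LINT x|lborel. gradient (\<lambda>x. \<phi> x * \<psi> x) x \<bullet> axis i 1)"
    by (rule C1c_integral_gradient[OF prod, symmetric])
  also have "\<dots> = (LINT x|lborel. \<phi> x * partial_deriv i \<psi> x + partial_deriv i \<phi> x * \<psi> x)"
    by (simp add: inner_axis gradient_nth partial_deriv_mult[OF d])
  also have "\<dots> = (LINT x|lborel. \<phi> x * partial_deriv i \<psi> x) + (LINT x|lborel. partial_deriv i \<phi> x * \<psi> x)"
    using i1 i2 by simp
  finally have "(LINT x|lborel. \<phi> x * partial_deriv i \<psi> x) = - (LINT x|lborel. partial_deriv i \<phi> x * \<psi> x)"
    by simp
  moreover have "L2_inner \<Omega> \<phi> (partial_deriv i \<psi>) = (LINT x|lborel. \<phi> x * partial_deriv i \<psi> x)"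
    using L2_inner_eq_lborel[OF \<Omega> c(1) c(4)] test_function_gradient_zero(1)[OF \<phi>] by simp
  moreover have "L2_inner \<Omega> (partial_deriv i \<phi>) \<psi> = (LINT x|lborel. partial_deriv i \<phi> x * \<psi> x)"
    using L2_inner_eq_lborel[OF \<Omega> c(3) c(2)] test_function_gradient_zero(1)[OF \<psi>] by simp
  ultimately show "L2_inner \<Omega> \<phi> (partial_deriv i \<psi>) = - L2_inner \<Omega> (\<lambda>x. gradient \<phi> x $ i) \<psi>"
    by (simp add: gradient_nth[abs_def])
qed

section \<open>Translations and the Poincare inequality\<close>

text \<open>
  The function \<open>w \<mapsto> \<parallel>\<phi>(\<cdot> + w) - \<phi>\<parallel>\<close> is subadditive, since a translation by \<open>w + w'\<close> may be done in
  two steps and the norm does not see the first one.  Hence its value at \<open>v\<close> is at most \<open>n\<close> times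
  its value at \<open>v / n\<close>, the norm of a difference quotient, and \<open>n\<close> may tend to infinity.
\<close>

theorem C1c_translation_bound:
  assumes \<phi>: "\<phi> \<in> C1c"
  shows "L2_norm UNIV (\<lambda>x. \<phi> (x + v) - \<phi> x) \<le> norm v * L2_norm UNIV (gradient \<phi>)"
proof -
  define T where "T w x = \<phi> (x + w) - \<phi> x" for w x
  note c = C1c_continuous[OF \<phi>] and gc = C1c_gradient_continuous[OF \<phi>]
  obtain R where R: "\<And>x. norm x > R \<Longrightarrow> \<phi> x = 0" "\<And>x. norm x > R \<Longrightarrow> gradient \<phi> x = 0" using C1c_bounds[OF \<phi>] by metis
  have Tc: "continuous_on UNIV (T w)" for w
    unfolding T_def by (intro continuous_intros continuous_shift c)
  have shL: "(\<lambda>x. \<phi> (x + h)) \<in> L2 UNIV" for h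
  proof (rule continuous_bounded_support_L2[OF continuous_shift[OF c]])
    fix x :: "real^'a" assume "norm x > R + norm h"
    then show "\<phi> (x + h) = 0" using norm_triangle_ineq2[of x "- h"] by (intro R) simp
  qed simp
  have TL: "T w \<in> L2 UNIV" for w
    unfolding T_def using L2_diff[OF shL[of w] shL[of 0]] by simp
  have TLs: "(\<lambda>x. T w (x + h)) \<in> L2 UNIV" for w h
    unfolding T_def using L2_diff[OF shL[of "h + w"] shL[of h]] by (simp add: add.assoc)
  have mult: "L2_norm UNIV (T (real m *\<^sub>R w)) \<le> real m * L2_norm UNIV (T w)" for m w
  proof (induction m)
    case 0
    then show ?case by (simp add: T_def L2_norm_def)
  next
    case (Suc m)
    have "T (real (Suc m) *\<^sub>R w) = (\<lambda>x. T (real m *\<^sub>R w) (x + w) + T w x)"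
      by (rule ext) (simp add: T_def algebra_simps)
    then have "L2_norm UNIV (T (real (Suc m) *\<^sub>R w)) \<le> L2_norm UNIV (\<lambda>x. T (real m *\<^sub>R w) (x + w)) + L2_norm UNIV (T w)"
      using L2_norm_triangle[OF TLs TL] by simp
    also have "\<dots> = L2_norm UNIV (T (real m *\<^sub>R w)) + L2_norm UNIV (T w)"
      by (simp add: L2_norm_UNIV_translate[OF Tc])
    finally show ?case using Suc by (simp add: algebra_simps)
  qed
  have dq: "L2_norm UNIV (T v) \<le> L2_norm UNIV (diff_quot \<phi> v n)" for n
  proof -
    have "L2_norm UNIV (T v) \<le> real (Suc n) * L2_norm UNIV (T ((1 / real (Suc n)) *\<^sub>R v))"
      using mult[of "Suc n" "(1 / real (Suc n)) *\<^sub>R v"] by simp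
    also have "\<dots> = L2_norm UNIV (\<lambda>x. real (Suc n) *\<^sub>R T ((1 / real (Suc n)) *\<^sub>R v) x)"
      by (subst L2_norm_scaleR) simp
    finally show ?thesis by (simp add: diff_quot_def[abs_def] T_def)
  qed
  obtain R' K where RK: "K \<ge> 0" "\<And>n x. norm x > R' \<Longrightarrow> diff_quot \<phi> v n x = 0"
    "\<And>n x. \<bar>diff_quot \<phi> v n x\<bar> \<le> K" "\<And>n. continuous_on UNIV (diff_quot \<phi> v n)"
    using diff_quot_bounds[OF \<phi>] by metis
  have gvc: "continuous_on UNIV (\<lambda>x. gradient \<phi> x \<bullet> v)" by (intro continuous_intros gc)
  have "(\<lambda>n. LINT x|lborel. (norm (diff_quot \<phi> v n x))^2) \<longlonglongrightarrow> (LINT x|lborel. (norm (gradient \<phi> x \<bullet> v))^2)"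
  proof (rule integral_dominated_convergence)
    show "integrable lborel (\<lambda>x. K^2 * indicator (cball 0 R') x)"
      by (intro integrable_mult_right integrable_real_indicator)
         (auto intro: emeasure_bounded_finite[unfolded infinity_ennreal_def])
    show "(\<lambda>x. (norm (gradient \<phi> x \<bullet> v))^2) \<in> borel_measurable lborel"
      using borel_measurable_continuous_onI[OF gvc] by simp
    show "(\<lambda>x. (norm (diff_quot \<phi> v n x))^2) \<in> borel_measurable lborel" for n
      using borel_measurable_continuous_onI[OF RK(4)] by simp
    show "AE x in lborel. (\<lambda>n. (norm (diff_quot \<phi> v n x))^2) \<longlonglongrightarrow> (norm (gradient \<phi> x \<bullet> v))^2"
      by (intro AE_I2 tendsto_power tendsto_norm diff_quot_tendsto \<phi>)
    show "AE x in lborel. norm ((norm (diff_quot \<phi> v n x))^2) \<le> K^2 * indicator (cball 0 R') x" for n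
    proof (intro AE_I2)
      fix x show "norm ((norm (diff_quot \<phi> v n x))^2) \<le> K^2 * indicator (cball 0 R') x"
        using RK(2)[of x n] power_mono[OF RK(3)[of n x], of 2] by (cases "norm x \<le> R'") auto
    qed
  qed
  then have "(\<lambda>n. (L2_norm UNIV (diff_quot \<phi> v n))^2) \<longlonglongrightarrow> (L2_norm UNIV (\<lambda>x. gradient \<phi> x \<bullet> v))^2"
    by (simp only: L2_norm_UNIV_sq[OF RK(4)] L2_norm_UNIV_sq[OF gvc])
  then have "(L2_norm UNIV (T v))^2 \<le> (L2_norm UNIV (\<lambda>x. gradient \<phi> x \<bullet> v))^2"
    by (rule LIMSEQ_le_const) (use dq L2_norm_nonneg in \<open>auto intro!: power_mono\<close>)
  then have "L2_norm UNIV (T v) \<le> L2_norm UNIV (\<lambda>x. gradient \<phi> x \<bullet> v)"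
    by (rule power2_le_imp_le) (rule L2_norm_nonneg)
  also have "\<dots> \<le> norm v * L2_norm UNIV (gradient \<phi>)"
  proof (rule L2_dominated(2))
    show "gradient \<phi> \<in> L2 UNIV" by (rule C1c_gradient_L2[OF \<phi>]) simp
    have "(\<lambda>x. gradient \<phi> x \<bullet> v) \<in> L2 UNIV"
      by (rule continuous_bounded_support_L2[OF gvc, of R]) (use R in auto)
    then show "(\<lambda>x. gradient \<phi> x \<bullet> v) \<in> borel_measurable (lebesgue_on UNIV)" by (rule L2_measurable)
    show "AE x in lebesgue_on UNIV. norm (gradient \<phi> x \<bullet> v) \<le> norm v * norm (gradient \<phi> x)"
      using Cauchy_Schwarz_ineq2[of _ v] by (simp add: mult.commute[of "norm v"])
  qed simp
  finally show ?thesis by (simp only: T_def[abs_def])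
qed

text \<open>
  Translating by more than the diameter of the support makes the two copies of \<open>\<phi>\<close> disjoint, and
  then the squared norm of their difference is twice the squared norm of \<open>\<phi>\<close>.
\<close>

theorem C1c_Poincare:
  assumes \<phi>: "\<phi> \<in> C1c" and R: "\<And>x. norm x > R \<Longrightarrow> \<phi> x = 0" and "R > 0"
  shows "L2_norm UNIV \<phi> \<le> 3 * R * L2_norm UNIV (gradient \<phi>)"
proof -
  note c = C1c_continuous[OF \<phi>]
  \<comment> \<open>The support lies in a ball of diameter \<open>2 * R\<close>, so any length above that will do.\<close>
  define v :: "real^'a" where "v = (3 * R) *\<^sub>R axis undefined 1"
  have nv: "norm v = 3 * R" using \<open>R > 0\<close> by (simp add: v_def norm_axis_1)
  have disj: "\<phi> (x + v) * \<phi> x = 0" for x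
  proof (cases "norm x > R")
    case False
    then have "norm (x + v) > R" using norm_triangle_ineq2[of v "- x"] nv \<open>R > 0\<close> by (simp add: add.commute)
    then show ?thesis using R by simp
  qed (use R in simp)
  have sq: "integrable lborel (\<lambda>x. (\<phi> (x + h))^2)" for h
  proof (rule continuous_bounded_support_integrable)
    show "continuous_on UNIV (\<lambda>x. (\<phi> (x + h))\<^sup>2)" by (intro continuous_intros continuous_shift c)
    fix x :: "real^'a" assume "norm x > R + norm h"
    then have "\<phi> (x + h) = 0" using norm_triangle_ineq2[of x "- h"] by (intro R) simp
    then show "(\<phi> (x + h))^2 = 0" by simp
  qed
  have "(L2_norm UNIV (\<lambda>x. \<phi> (x + v) - \<phi> x))^2 = (LINT x|lborel. (norm (\<phi> (x + v) - \<phi> x))^2)"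
    by (rule L2_norm_UNIV_sq) (intro continuous_intros continuous_shift c)
  also have "\<dots> = (LINT x|lborel. (\<phi> (x + v))^2 + (\<phi> (x + 0))^2)"
    using disj by (intro Bochner_Integration.integral_cong) (auto simp: power2_diff algebra_simps)
  also have "\<dots> = (LINT x|lborel. (\<phi> (x + v))^2) + (LINT x|lborel. (\<phi> (x + 0))^2)"
    by (intro Bochner_Integration.integral_add sq)
  also have "\<dots> = 2 * (L2_norm UNIV \<phi>)^2"
    using L2_norm_UNIV_sq[OF c] L2_norm_UNIV_sq[OF continuous_shift[OF c, of v]] L2_norm_UNIV_translate[OF c, of v] by simp
  finally have "(L2_norm UNIV \<phi>)^2 \<le> (L2_norm UNIV (\<lambda>x. \<phi> (x + v) - \<phi> x))^2" by simp
  then have "L2_norm UNIV \<phi> \<le> L2_norm UNIV (\<lambda>x. \<phi> (x + v) - \<phi> x)"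
    by (rule power2_le_imp_le) (rule L2_norm_nonneg)
  also have "\<dots> \<le> norm v * L2_norm UNIV (gradient \<phi>)" by (rule C1c_translation_bound[OF \<phi>])
  finally show ?thesis by (simp add: nv)
qed

section \<open>A Poincare inequality on a grid of cubes\<close>

definition grid_cell :: "real \<Rightarrow> ('d \<Rightarrow> int) \<Rightarrow> (real^'d) set" where
  "grid_cell \<delta> m = {x. \<forall>i. \<lfloor>x $ i / \<delta>\<rfloor> = m i}"

lemma grid_cell_bounds:
  assumes "\<delta> > 0"
  shows "x \<in> grid_cell \<delta> m \<longleftrightarrow> (\<forall>i. \<delta> * m i \<le> x $ i \<and> x $ i < \<delta> * (m i + 1))"
  using assms by (simp add: grid_cell_def floor_eq_iff field_simps)

lemma grid_cell_measure:
  fixes m :: "'d::finite \<Rightarrow> int"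
  assumes "\<delta> > 0"
  shows "grid_cell \<delta> m \<in> sets borel" "emeasure lborel (grid_cell \<delta> m) = ennreal (\<delta> ^ CARD('d))"
proof -
  define l u :: "real^'d" where "l = (\<chi> i. \<delta> * m i)" and "u = (\<chi> i. \<delta> * (m i + 1))"
  have "grid_cell \<delta> m = (\<Inter>i\<in>UNIV. {x. \<delta> * m i \<le> x $ i} \<inter> {x. x $ i < \<delta> * (m i + 1)})"
    using grid_cell_bounds[OF assms] by auto
  also have "\<dots> \<in> sets borel"
    by (intro sets.finite_INT sets.Int borel_closed borel_open closed_halfspace_component_ge_cart
        open_halfspace_component_lt_cart) auto
  finally show b: "grid_cell \<delta> m \<in> sets borel" .
  have le: "l \<bullet> b \<le> u \<bullet> b" and diff: "(u - l) \<bullet> b = \<delta>" if "b \<in> Basis" for b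
    using that assms by (auto simp: Basis_vec_def l_def u_def inner_axis algebra_simps)
  have prod: "(\<Prod>b\<in>Basis. (u - l) \<bullet> b) = \<delta> ^ CARD('d)"
    using diff by simp
  have "box l u \<subseteq> grid_cell \<delta> m" "grid_cell \<delta> m \<subseteq> cbox l u"
    unfolding subset_iff grid_cell_bounds[OF assms] by (auto simp: mem_box_cart l_def u_def less_imp_le)
  then have "emeasure lborel (box l u) \<le> emeasure lborel (grid_cell \<delta> m)"
    "emeasure lborel (grid_cell \<delta> m) \<le> emeasure lborel (cbox l u)"
    using b by (auto intro!: emeasure_mono)
  then show "emeasure lborel (grid_cell \<delta> m) = ennreal (\<delta> ^ CARD('d))"
    using le by (simp add: emeasure_lborel_box emeasure_lborel_cbox prod del: inner_diff_left)
qed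

text \<open>
  The identity between the variance of \<open>\<phi>\<close> on \<open>Q\<close> and the mean of the squared differences.  It
  trades the mean value, which the compactness argument controls, for differences of \<open>\<phi>\<close>, which
  the translation bound controls.
\<close>

lemma variance_double_integral:
  fixes \<phi> :: "real^'d \<Rightarrow> real"
  assumes c: "continuous_on UNIV \<phi>" and z: "\<And>x. norm x > R \<Longrightarrow> \<phi> x = 0"
    and Q: "Q \<in> sets borel" and V: "emeasure lborel Q = ennreal V" "V \<ge> 0"
  shows "(\<integral>\<^sup>+x. \<integral>\<^sup>+y. ennreal (indicator Q x * indicator Q y * (\<phi> x - \<phi> y)^2) \<partial>lborel \<partial>lborel)
    = ennreal (2 * V * (LINT x|lborel. indicator Q x * (\<phi> x)^2) - 2 * (LINT x|lborel. indicator Q x * \<phi> x)^2)"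
proof -
  define s t where "s = (LINT x|lborel. indicator Q x * \<phi> x)" and "t = (LINT x|lborel. indicator Q x * (\<phi> x)^2)"
  have iQ: "integrable lborel (\<lambda>x. indicator Q x :: real)"
    using Q V by (intro integrable_real_indicator) auto
  have mQ: "measure lborel Q = V"
    using V by (simp add: measure_def)
  then have LQ: "(LINT x|lborel. indicator Q x) = V" by simp
  have i1: "integrable lborel (\<lambda>x. indicator Q x * \<phi> x)"
    using integrable_mult_indicator[OF _ continuous_bounded_support_integrable[OF c z], of Q] Q by simp
  have "continuous_on UNIV (\<lambda>x. (\<phi> x)^2)" by (intro continuous_intros c)
  then have "integrable lborel (\<lambda>x. (\<phi> x)^2)"
    by (rule continuous_bounded_support_integrable[of _ R]) (simp add: z)
  then have i2: "integrable lborel (\<lambda>x. indicator Q x * (\<phi> x)^2)"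
    using integrable_mult_indicator[of Q lborel "\<lambda>x. (\<phi> x)^2"] Q by simp
  have inner: "(\<integral>\<^sup>+y. ennreal (indicator Q x * indicator Q y * (\<phi> x - \<phi> y)^2) \<partial>lborel)
      = ennreal (V * (indicator Q x * (\<phi> x)^2) - 2 * s * (indicator Q x * \<phi> x) + t * indicator Q x)" for x
  proof -
    have eq: "indicator Q x * indicator Q y * (\<phi> x - \<phi> y)^2 =
        (indicator Q x * (\<phi> x)^2) * indicator Q y - (2 * (indicator Q x * \<phi> x)) * (indicator Q y * \<phi> y)
        + indicator Q x * (indicator Q y * (\<phi> y)^2)" for y
      by (simp add: power2_diff algebra_simps)
    have i: "integrable lborel (\<lambda>y. indicator Q x * indicator Q y * (\<phi> x - \<phi> y)^2)"
      unfolding eq by (intro Bochner_Integration.integrable_add Bochner_Integration.integrable_diff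
          integrable_mult_right iQ i1 i2)
    have "(LINT y|lborel. indicator Q x * indicator Q y * (\<phi> x - \<phi> y)^2)
        = (indicator Q x * (\<phi> x)^2) * V - (2 * (indicator Q x * \<phi> x)) * s + indicator Q x * t"
      unfolding eq s_def t_def LQ[symmetric] using iQ i1 i2 by simp
    also have "\<dots> = V * (indicator Q x * (\<phi> x)^2) - 2 * s * (indicator Q x * \<phi> x) + t * indicator Q x"
      by (simp add: algebra_simps)
    finally have L: "(LINT y|lborel. indicator Q x * indicator Q y * (\<phi> x - \<phi> y)^2)
        = V * (indicator Q x * (\<phi> x)^2) - 2 * s * (indicator Q x * \<phi> x) + t * indicator Q x" .
    show ?thesis unfolding L[symmetric]
      by (rule nn_integral_eq_integral[OF i]) simp
  qed
  have nn: "0 \<le> V * (indicator Q x * (\<phi> x)^2) - 2 * s * (indicator Q x * \<phi> x) + t * indicator Q x" for x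
  proof (cases "x \<in> Q")
    case True
    have "0 \<le> (LINT y|lborel. indicator Q y * (\<phi> x - \<phi> y)^2)"
      by (intro integral_nonneg_AE) simp
    also have "\<dots> = (LINT y|lborel. (\<phi> x)^2 * indicator Q y - (2 * \<phi> x) * (indicator Q y * \<phi> y) + indicator Q y * (\<phi> y)^2)"
      by (intro Bochner_Integration.integral_cong) (auto simp: power2_diff algebra_simps)
    also have "\<dots> = (\<phi> x)^2 * V - (2 * \<phi> x) * s + t"
      unfolding s_def t_def LQ[symmetric] using iQ i1 i2 by simp
    finally show ?thesis using True by (simp add: algebra_simps)
  qed simp
  have i: "integrable lborel (\<lambda>x. V * (indicator Q x * (\<phi> x)^2) - 2 * s * (indicator Q x * \<phi> x) + t * indicator Q x)"
    by (intro Bochner_Integration.integrable_add Bochner_Integration.integrable_diff integrable_mult_right iQ i1 i2)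
  have "(LINT x|lborel. V * (indicator Q x * (\<phi> x)^2) - 2 * s * (indicator Q x * \<phi> x) + t * indicator Q x)
      = V * t - 2 * s * s + t * V"
    using iQ i1 i2 mQ by (simp flip: s_def t_def)
  also have "\<dots> = 2 * V * t - 2 * s^2" by (simp add: power2_eq_square)
  finally show ?thesis
    unfolding inner s_def[symmetric] t_def[symmetric] using nn_integral_eq_integral[OF i] nn by simp
qed

text \<open>
  Substitute \<open>y = x + h\<close> and exchange the integrals: for fixed \<open>h\<close> the inner integral is the squared
  norm of \<open>\<phi>(\<cdot> + h) - \<phi>\<close>, and \<open>|h|\<close> is at most the dimension times \<open>\<delta>\<close> on the cube.
\<close>

lemma double_integral_translation_bound:
  fixes \<phi> :: "real^'d \<Rightarrow> real"
  assumes \<phi>: "\<phi> \<in> C1c" and "\<delta> > 0"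
  shows "(\<integral>\<^sup>+x. \<integral>\<^sup>+y. ennreal (indicator (cbox (\<chi> i. - \<delta>) (\<chi> i. \<delta>)) (y - x) * (\<phi> x - \<phi> y)^2) \<partial>lborel \<partial>lborel)
    \<le> ennreal ((2 * \<delta>) ^ CARD('d) * (real CARD('d) * \<delta> * L2_norm UNIV (gradient \<phi>))^2)"
proof -
  define H :: "(real^'d) set" where "H = cbox (\<chi> i. - \<delta>) (\<chi> i. \<delta>)"
  define G where "G = (real CARD('d) * \<delta> * L2_norm UNIV (gradient \<phi>))^2"
  have [measurable]: "H \<in> sets borel" by (simp add: H_def)
  have c: "continuous_on UNIV \<phi>" by (rule C1c_continuous[OF \<phi>])
  have [measurable]: "\<phi> \<in> borel_measurable borel" by (rule borel_measurable_continuous_onI[OF c])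
  have eH: "emeasure lborel H = ennreal ((2 * \<delta>) ^ CARD('d))"
  proof -
    have "(\<chi> i. - \<delta>) \<bullet> b \<le> ((\<chi> i. \<delta>) :: real^'d) \<bullet> b \<and> ((\<chi> i. \<delta>) - (\<chi> i. - \<delta>) :: real^'d) \<bullet> b = 2 * \<delta>"
      if "b \<in> Basis" for b
      using that \<open>\<delta> > 0\<close> by (auto simp: Basis_vec_def inner_axis)
    then show ?thesis unfolding H_def by (simp add: emeasure_lborel_cbox del: inner_diff_left)
  qed
  have nH: "norm h \<le> real CARD('d) * \<delta>" if "h \<in> H" for h
  proof -
    have "norm h \<le> (\<Sum>i\<in>UNIV. \<bar>h $ i\<bar>)" by (rule norm_le_l1_cart)
    also have "\<dots> \<le> (\<Sum>i\<in>(UNIV :: 'd set). \<delta>)"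
      by (intro sum_mono) (use that in \<open>auto simp: H_def mem_box_cart abs_le_iff minus_le_iff\<close>)
    finally show ?thesis by simp
  qed
  have "(\<integral>\<^sup>+x. \<integral>\<^sup>+y. ennreal (indicator H (y - x) * (\<phi> x - \<phi> y)^2) \<partial>lborel \<partial>lborel)
      = (\<integral>\<^sup>+x. \<integral>\<^sup>+h. ennreal (indicator H h * (\<phi> (x + h) - \<phi> x)^2) \<partial>lborel \<partial>lborel)"
  proof (rule nn_integral_cong)
    fix x :: "real^'d"
    have "(\<integral>\<^sup>+y. ennreal (indicator H (y - x) * (\<phi> x - \<phi> y)^2) \<partial>lborel)
        = (\<integral>\<^sup>+y. ennreal (indicator H (y - x) * (\<phi> x - \<phi> y)^2) \<partial>distr lborel borel ((+) x))"
      by (simp only: lborel_distr_plus)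
    also have "\<dots> = (\<integral>\<^sup>+h. ennreal (indicator H (x + h - x) * (\<phi> x - \<phi> (x + h))^2) \<partial>lborel)"
      by (rule nn_integral_distr) (auto simp: borel_measurable_indicator)
    finally show "(\<integral>\<^sup>+y. ennreal (indicator H (y - x) * (\<phi> x - \<phi> y)^2) \<partial>lborel)
        = (\<integral>\<^sup>+h. ennreal (indicator H h * (\<phi> (x + h) - \<phi> x)^2) \<partial>lborel)"
      by (simp add: power2_commute[of "\<phi> x"])
  qed
  also have "\<dots> = (\<integral>\<^sup>+h. \<integral>\<^sup>+x. ennreal (indicator H h * (\<phi> (x + h) - \<phi> x)^2) \<partial>lborel \<partial>lborel)"
  proof (rule lborel_pair.Fubini')
    have "(\<lambda>p::(real^'d) \<times> (real^'d). \<phi> (snd p + fst p) - \<phi> (snd p)) \<in> borel_measurable borel"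
      by (intro borel_measurable_continuous_onI continuous_on_diff continuous_on_compose2[OF c] continuous_intros) auto
    moreover have "(\<lambda>p::(real^'d) \<times> (real^'d). indicator H (fst p) :: real) \<in> borel_measurable (borel \<Otimes>\<^sub>M borel)"
      by measurable
    ultimately have "(\<lambda>p::(real^'d) \<times> (real^'d). indicator H (fst p) * (\<phi> (snd p + fst p) - \<phi> (snd p))^2) \<in> borel_measurable (lborel \<Otimes>\<^sub>M lborel)"
      by (simp add: borel_prod lborel_prod)
    then show "(\<lambda>(h, x). ennreal (indicator H h * (\<phi> (x + h) - \<phi> x)^2)) \<in> borel_measurable (lborel \<Otimes>\<^sub>M lborel)"
      by (simp add: case_prod_beta')
  qed
  also have "\<dots> \<le> (\<integral>\<^sup>+h. ennreal G * indicator H h \<partial>lborel)"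
  proof (rule nn_integral_mono)
    fix h :: "real^'d"
    show "(\<integral>\<^sup>+x. ennreal (indicator H h * (\<phi> (x + h) - \<phi> x)^2) \<partial>lborel) \<le> ennreal G * indicator H h"
    proof (cases "h \<in> H")
      case True
      define T where "T x = \<phi> (x + h) - \<phi> x" for x
      obtain R where R: "\<And>x. norm x > R \<Longrightarrow> \<phi> x = 0" using C1c_bounds[OF \<phi>] by metis
      have Tc: "continuous_on UNIV T" unfolding T_def by (intro continuous_intros continuous_shift c)
      have Tz: "T x = 0" if "norm x > R + norm h" for x
      proof -
        have "norm (x + h) > R" using that norm_triangle_ineq2[of x "- h"] by simp
        moreover have "norm x > R" using that norm_ge_zero[of h] by linarith
        ultimately show ?thesis using R by (simp add: T_def)
      qed
      have "continuous_on UNIV (\<lambda>x. (T x)^2)" by (intro continuous_intros Tc)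
      then have i: "integrable lborel (\<lambda>x. (T x)^2)"
        by (rule continuous_bounded_support_integrable[of _ "R + norm h"]) (simp add: Tz)
      have "(\<integral>\<^sup>+x. ennreal (indicator H h * (T x)^2) \<partial>lborel) = ennreal (LINT x|lborel. (T x)^2)"
        using True nn_integral_eq_integral[OF i] by simp
      also have "(LINT x|lborel. (T x)^2) = (L2_norm UNIV T)^2"
        using L2_norm_UNIV_sq[OF Tc] by simp
      also have "(L2_norm UNIV T)^2 \<le> G"
      proof -
        have "L2_norm UNIV T \<le> norm h * L2_norm UNIV (gradient \<phi>)"
          using C1c_translation_bound[OF \<phi>, of h] by (simp only: T_def[abs_def])
        also have "\<dots> \<le> real CARD('d) * \<delta> * L2_norm UNIV (gradient \<phi>)"
          by (intro mult_right_mono nH True L2_norm_nonneg)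
        finally show ?thesis unfolding G_def by (intro power_mono L2_norm_nonneg)
      qed
      finally show ?thesis using True by (simp add: T_def ennreal_leI)
    qed simp
  qed
  also have "\<dots> = ennreal G * emeasure lborel H" by (rule nn_integral_cmult_indicator) simp
  also have "\<dots> = ennreal ((2 * \<delta>) ^ CARD('d) * G)"
    using \<open>\<delta> > 0\<close> by (simp add: eH G_def ennreal_mult' mult.commute)
  finally show ?thesis by (simp add: H_def G_def)
qed

text \<open>
  Two points of the same cell differ by a vector of the cube \<open>[-\<delta>, \<delta>]\<^sup>d\<close>, and a pair of points lies in at
  most one common cell.  The double integrals over all cells together are thus bounded by the
  single one of \<open>double_integral_translation_bound\<close>.  Its factor \<open>(2\<delta>)\<^sup>d\<close> is compensated by the volume
  \<open>\<delta>\<^sup>d\<close> of a cell, which leaves the small factor \<open>\<delta>\<^sup>2\<close> in front of the gradient.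
\<close>

theorem C1c_grid_Poincare:
  fixes \<phi> :: "real^'d \<Rightarrow> real"
  assumes \<phi>: "\<phi> \<in> C1c" and "\<delta> > 0" and J: "finite J"
    and supp: "\<And>x. \<phi> x \<noteq> 0 \<Longrightarrow> (\<lambda>i. \<lfloor>x $ i / \<delta>\<rfloor>) \<in> J"
  shows "(L2_norm UNIV \<phi>)^2 \<le> 2 ^ CARD('d) * (real CARD('d) * \<delta> * L2_norm UNIV (gradient \<phi>))^2
     + (1 / \<delta> ^ CARD('d)) * (\<Sum>m\<in>J. (LINT x|lborel. indicator (grid_cell \<delta> m) x * \<phi> x)^2)"
proof -
  define V where "V = \<delta> ^ CARD('d)"
  define W where "W = (2 * \<delta>) ^ CARD('d) * (real CARD('d) * \<delta> * L2_norm UNIV (gradient \<phi>))^2"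
  define Q where "Q m = grid_cell \<delta> m" for m :: "'d \<Rightarrow> int"
  define s where "s m = (LINT x|lborel. indicator (Q m) x * \<phi> x)" for m
  define t where "t m = (LINT x|lborel. indicator (Q m) x * (\<phi> x)^2)" for m
  have Vp: "V > 0" using \<open>\<delta> > 0\<close> by (simp add: V_def)
  have c: "continuous_on UNIV \<phi>" by (rule C1c_continuous[OF \<phi>])
  have pm: "\<phi> \<in> borel_measurable borel" by (rule borel_measurable_continuous_onI[OF c])
  obtain R where R: "\<And>x. norm x > R \<Longrightarrow> \<phi> x = 0" using C1c_bounds[OF \<phi>] by metis
  have Qb: "Q m \<in> sets borel" and QV: "emeasure lborel (Q m) = ennreal V" for m
    using grid_cell_measure[OF \<open>\<delta> > 0\<close>, of m] by (auto simp: Q_def V_def)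
  have Q_iff: "x \<in> Q m \<longleftrightarrow> (\<lambda>i. \<lfloor>x $ i / \<delta>\<rfloor>) = m" for x m
    by (auto simp: Q_def grid_cell_def)
  define dd where "dd m = 2 * V * t m - 2 * (s m)^2" for m
  have cell: "(\<integral>\<^sup>+x. \<integral>\<^sup>+y. ennreal (indicator (Q m) x * indicator (Q m) y * (\<phi> x - \<phi> y)^2) \<partial>lborel \<partial>lborel) = ennreal (dd m)" for m
    unfolding dd_def s_def t_def by (rule variance_double_integral[OF c R Qb QV]) (use Vp in auto)
  have meas: "(\<lambda>y. ennreal (indicator (Q m) x * indicator (Q m) y * (\<phi> x - \<phi> y)^2)) \<in> borel_measurable lborel" for m x
    using Qb pm by simp
  have meas2: "(\<lambda>x. \<integral>\<^sup>+y. ennreal (indicator (Q m) x * indicator (Q m) y * (\<phi> x - \<phi> y)^2) \<partial>lborel) \<in> borel_measurable lborel" for m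
  proof (rule lborel.borel_measurable_nn_integral)
    have [measurable]: "Q m \<in> sets borel" "\<phi> \<in> borel_measurable borel" by (rule Qb, rule pm)
    show "(\<lambda>(x, y). ennreal (indicator (Q m) x * indicator (Q m) y * (\<phi> x - \<phi> y)^2)) \<in> borel_measurable (lborel \<Otimes>\<^sub>M lborel)"
      by measurable
  qed
  have dd_sum: "(\<Sum>m\<in>J. dd m) \<le> W"
  proof -
    \<comment> \<open>Truncation of negative numbers by \<open>ennreal\<close> can only increase the sum.\<close>
    have "ennreal (\<Sum>m\<in>J. dd m) \<le> (\<Sum>m\<in>J. ennreal (dd m))"
    proof -
      have "(\<Sum>m\<in>J. dd m) \<le> (\<Sum>m\<in>J. max 0 (dd m))" by (intro sum_mono) simp
      then have "ennreal (\<Sum>m\<in>J. dd m) \<le> ennreal (\<Sum>m\<in>J. max 0 (dd m))" by (rule ennreal_leI)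
      also have "\<dots> = (\<Sum>m\<in>J. ennreal (max 0 (dd m)))" by (rule sum_ennreal[symmetric]) simp
      also have "\<dots> = (\<Sum>m\<in>J. ennreal (dd m))"
      proof (rule sum.cong)
        show "ennreal (max 0 (dd m)) = ennreal (dd m)" for m
          by (cases "0 \<le> dd m") (auto simp: max_def ennreal_neg)
      qed simp
      finally show ?thesis .
    qed
    also have "\<dots> = (\<integral>\<^sup>+x. (\<Sum>m\<in>J. \<integral>\<^sup>+y. ennreal (indicator (Q m) x * indicator (Q m) y * (\<phi> x - \<phi> y)^2) \<partial>lborel) \<partial>lborel)"
      unfolding cell[symmetric] by (rule nn_integral_sum[symmetric]) (rule meas2)
    also have "\<dots> = (\<integral>\<^sup>+x. \<integral>\<^sup>+y. (\<Sum>m\<in>J. ennreal (indicator (Q m) x * indicator (Q m) y * (\<phi> x - \<phi> y)^2)) \<partial>lborel \<partial>lborel)"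
      by (intro nn_integral_cong nn_integral_sum[symmetric] meas)
    also have "\<dots> \<le> (\<integral>\<^sup>+x. \<integral>\<^sup>+y. ennreal (indicator (cbox (\<chi> i. - \<delta>) (\<chi> i. \<delta>)) (y - x) * (\<phi> x - \<phi> y)^2) \<partial>lborel \<partial>lborel)"
    proof (intro nn_integral_mono)
      fix x y :: "real^'d"
      define m where "m = (\<lambda>i. \<lfloor>x $ i / \<delta>\<rfloor>)"
      have z: "indicator (Q m') x * indicator (Q m') y * (\<phi> x - \<phi> y)^2 = 0" if "m' \<noteq> m" for m'
        using that by (simp add: Q_iff m_def indicator_def)
      have le: "indicator (Q m) x * indicator (Q m) y * (\<phi> x - \<phi> y)^2
          \<le> indicator (cbox (\<chi> i. - \<delta>) (\<chi> i. \<delta>)) (y - x) * (\<phi> x - \<phi> y)^2"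
      proof (cases "x \<in> Q m \<and> y \<in> Q m")
        case True
        then have "\<delta> * m i \<le> x $ i \<and> x $ i < \<delta> * (m i + 1)" "\<delta> * m i \<le> y $ i \<and> y $ i < \<delta> * (m i + 1)" for i
          unfolding Q_def grid_cell_bounds[OF \<open>\<delta> > 0\<close>] by blast+
        moreover have "\<delta> * (m i + 1) = \<delta> * m i + \<delta>" for i by (simp add: distrib_left)
        ultimately have "x $ i - \<delta> \<le> y $ i \<and> y $ i \<le> x $ i + \<delta>" for i by (smt (verit))
        then have "- \<delta> \<le> y $ i - x $ i \<and> y $ i - x $ i \<le> \<delta>" for i
          by (simp add: algebra_simps)
        then have "y - x \<in> cbox (\<chi> i. - \<delta>) (\<chi> i. \<delta>)" by (simp add: mem_box_cart)
        then show ?thesis by (auto split: split_indicator)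
      qed auto
      have "(\<Sum>m'\<in>J. ennreal (indicator (Q m') x * indicator (Q m') y * (\<phi> x - \<phi> y)^2))
          = (\<Sum>m'\<in>J. if m' = m then ennreal (indicator (Q m) x * indicator (Q m) y * (\<phi> x - \<phi> y)^2) else 0)"
        by (intro sum.cong refl) (use z in auto)
      also have "\<dots> \<le> ennreal (indicator (Q m) x * indicator (Q m) y * (\<phi> x - \<phi> y)^2)"
        using J by (simp add: sum.delta)
      also have "\<dots> \<le> ennreal (indicator (cbox (\<chi> i. - \<delta>) (\<chi> i. \<delta>)) (y - x) * (\<phi> x - \<phi> y)^2)"
        by (rule ennreal_leI[OF le])
      finally show "(\<Sum>m'\<in>J. ennreal (indicator (Q m') x * indicator (Q m') y * (\<phi> x - \<phi> y)^2))
          \<le> ennreal (indicator (cbox (\<chi> i. - \<delta>) (\<chi> i. \<delta>)) (y - x) * (\<phi> x - \<phi> y)^2)" .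
    qed
    also have "\<dots> \<le> ennreal W"
      unfolding W_def by (rule double_integral_translation_bound[OF \<phi> \<open>\<delta> > 0\<close>])
    finally show ?thesis
      using \<open>\<delta> > 0\<close> by (subst (asm) ennreal_le_iff) (auto simp: W_def)
  qed
  have "continuous_on UNIV (\<lambda>x. (\<phi> x)^2)" by (intro continuous_intros c)
  then have i2: "integrable lborel (\<lambda>x. (\<phi> x)^2)"
    by (rule continuous_bounded_support_integrable[of _ R]) (simp add: R)
  have iQ: "integrable lborel (\<lambda>x. indicator (Q m) x * (\<phi> x)^2)" for m
    using integrable_mult_indicator[OF _ i2, of "Q m"] Qb by simp
  have "(L2_norm UNIV \<phi>)^2 = (LINT x|lborel. (\<Sum>m\<in>J. indicator (Q m) x * (\<phi> x)^2))"
  proof -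
    have "(\<Sum>m\<in>J. indicator (Q m) x * (\<phi> x)^2) = (\<phi> x)^2" for x
    proof (cases "\<phi> x = 0")
      case False
      have "(\<Sum>m\<in>J. indicator (Q m) x * (\<phi> x)^2) = (\<Sum>m\<in>J. if m = (\<lambda>i. \<lfloor>x $ i / \<delta>\<rfloor>) then (\<phi> x)^2 else 0)"
        by (intro sum.cong refl) (auto simp: Q_iff indicator_def)
      then show ?thesis using supp[OF False] J by simp
    qed simp
    then show ?thesis by (simp add: L2_norm_UNIV_sq[OF c])
  qed
  also have "\<dots> = (\<Sum>m\<in>J. t m)" unfolding t_def by (rule Bochner_Integration.integral_sum) (rule iQ)
  also have "\<dots> = (\<Sum>m\<in>J. dd m) / (2 * V) + (1 / V) * (\<Sum>m\<in>J. (s m)^2)"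
  proof -
    have "t m = dd m / (2 * V) + (1 / V) * (s m)^2" for m using Vp by (simp add: dd_def field_simps)
    then show ?thesis by (simp add: sum.distrib sum_divide_distrib sum_distrib_left)
  qed
  also have "\<dots> \<le> W / (2 * V) + (1 / V) * (\<Sum>m\<in>J. (s m)^2)"
    using dd_sum Vp by (intro add_right_mono divide_right_mono) auto
  also have "W / (2 * V) \<le> W / V" using Vp \<open>\<delta> > 0\<close> by (intro divide_left_mono) (auto simp: W_def)
  also have "W / V = 2 ^ CARD('d) * (real CARD('d) * \<delta> * L2_norm UNIV (gradient \<phi>))^2"
    using \<open>\<delta> > 0\<close> by (simp add: W_def V_def power_mult_distrib)
  finally show ?thesis by (simp add: s_def Q_def V_def)
qed

section \<open>Limits in L2\<close>

lemma L2_norm_tendsto: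
  assumes f: "\<And>n. f n \<in> L2 S" and g: "g \<in> L2 S"
    and lim: "(\<lambda>n. L2_norm S (\<lambda>x. f n x - g x)) \<longlonglongrightarrow> 0"
  shows "(\<lambda>n. L2_norm S (f n)) \<longlonglongrightarrow> L2_norm S g"
proof -
  have "\<bar>L2_norm S (f n) - L2_norm S g\<bar> \<le> L2_norm S (\<lambda>x. f n x - g x)" for n
    using L2_norm_triangle_sub[OF f[of n] g] L2_norm_triangle_sub[OF g f[of n]]
      L2_norm_minus_commute[of S "f n" g] by linarith
  then have "(\<lambda>n. L2_norm S (f n) - L2_norm S g) \<longlonglongrightarrow> 0"
    by (intro Lim_null_comparison[OF _ lim]) simp
  then show ?thesis by (simp add: LIM_zero_iff)
qed

lemma L2_inner_tendsto:
  assumes f: "\<And>n. f n \<in> L2 S" and g: "g \<in> L2 S" and h: "h \<in> L2 S"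
    and lim: "(\<lambda>n. L2_norm S (\<lambda>x. f n x - g x)) \<longlonglongrightarrow> 0"
  shows "(\<lambda>n. L2_inner S h (f n)) \<longlonglongrightarrow> L2_inner S h g"
proof -
  have "\<bar>L2_inner S h (f n) - L2_inner S h g\<bar> \<le> L2_norm S h * L2_norm S (\<lambda>x. f n x - g x)" for n
    using L2_Cauchy_Schwarz[OF h L2_diff[OF f g]] by (simp add: L2_inner_diff_right f g h)
  then have "\<forall>\<^sub>F n in sequentially. norm (L2_inner S h (f n) - L2_inner S h g) \<le> L2_norm S h * L2_norm S (\<lambda>x. f n x - g x)"
    by (intro always_eventually) simp
  moreover have "(\<lambda>n. L2_norm S h * L2_norm S (\<lambda>x. f n x - g x)) \<longlonglongrightarrow> 0"
    using tendsto_mult_right_zero[OF lim] .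
  ultimately have "(\<lambda>n. L2_inner S h (f n) - L2_inner S h g) \<longlonglongrightarrow> 0"
    by (rule Lim_null_comparison)
  then show ?thesis by (simp add: LIM_zero_iff)
qed

lemma L2_inner_tendsto_left:
  assumes "\<And>n. f n \<in> L2 S" "g \<in> L2 S" "h \<in> L2 S"
    and "(\<lambda>n. L2_norm S (\<lambda>x. f n x - g x)) \<longlonglongrightarrow> 0"
  shows "(\<lambda>n. L2_inner S (f n) h) \<longlonglongrightarrow> L2_inner S g h"
  using L2_inner_tendsto[OF assms] by (simp add: L2_inner_commute[of S h])

lemma L2_scaleR_const:
  assumes "f \<in> L2 S" shows "(\<lambda>x. f x *\<^sub>R c) \<in> L2 S"
proof (rule L2_dominated(1)[OF _ assms norm_ge_zero[of c]])
  show "(\<lambda>x. f x *\<^sub>R c) \<in> borel_measurable (lebesgue_on S)"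
    by (intro borel_measurable_scaleR L2_measurable[OF assms] borel_measurable_const)
qed (simp add: mult.commute)

lemma L2_inner_component: "L2_inner S (\<lambda>x. g x $ i) \<phi> = L2_inner S g (\<lambda>x. \<phi> x *\<^sub>R axis i 1)"
  by (simp add: L2_inner_def inner_axis mult.commute)

section \<open>Weak derivatives and the space H10\<close>

lemma test_function_add:
  assumes \<phi>: "\<phi> \<in> test_functions \<Omega>" and \<psi>: "\<psi> \<in> test_functions \<Omega>"
  shows "(\<lambda>x. r * \<phi> x + s * \<psi> x) \<in> test_functions \<Omega>"
proof -
  let ?S = "closure {x. r * \<phi> x + s * \<psi> x \<noteq> 0}"
  have "?S \<subseteq> closure ({x. \<phi> x \<noteq> 0} \<union> {x. \<psi> x \<noteq> 0})"
    by (rule closure_mono) auto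
  then have sub: "?S \<subseteq> closure {x. \<phi> x \<noteq> 0} \<union> closure {x. \<psi> x \<noteq> 0}" by simp
  have "compact (closure {x. \<phi> x \<noteq> 0} \<union> closure {x. \<psi> x \<noteq> 0})"
    using \<phi> \<psi> by (auto simp: test_functions_def intro!: compact_Un)
  then have "compact ?S" using sub
    by (meson closed_closure compact_eq_bounded_closed bounded_subset)
  moreover have "?S \<subseteq> \<Omega>" using sub \<phi> \<psi> by (auto simp: test_functions_def)
  moreover have "Ck n (\<lambda>x. r * \<phi> x + s * \<psi> x)" for n
    by (intro Ck_add Ck_mult Ck_const) (use \<phi> \<psi> in \<open>auto simp: test_functions_def\<close>)
  ultimately show ?thesis by (simp add: test_functions_def)
qed

lemma gradient_lincomb:
  assumes "\<phi> \<in> C1c" "\<psi> \<in> C1c"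
  shows "gradient (\<lambda>x. r * \<phi> x + s * \<psi> x) x = r *\<^sub>R gradient \<phi> x + s *\<^sub>R gradient \<psi> x"
proof -
  have "((\<lambda>x. r * \<phi> x + s * \<psi> x) has_derivative (\<lambda>h. r * (gradient \<phi> x \<bullet> h) + s * (gradient \<psi> x \<bullet> h))) (at x)"
    by (intro has_derivative_add has_derivative_mult_right C1c_has_derivative assms)
  from partial_deriv_eqI[OF this] show ?thesis
    by (simp add: vec_eq_iff gradient_nth inner_axis)
qed

locale bounded_domain =
  fixes \<Omega> :: "(real^'d) set"
  assumes open_domain: "open \<Omega>" and bounded_domain: "bounded \<Omega>"
begin

lemma domain_sets: "\<Omega> \<in> sets lebesgue" by (rule open_in_sets_lebesgue[OF open_domain])

lemma domain_lmeasurable: "\<Omega> \<in> lmeasurable"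
  using lmeasurable_open[OF bounded_domain open_domain] .

lemma test_L2: "\<phi> \<in> test_functions \<Omega> \<Longrightarrow> \<phi> \<in> L2 \<Omega>"
  by (rule C1c_L2[OF test_function_C1c domain_sets])

lemma test_gradient_L2: "\<phi> \<in> test_functions \<Omega> \<Longrightarrow> gradient \<phi> \<in> L2 \<Omega>"
  by (rule C1c_gradient_L2[OF test_function_C1c domain_sets])

lemma test_partial_L2: "\<phi> \<in> test_functions \<Omega> \<Longrightarrow> partial_deriv i \<phi> \<in> L2 \<Omega>"
  using L2_component[OF test_gradient_L2, of \<phi> i] by (simp add: gradient_nth[abs_def])

lemma weak_grad_unique:
  assumes g: "is_weak_grad \<Omega> v g" and h: "is_weak_grad \<Omega> v h"
  shows "AE x in lebesgue_on \<Omega>. g x = h x"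
proof -
  have gL: "g \<in> L2 \<Omega>" and hL: "h \<in> L2 \<Omega>" using g h by (auto simp: is_weak_grad_def)
  have "AE x in lebesgue_on \<Omega>. g x $ i - h x $ i = 0" for i
  proof (rule fundamental_lemma[OF open_domain L2_diff[OF L2_component[OF gL] L2_component[OF hL]]])
    fix \<phi> assume \<phi>: "\<phi> \<in> test_functions \<Omega>"
    then have "L2_inner \<Omega> (\<lambda>x. g x $ i) \<phi> = L2_inner \<Omega> (\<lambda>x. h x $ i) \<phi>"
      using g h unfolding is_weak_grad_def by (metis neg_equal_iff_equal)
    then show "L2_inner \<Omega> (\<lambda>x. g x $ i - h x $ i) \<phi> = 0"
      by (simp add: L2_inner_diff_left L2_component gL hL test_L2 \<phi>)
  qed
  then have "AE x in lebesgue_on \<Omega>. \<forall>i\<in>UNIV. g x $ i - h x $ i = 0"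
    by (intro AE_finite_allI) auto
  then show ?thesis by eventually_elim (simp add: vec_eq_iff)
qed

lemma weak_div_unique:
  assumes g: "is_weak_div \<Omega> \<tau> g" and h: "is_weak_div \<Omega> \<tau> h"
  shows "AE x in lebesgue_on \<Omega>. g x = h x"
proof -
  have gL: "g \<in> L2 \<Omega>" and hL: "h \<in> L2 \<Omega>" using g h by (auto simp: is_weak_div_def)
  have "AE x in lebesgue_on \<Omega>. g x - h x = 0"
  proof (rule fundamental_lemma[OF open_domain L2_diff[OF gL hL]])
    fix \<phi> assume \<phi>: "\<phi> \<in> test_functions \<Omega>"
    then have "L2_inner \<Omega> g \<phi> = L2_inner \<Omega> h \<phi>"
      using g h unfolding is_weak_div_def by (metis neg_equal_iff_equal)
    then show "L2_inner \<Omega> (\<lambda>x. g x - h x) \<phi> = 0"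
      by (simp add: L2_inner_diff_left gL hL test_L2 \<phi>)
  qed
  then show ?thesis by eventually_elim simp
qed

lemma is_weak_grad_lincomb:
  assumes v: "v \<in> L2 \<Omega>" "is_weak_grad \<Omega> v g" and w: "w \<in> L2 \<Omega>" "is_weak_grad \<Omega> w h"
  shows "is_weak_grad \<Omega> (\<lambda>x. r * v x + s * w x) (\<lambda>x. r *\<^sub>R g x + s *\<^sub>R h x)"
  unfolding is_weak_grad_def
proof (intro conjI ballI allI)
  have gL: "g \<in> L2 \<Omega>" and hL: "h \<in> L2 \<Omega>" using v w by (auto simp: is_weak_grad_def)
  show "(\<lambda>x. r *\<^sub>R g x + s *\<^sub>R h x) \<in> L2 \<Omega>" by (intro L2_intros gL hL)
  fix \<phi> i assume \<phi>: "\<phi> \<in> test_functions \<Omega>"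
  have "L2_inner \<Omega> (\<lambda>x. r *\<^sub>R v x + s *\<^sub>R w x) (partial_deriv i \<phi>)
      = r * L2_inner \<Omega> v (partial_deriv i \<phi>) + s * L2_inner \<Omega> w (partial_deriv i \<phi>)"
    by (simp only: L2_inner_add_left L2_inner_scaleR_left L2_scaleR v(1) w(1) test_partial_L2[OF \<phi>])
  also have "\<dots> = - (r * L2_inner \<Omega> (\<lambda>x. g x $ i) \<phi> + s * L2_inner \<Omega> (\<lambda>x. h x $ i) \<phi>)"
    using v(2) w(2) \<phi> by (simp add: is_weak_grad_def)
  also have "\<dots> = - L2_inner \<Omega> (\<lambda>x. r *\<^sub>R (g x $ i) + s *\<^sub>R (h x $ i)) \<phi>"
    by (simp only: L2_inner_add_left L2_inner_scaleR_left L2_scaleR L2_component[OF gL] L2_component[OF hL] test_L2[OF \<phi>])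
  finally show "L2_inner \<Omega> (\<lambda>x. r * v x + s * w x) (partial_deriv i \<phi>)
      = - L2_inner \<Omega> (\<lambda>x. (r *\<^sub>R g x + s *\<^sub>R h x) $ i) \<phi>"
    by simp
qed

lemma is_weak_div_diff:
  assumes v: "v \<in> L2 \<Omega>" "is_weak_div \<Omega> v g" and w: "w \<in> L2 \<Omega>" "is_weak_div \<Omega> w h"
  shows "is_weak_div \<Omega> (\<lambda>x. v x - w x) (\<lambda>x. g x - h x)"
  unfolding is_weak_div_def
proof (intro conjI ballI)
  have gL: "g \<in> L2 \<Omega>" and hL: "h \<in> L2 \<Omega>" using v w by (auto simp: is_weak_div_def)
  show "(\<lambda>x. g x - h x) \<in> L2 \<Omega>" by (intro L2_intros gL hL)
  fix \<phi> assume \<phi>: "\<phi> \<in> test_functions \<Omega>"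
  show "L2_inner \<Omega> (\<lambda>x. v x - w x) (gradient \<phi>) = - L2_inner \<Omega> (\<lambda>x. g x - h x) \<phi>"
    using v w \<phi> by (simp add: is_weak_div_def L2_inner_diff_left gL hL test_L2 test_gradient_L2)
qed

lemma H1_weak_grad: "v \<in> H1 \<Omega> \<Longrightarrow> is_weak_grad \<Omega> v (weak_grad \<Omega> v)"
proof -
  assume "v \<in> H1 \<Omega>"
  then have "\<exists>g. is_weak_grad \<Omega> v g" by (simp add: H1_def)
  then show ?thesis unfolding weak_grad_def by (rule someI_ex)
qed

lemma H1_L2: "v \<in> H1 \<Omega> \<Longrightarrow> v \<in> L2 \<Omega>"
  by (simp add: H1_def)

lemma H1_weak_grad_L2: "v \<in> H1 \<Omega> \<Longrightarrow> weak_grad \<Omega> v \<in> L2 \<Omega>"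
  using H1_weak_grad is_weak_grad_def by blast

lemma H1_I: "v \<in> L2 \<Omega> \<Longrightarrow> is_weak_grad \<Omega> v g \<Longrightarrow> v \<in> H1 \<Omega>"
  by (auto simp: H1_def)

lemma weak_grad_AE: "v \<in> L2 \<Omega> \<Longrightarrow> is_weak_grad \<Omega> v g \<Longrightarrow> AE x in lebesgue_on \<Omega>. weak_grad \<Omega> v x = g x"
  by (rule weak_grad_unique[OF H1_weak_grad[OF H1_I]])

lemma H1_lincomb:
  assumes "v \<in> H1 \<Omega>" "w \<in> H1 \<Omega>"
  shows "(\<lambda>x. r * v x + s * w x) \<in> H1 \<Omega>"
    and "AE x in lebesgue_on \<Omega>. weak_grad \<Omega> (\<lambda>x. r * v x + s * w x) x
        = r *\<^sub>R weak_grad \<Omega> v x + s *\<^sub>R weak_grad \<Omega> w x"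
proof -
  note wg = is_weak_grad_lincomb[OF H1_L2[OF assms(1)] H1_weak_grad[OF assms(1)] H1_L2[OF assms(2)] H1_weak_grad[OF assms(2)], of r s]
  have L: "(\<lambda>x. r * v x + s * w x) \<in> L2 \<Omega>"
    by (intro L2_add L2_scale H1_L2 assms)
  show "(\<lambda>x. r * v x + s * w x) \<in> H1 \<Omega>" by (rule H1_I[OF L wg])
  show "AE x in lebesgue_on \<Omega>. weak_grad \<Omega> (\<lambda>x. r * v x + s * w x) x
        = r *\<^sub>R weak_grad \<Omega> v x + s *\<^sub>R weak_grad \<Omega> w x" by (rule weak_grad_AE[OF L wg])
qed

lemma test_weak_grad: "\<phi> \<in> test_functions \<Omega> \<Longrightarrow> is_weak_grad \<Omega> \<phi> (gradient \<phi>)"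
  by (rule test_function_weak_grad[OF open_domain])

lemma H1_norm_diff_test:
  assumes v: "v \<in> L2 \<Omega>" "is_weak_grad \<Omega> v g" and \<phi>: "\<phi> \<in> test_functions \<Omega>"
  shows "H1_norm \<Omega> (\<lambda>x. v x - \<phi> x) = sqrt ((L2_norm \<Omega> (\<lambda>x. v x - \<phi> x))^2 + (L2_norm \<Omega> (\<lambda>x. g x - gradient \<phi> x))^2)"
proof -
  have gL: "g \<in> L2 \<Omega>" using v by (simp add: is_weak_grad_def)
  have wg: "is_weak_grad \<Omega> (\<lambda>x. v x - \<phi> x) (\<lambda>x. g x - gradient \<phi> x)"
    using is_weak_grad_lincomb[OF v test_L2[OF \<phi>] test_weak_grad[OF \<phi>], of 1 "-1"] by simp
  have L: "(\<lambda>x. v x - \<phi> x) \<in> L2 \<Omega>" by (intro L2_diff v test_L2 \<phi>)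
  have "L2_norm \<Omega> (weak_grad \<Omega> (\<lambda>x. v x - \<phi> x)) = L2_norm \<Omega> (\<lambda>x. g x - gradient \<phi> x)"
    by (intro L2_norm_cong_AE H1_weak_grad_L2 H1_I[OF L wg] weak_grad_AE[OF L wg] L2_diff gL test_gradient_L2 \<phi>)
  then show ?thesis by (simp add: H1_norm_def)
qed

lemma H10_H1: "v \<in> H10 \<Omega> \<Longrightarrow> v \<in> H1 \<Omega>"
  by (simp add: H10_def)

lemma H10_L2: "v \<in> H10 \<Omega> \<Longrightarrow> v \<in> L2 \<Omega>"
  and H10_weak_grad: "v \<in> H10 \<Omega> \<Longrightarrow> is_weak_grad \<Omega> v (weak_grad \<Omega> v)"
  and H10_weak_grad_L2: "v \<in> H10 \<Omega> \<Longrightarrow> weak_grad \<Omega> v \<in> L2 \<Omega>"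
  by (auto intro: H1_L2 H1_weak_grad H1_weak_grad_L2 H10_H1)

lemma H10_approx:
  assumes v: "v \<in> H10 \<Omega>"
  obtains \<phi> where "\<And>n. \<phi> n \<in> test_functions \<Omega>"
    "(\<lambda>n. L2_norm \<Omega> (\<lambda>x. \<phi> n x - v x)) \<longlonglongrightarrow> 0"
    "(\<lambda>n. L2_norm \<Omega> (\<lambda>x. gradient (\<phi> n) x - weak_grad \<Omega> v x)) \<longlonglongrightarrow> 0"
proof -
  have "\<exists>\<phi>\<in>test_functions \<Omega>. H1_norm \<Omega> (\<lambda>x. v x - \<phi> x) < inverse (real (Suc n))" for n
    using v by (auto simp: H10_def)
  then obtain \<phi> where \<phi>: "\<And>n. \<phi> n \<in> test_functions \<Omega>"
    and lt: "\<And>n. H1_norm \<Omega> (\<lambda>x. v x - \<phi> n x) < inverse (real (Suc n))" by metis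
  have "L2_norm \<Omega> (\<lambda>x. \<phi> n x - v x) \<le> inverse (real (Suc n))"
    "L2_norm \<Omega> (\<lambda>x. gradient (\<phi> n) x - weak_grad \<Omega> v x) \<le> inverse (real (Suc n))" for n
  proof -
    let ?a = "L2_norm \<Omega> (\<lambda>x. v x - \<phi> n x)" and ?b = "L2_norm \<Omega> (\<lambda>x. weak_grad \<Omega> v x - gradient (\<phi> n) x)"
    have "sqrt (?a^2 + ?b^2) < inverse (real (Suc n))"
      using lt[of n] unfolding H1_norm_diff_test[OF H10_L2[OF v] H10_weak_grad[OF v] \<phi>[of n]] .
    moreover have "?a \<le> sqrt (?a^2 + ?b^2)" "?b \<le> sqrt (?a^2 + ?b^2)" by (rule real_le_rsqrt, simp)+
    ultimately show "L2_norm \<Omega> (\<lambda>x. \<phi> n x - v x) \<le> inverse (real (Suc n))"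
      "L2_norm \<Omega> (\<lambda>x. gradient (\<phi> n) x - weak_grad \<Omega> v x) \<le> inverse (real (Suc n))"
      unfolding L2_norm_minus_commute[of \<Omega> "\<phi> n"] L2_norm_minus_commute[of \<Omega> "gradient (\<phi> n)"]
      by linarith+
  qed
  then have "(\<lambda>n. L2_norm \<Omega> (\<lambda>x. \<phi> n x - v x)) \<longlonglongrightarrow> 0"
    "(\<lambda>n. L2_norm \<Omega> (\<lambda>x. gradient (\<phi> n) x - weak_grad \<Omega> v x)) \<longlonglongrightarrow> 0"
    by (auto intro!: tendsto_sandwich[OF _ _ tendsto_const LIMSEQ_inverse_real_of_nat] always_eventually simp: L2_norm_nonneg)
  with \<phi> show ?thesis using that by blast
qed

text \<open>
  The defining approximation refers to \<open>weak_grad\<close>, a chosen representative; this criterion accepts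
  any weak gradient of \<open>v\<close>.
\<close>

lemma H10_I:
  assumes v: "v \<in> L2 \<Omega>" "is_weak_grad \<Omega> v g"
    and ap: "\<And>\<epsilon>. \<epsilon> > 0 \<Longrightarrow> \<exists>\<phi>\<in>test_functions \<Omega>. L2_norm \<Omega> (\<lambda>x. v x - \<phi> x) < \<epsilon> \<and> L2_norm \<Omega> (\<lambda>x. g x - gradient \<phi> x) < \<epsilon>"
  shows "v \<in> H10 \<Omega>"
proof -
  have "\<exists>\<phi>\<in>test_functions \<Omega>. H1_norm \<Omega> (\<lambda>x. v x - \<phi> x) < \<epsilon>" if "\<epsilon> > 0" for \<epsilon>
  proof -
    obtain \<phi> where \<phi>: "\<phi> \<in> test_functions \<Omega>" and lt: "L2_norm \<Omega> (\<lambda>x. v x - \<phi> x) < \<epsilon>/2" "L2_norm \<Omega> (\<lambda>x. g x - gradient \<phi> x) < \<epsilon>/2"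
      using ap[of "\<epsilon>/2"] \<open>\<epsilon> > 0\<close> by auto
    have "H1_norm \<Omega> (\<lambda>x. v x - \<phi> x) \<le> L2_norm \<Omega> (\<lambda>x. v x - \<phi> x) + L2_norm \<Omega> (\<lambda>x. g x - gradient \<phi> x)"
      unfolding H1_norm_diff_test[OF v \<phi>] by (intro sqrt_sum_squares_le_sum L2_norm_nonneg)
    with lt \<phi> show ?thesis by (intro bexI[OF _ \<phi>]) linarith
  qed
  then show ?thesis using H1_I[OF v] by (simp add: H10_def)
qed

lemma test_H10: "\<phi> \<in> test_functions \<Omega> \<Longrightarrow> \<phi> \<in> H10 \<Omega>"
  by (rule H10_I[OF test_L2 test_weak_grad]) (auto simp: L2_norm_def intro!: bexI[of _ \<phi>])

lemma H10_lincomb: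
  assumes v: "v \<in> H10 \<Omega>" and w: "w \<in> H10 \<Omega>"
  shows "(\<lambda>x. r * v x + s * w x) \<in> H10 \<Omega>"
proof (rule H10_I)
  show "(\<lambda>x. r * v x + s * w x) \<in> L2 \<Omega>"
    by (intro L2_add L2_scale H10_L2 v w)
  show "is_weak_grad \<Omega> (\<lambda>x. r * v x + s * w x) (\<lambda>x. r *\<^sub>R weak_grad \<Omega> v x + s *\<^sub>R weak_grad \<Omega> w x)"
    by (intro is_weak_grad_lincomb H10_L2 H10_weak_grad v w)
  fix \<epsilon> :: real assume "\<epsilon> > 0"
  obtain \<phi> where \<phi>: "\<And>n. \<phi> n \<in> test_functions \<Omega>"
    "(\<lambda>n. L2_norm \<Omega> (\<lambda>x. \<phi> n x - v x)) \<longlonglongrightarrow> 0"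
    "(\<lambda>n. L2_norm \<Omega> (\<lambda>x. gradient (\<phi> n) x - weak_grad \<Omega> v x)) \<longlonglongrightarrow> 0" using H10_approx[OF v] by blast
  obtain \<psi> where \<psi>: "\<And>n. \<psi> n \<in> test_functions \<Omega>"
    "(\<lambda>n. L2_norm \<Omega> (\<lambda>x. \<psi> n x - w x)) \<longlonglongrightarrow> 0"
    "(\<lambda>n. L2_norm \<Omega> (\<lambda>x. gradient (\<psi> n) x - weak_grad \<Omega> w x)) \<longlonglongrightarrow> 0" using H10_approx[OF w] by blast
  have combine: "L2_norm \<Omega> (\<lambda>x. r *\<^sub>R f x + s *\<^sub>R g x - (r *\<^sub>R f' x + s *\<^sub>R g' x))
      \<le> \<bar>r\<bar> * L2_norm \<Omega> (\<lambda>x. f' x - f x) + \<bar>s\<bar> * L2_norm \<Omega> (\<lambda>x. g' x - g x)"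
    if "f \<in> L2 \<Omega>" "f' \<in> L2 \<Omega>" "g \<in> L2 \<Omega>" "g' \<in> L2 \<Omega>" for f f' g g' :: "real^'d \<Rightarrow> 'e::euclidean_space"
  proof -
    have "L2_norm \<Omega> (\<lambda>x. r *\<^sub>R f x + s *\<^sub>R g x - (r *\<^sub>R f' x + s *\<^sub>R g' x))
      = L2_norm \<Omega> (\<lambda>x. r *\<^sub>R (f x - f' x) + s *\<^sub>R (g x - g' x))" by (simp add: algebra_simps)
    also have "\<dots> \<le> L2_norm \<Omega> (\<lambda>x. r *\<^sub>R (f x - f' x)) + L2_norm \<Omega> (\<lambda>x. s *\<^sub>R (g x - g' x))"
      by (intro L2_norm_triangle L2_scaleR L2_diff that)
    finally show ?thesis
      by (simp add: L2_norm_scaleR L2_norm_minus_commute[of \<Omega> f'] L2_norm_minus_commute[of \<Omega> g'])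
  qed
  have lim0: "(\<lambda>n. \<bar>r\<bar> * L2_norm \<Omega> (\<lambda>x. \<phi> n x - v x) + \<bar>s\<bar> * L2_norm \<Omega> (\<lambda>x. \<psi> n x - w x)) \<longlonglongrightarrow> \<bar>r\<bar> * 0 + \<bar>s\<bar> * 0"
    and lim1: "(\<lambda>n. \<bar>r\<bar> * L2_norm \<Omega> (\<lambda>x. gradient (\<phi> n) x - weak_grad \<Omega> v x) + \<bar>s\<bar> * L2_norm \<Omega> (\<lambda>x. gradient (\<psi> n) x - weak_grad \<Omega> w x)) \<longlonglongrightarrow> \<bar>r\<bar> * 0 + \<bar>s\<bar> * 0"
    by (intro tendsto_add tendsto_mult tendsto_const \<phi> \<psi>)+
  have "\<forall>\<^sub>F n in sequentially. \<bar>r\<bar> * L2_norm \<Omega> (\<lambda>x. \<phi> n x - v x) + \<bar>s\<bar> * L2_norm \<Omega> (\<lambda>x. \<psi> n x - w x) < \<epsilon> \<and>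
    \<bar>r\<bar> * L2_norm \<Omega> (\<lambda>x. gradient (\<phi> n) x - weak_grad \<Omega> v x) + \<bar>s\<bar> * L2_norm \<Omega> (\<lambda>x. gradient (\<psi> n) x - weak_grad \<Omega> w x) < \<epsilon>"
    by (intro eventually_conj order_tendstoD(2)[OF lim0] order_tendstoD(2)[OF lim1]) (use \<open>\<epsilon> > 0\<close> in auto)
  then obtain n where n: "\<bar>r\<bar> * L2_norm \<Omega> (\<lambda>x. \<phi> n x - v x) + \<bar>s\<bar> * L2_norm \<Omega> (\<lambda>x. \<psi> n x - w x) < \<epsilon>"
    "\<bar>r\<bar> * L2_norm \<Omega> (\<lambda>x. gradient (\<phi> n) x - weak_grad \<Omega> v x) + \<bar>s\<bar> * L2_norm \<Omega> (\<lambda>x. gradient (\<psi> n) x - weak_grad \<Omega> w x) < \<epsilon>"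
    by (auto dest!: eventually_happens'[OF sequentially_bot])
  show "\<exists>\<theta>\<in>test_functions \<Omega>. L2_norm \<Omega> (\<lambda>x. r * v x + s * w x - \<theta> x) < \<epsilon> \<and>
      L2_norm \<Omega> (\<lambda>x. r *\<^sub>R weak_grad \<Omega> v x + s *\<^sub>R weak_grad \<Omega> w x - gradient \<theta> x) < \<epsilon>"
  proof (intro bexI conjI)
    show "(\<lambda>x. r * \<phi> n x + s * \<psi> n x) \<in> test_functions \<Omega>" by (rule test_function_add[OF \<phi>(1) \<psi>(1)])
    show "L2_norm \<Omega> (\<lambda>x. r * v x + s * w x - (r * \<phi> n x + s * \<psi> n x)) < \<epsilon>"
      using combine[OF H10_L2[OF v] test_L2[OF \<phi>(1)] H10_L2[OF w] test_L2[OF \<psi>(1)], of n n] n(1) by simp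
    show "L2_norm \<Omega> (\<lambda>x. r *\<^sub>R weak_grad \<Omega> v x + s *\<^sub>R weak_grad \<Omega> w x - gradient (\<lambda>x. r * \<phi> n x + s * \<psi> n x) x) < \<epsilon>"
      using combine[OF H10_weak_grad_L2[OF v] test_gradient_L2[OF \<phi>(1)] H10_weak_grad_L2[OF w] test_gradient_L2[OF \<psi>(1)], of n n] n(2)
      by (simp add: gradient_lincomb[OF test_function_C1c[OF \<phi>(1)] test_function_C1c[OF \<psi>(1)]])
  qed
qed

lemma H10_diff:
  assumes "v \<in> H10 \<Omega>" "w \<in> H10 \<Omega>"
  shows "(\<lambda>x. v x - w x) \<in> H10 \<Omega>"
    and "AE x in lebesgue_on \<Omega>. weak_grad \<Omega> (\<lambda>x. v x - w x) x = weak_grad \<Omega> v x - weak_grad \<Omega> w x"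
  using H10_lincomb[OF assms, of 1 "-1"] H1_lincomb(2)[OF assms[THEN H10_H1], of 1 "-1"] by simp_all

lemma H10_scale:
  assumes "v \<in> H10 \<Omega>"
  shows "(\<lambda>x. r * v x) \<in> H10 \<Omega>"
    and "AE x in lebesgue_on \<Omega>. weak_grad \<Omega> (\<lambda>x. r * v x) x = r *\<^sub>R weak_grad \<Omega> v x"
  using H10_lincomb[OF assms assms, of r 0] H1_lincomb(2)[OF assms[THEN H10_H1] assms[THEN H10_H1], of r 0] by simp_all

text \<open>
  The limit of the gradients is a weak gradient of the limit because the defining identity is
  continuous in both functions.
\<close>

lemma H10_complete:
  assumes w: "\<And>n. w n \<in> H10 \<Omega>"
    and C0: "\<And>\<epsilon>. \<epsilon> > 0 \<Longrightarrow> \<exists>N. \<forall>m\<ge>N. \<forall>n\<ge>N. L2_norm \<Omega> (\<lambda>x. w m x - w n x) < \<epsilon>"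
    and C1: "\<And>\<epsilon>. \<epsilon> > 0 \<Longrightarrow> \<exists>N. \<forall>m\<ge>N. \<forall>n\<ge>N. L2_norm \<Omega> (\<lambda>x. weak_grad \<Omega> (w m) x - weak_grad \<Omega> (w n) x) < \<epsilon>"
  obtains u where "u \<in> H10 \<Omega>" "(\<lambda>n. L2_norm \<Omega> (\<lambda>x. w n x - u x)) \<longlonglongrightarrow> 0"
    "(\<lambda>n. L2_norm \<Omega> (\<lambda>x. weak_grad \<Omega> (w n) x - weak_grad \<Omega> u x)) \<longlonglongrightarrow> 0"
proof -
  obtain u where u: "u \<in> L2 \<Omega>" "(\<lambda>n. L2_norm \<Omega> (\<lambda>x. w n x - u x)) \<longlonglongrightarrow> 0"
    using L2_complete[OF domain_lmeasurable H10_L2[OF w] C0] by blast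
  obtain g where g: "g \<in> L2 \<Omega>" "(\<lambda>n. L2_norm \<Omega> (\<lambda>x. weak_grad \<Omega> (w n) x - g x)) \<longlonglongrightarrow> 0"
    using L2_complete[OF domain_lmeasurable H10_weak_grad_L2[OF w] C1] by blast
  have wg: "is_weak_grad \<Omega> u g"
    unfolding is_weak_grad_def
  proof (intro conjI ballI allI g(1))
    fix \<phi> i assume \<phi>: "\<phi> \<in> test_functions \<Omega>"
    have "(\<lambda>n. L2_inner \<Omega> (w n) (partial_deriv i \<phi>)) \<longlonglongrightarrow> L2_inner \<Omega> u (partial_deriv i \<phi>)"
      by (rule L2_inner_tendsto_left[OF H10_L2[OF w] u(1) test_partial_L2[OF \<phi>] u(2)])
    moreover have "(\<lambda>n. - L2_inner \<Omega> (\<lambda>x. weak_grad \<Omega> (w n) x $ i) \<phi>) \<longlonglongrightarrow> - L2_inner \<Omega> (\<lambda>x. g x $ i) \<phi>"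
      unfolding L2_inner_component
      by (intro tendsto_minus L2_inner_tendsto_left[OF H10_weak_grad_L2[OF w] g(1) L2_scaleR_const[OF test_L2[OF \<phi>]] g(2)])
    moreover have "L2_inner \<Omega> (w n) (partial_deriv i \<phi>) = - L2_inner \<Omega> (\<lambda>x. weak_grad \<Omega> (w n) x $ i) \<phi>" for n
      using H10_weak_grad[OF w[of n]] \<phi> by (simp add: is_weak_grad_def)
    ultimately show "L2_inner \<Omega> u (partial_deriv i \<phi>) = - L2_inner \<Omega> (\<lambda>x. g x $ i) \<phi>"
      using LIMSEQ_unique by simp
  qed
  have uH: "u \<in> H10 \<Omega>"
  proof (rule H10_I[OF u(1) wg])
    fix \<epsilon> :: real assume "\<epsilon> > 0"
    have "\<forall>\<^sub>F n in sequentially. L2_norm \<Omega> (\<lambda>x. w n x - u x) < \<epsilon>/2 \<and> L2_norm \<Omega> (\<lambda>x. weak_grad \<Omega> (w n) x - g x) < \<epsilon>/2"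
      by (intro eventually_conj order_tendstoD(2)[OF u(2)] order_tendstoD(2)[OF g(2)]) (use \<open>\<epsilon> > 0\<close> in auto)
    then obtain n where n: "L2_norm \<Omega> (\<lambda>x. w n x - u x) < \<epsilon>/2" "L2_norm \<Omega> (\<lambda>x. weak_grad \<Omega> (w n) x - g x) < \<epsilon>/2"
      by (auto dest!: eventually_happens'[OF sequentially_bot])
    obtain \<phi> where \<phi>: "\<And>n. \<phi> n \<in> test_functions \<Omega>"
      "(\<lambda>k. L2_norm \<Omega> (\<lambda>x. \<phi> k x - w n x)) \<longlonglongrightarrow> 0"
      "(\<lambda>k. L2_norm \<Omega> (\<lambda>x. gradient (\<phi> k) x - weak_grad \<Omega> (w n) x)) \<longlonglongrightarrow> 0" using H10_approx[OF w[of n]] by blast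
    have "\<forall>\<^sub>F k in sequentially. L2_norm \<Omega> (\<lambda>x. \<phi> k x - w n x) < \<epsilon>/2 \<and> L2_norm \<Omega> (\<lambda>x. gradient (\<phi> k) x - weak_grad \<Omega> (w n) x) < \<epsilon>/2"
      by (intro eventually_conj order_tendstoD(2)[OF \<phi>(2)] order_tendstoD(2)[OF \<phi>(3)]) (use \<open>\<epsilon> > 0\<close> in auto)
    then obtain k where k: "L2_norm \<Omega> (\<lambda>x. \<phi> k x - w n x) < \<epsilon>/2" "L2_norm \<Omega> (\<lambda>x. gradient (\<phi> k) x - weak_grad \<Omega> (w n) x) < \<epsilon>/2"
      by (auto dest!: eventually_happens'[OF sequentially_bot])
    have "L2_norm \<Omega> (\<lambda>x. u x - \<phi> k x) < \<epsilon>"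
      using L2_norm_triangle_diff[OF L2_diff[OF u(1) H10_L2[OF w]] L2_diff[OF test_L2[OF \<phi>(1)] H10_L2[OF w]], of n k n] n(1) k(1)
        L2_norm_minus_commute[of \<Omega> u "w n"] by simp
    moreover have "L2_norm \<Omega> (\<lambda>x. g x - gradient (\<phi> k) x) < \<epsilon>"
      using L2_norm_triangle_diff[OF L2_diff[OF g(1) H10_weak_grad_L2[OF w]] L2_diff[OF test_gradient_L2[OF \<phi>(1)] H10_weak_grad_L2[OF w]], of n k n] n(2) k(2)
        L2_norm_minus_commute[of \<Omega> g "weak_grad \<Omega> (w n)"] by simp
    ultimately show "\<exists>\<phi>\<in>test_functions \<Omega>. L2_norm \<Omega> (\<lambda>x. u x - \<phi> x) < \<epsilon> \<and> L2_norm \<Omega> (\<lambda>x. g x - gradient \<phi> x) < \<epsilon>"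
      using \<phi>(1) by blast
  qed
  have "L2_norm \<Omega> (\<lambda>x. weak_grad \<Omega> (w n) x - weak_grad \<Omega> u x) = L2_norm \<Omega> (\<lambda>x. weak_grad \<Omega> (w n) x - g x)" for n
  proof (rule L2_norm_cong_AE)
    show "AE x in lebesgue_on \<Omega>. weak_grad \<Omega> (w n) x - weak_grad \<Omega> u x = weak_grad \<Omega> (w n) x - g x"
      using weak_grad_AE[OF u(1) wg] by eventually_elim simp
  qed (intro L2_diff H10_weak_grad_L2 w uH g(1))+
  with g(2) have "(\<lambda>n. L2_norm \<Omega> (\<lambda>x. weak_grad \<Omega> (w n) x - weak_grad \<Omega> u x)) \<longlonglongrightarrow> 0" by simp
  with uH u(2) show ?thesis by (rule that)
qed

text \<open>
  This holds for test functions by definition of the weak divergence and is continuous in \<open>v\<close>.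
\<close>

lemma H10_divergence:
  assumes \<tau>: "\<tau> \<in> L2 \<Omega>" "is_weak_div \<Omega> \<tau> g" and v: "v \<in> H10 \<Omega>"
  shows "L2_inner \<Omega> \<tau> (weak_grad \<Omega> v) = - L2_inner \<Omega> g v"
proof -
  have gL: "g \<in> L2 \<Omega>" using \<tau> by (simp add: is_weak_div_def)
  obtain \<phi> where \<phi>: "\<And>n. \<phi> n \<in> test_functions \<Omega>"
    "(\<lambda>n. L2_norm \<Omega> (\<lambda>x. \<phi> n x - v x)) \<longlonglongrightarrow> 0"
    "(\<lambda>n. L2_norm \<Omega> (\<lambda>x. gradient (\<phi> n) x - weak_grad \<Omega> v x)) \<longlonglongrightarrow> 0" using H10_approx[OF v] by blast
  have "(\<lambda>n. L2_inner \<Omega> \<tau> (gradient (\<phi> n))) \<longlonglongrightarrow> L2_inner \<Omega> \<tau> (weak_grad \<Omega> v)"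
    by (rule L2_inner_tendsto[OF test_gradient_L2[OF \<phi>(1)] H10_weak_grad_L2[OF v] \<tau>(1) \<phi>(3)])
  moreover have "(\<lambda>n. - L2_inner \<Omega> g (\<phi> n)) \<longlonglongrightarrow> - L2_inner \<Omega> g v"
    by (intro tendsto_minus L2_inner_tendsto[OF test_L2[OF \<phi>(1)] H10_L2[OF v] gL \<phi>(2)])
  moreover have "L2_inner \<Omega> \<tau> (gradient (\<phi> n)) = - L2_inner \<Omega> g (\<phi> n)" for n
    using \<tau>(2) \<phi>(1) by (simp add: is_weak_div_def)
  ultimately show ?thesis using LIMSEQ_unique by simp
qed

lemma L2_norm_eq_UNIV:
  fixes f :: "real^'d \<Rightarrow> 'e::euclidean_space"
  assumes c: "continuous_on UNIV f" and z: "\<And>x. x \<notin> \<Omega> \<Longrightarrow> f x = 0"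
  shows "L2_norm \<Omega> f = L2_norm UNIV f"
proof -
  have "(L2_norm \<Omega> f)^2 = (L2_norm UNIV f)^2"
    using L2_inner_eq_lborel[OF open_domain c c] z by (simp add: L2_norm_sq L2_norm_UNIV_sq[OF c, unfolded L2_norm_sq] power2_norm_eq_inner)
  then show ?thesis by (metis L2_norm_nonneg power2_eq_iff_nonneg)
qed

lemma test_norms:
  assumes \<phi>: "\<phi> \<in> test_functions \<Omega>"
  shows "L2_norm \<Omega> \<phi> = L2_norm UNIV \<phi>" "L2_norm \<Omega> (gradient \<phi>) = L2_norm UNIV (gradient \<phi>)"
  using L2_norm_eq_UNIV C1c_continuous C1c_gradient_continuous test_function_C1c[OF \<phi>] test_function_gradient_zero[OF \<phi>]
  by blast+

theorem H10_Poincare: "\<exists>C>0. \<forall>v\<in>H10 \<Omega>. L2_norm \<Omega> v \<le> C * L2_norm \<Omega> (weak_grad \<Omega> v)"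
proof -
  obtain R where R: "R > 0" "\<And>x. x \<in> \<Omega> \<Longrightarrow> norm x \<le> R" using bounded_domain unfolding bounded_pos by blast
  have "L2_norm \<Omega> v \<le> 3 * R * L2_norm \<Omega> (weak_grad \<Omega> v)" if v: "v \<in> H10 \<Omega>" for v
  proof -
    obtain \<phi> where \<phi>: "\<And>n. \<phi> n \<in> test_functions \<Omega>"
      "(\<lambda>n. L2_norm \<Omega> (\<lambda>x. \<phi> n x - v x)) \<longlonglongrightarrow> 0"
      "(\<lambda>n. L2_norm \<Omega> (\<lambda>x. gradient (\<phi> n) x - weak_grad \<Omega> v x)) \<longlonglongrightarrow> 0" using H10_approx[OF v] by blast
    have le: "L2_norm \<Omega> (\<phi> n) \<le> 3 * R * L2_norm \<Omega> (gradient (\<phi> n))" for n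
      unfolding test_norms[OF \<phi>(1)]
    proof (rule C1c_Poincare[OF test_function_C1c[OF \<phi>(1)] _ R(1)])
      fix x :: "real^'d" assume "norm x > R"
      then have "x \<notin> \<Omega>" using R(2)[of x] by linarith
      then show "\<phi> n x = 0" by (rule test_function_gradient_zero(1)[OF \<phi>(1)])
    qed
    show ?thesis
      by (rule LIMSEQ_le[OF L2_norm_tendsto[OF test_L2[OF \<phi>(1)] H10_L2[OF v] \<phi>(2)]
          tendsto_mult_left[OF L2_norm_tendsto[OF test_gradient_L2[OF \<phi>(1)] H10_weak_grad_L2[OF v] \<phi>(3)]]])
         (use le in blast)
  qed
  with R(1) show ?thesis by (intro exI[of _ "3 * R"]) auto
qed

lemma test_functions_grid_Poincare:
  assumes "\<delta> > 0"
  obtains J :: "('d \<Rightarrow> int) set" where "finite J"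
    "\<And>\<phi>. \<phi> \<in> test_functions \<Omega> \<Longrightarrow> (L2_norm \<Omega> \<phi>)^2 \<le> 2 ^ CARD('d) * (real CARD('d) * \<delta> * L2_norm \<Omega> (gradient \<phi>))^2
     + (1 / \<delta> ^ CARD('d)) * (\<Sum>m\<in>J. (L2_inner \<Omega> \<phi> (indicator (grid_cell \<delta> m)))^2)"
proof -
  obtain R where R: "R > 0" "\<And>x. x \<in> \<Omega> \<Longrightarrow> norm x \<le> R" using bounded_domain unfolding bounded_pos by blast
  define J :: "('d \<Rightarrow> int) set" where "J = PiE UNIV (\<lambda>_. {\<lfloor>- R / \<delta>\<rfloor>..\<lfloor>R / \<delta>\<rfloor>})"
  have fin: "finite J" unfolding J_def by (intro finite_PiE) auto
  have inJ: "(\<lambda>i. \<lfloor>x $ i / \<delta>\<rfloor>) \<in> J" if "x \<in> \<Omega>" for x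
  proof -
    have "\<bar>x $ i\<bar> \<le> R" for i using component_le_norm_cart[of x i] R(2)[OF that] by linarith
    then have "- R / \<delta> \<le> x $ i / \<delta> \<and> x $ i / \<delta> \<le> R / \<delta>" for i
      using \<open>\<delta> > 0\<close> by (intro conjI divide_right_mono) (auto simp: abs_le_iff minus_le_iff)
    then show ?thesis unfolding J_def by (auto simp: PiE_UNIV_domain intro!: floor_mono)
  qed
  have "(L2_norm \<Omega> \<phi>)^2 \<le> 2 ^ CARD('d) * (real CARD('d) * \<delta> * L2_norm \<Omega> (gradient \<phi>))^2
     + (1 / \<delta> ^ CARD('d)) * (\<Sum>m\<in>J. (L2_inner \<Omega> \<phi> (indicator (grid_cell \<delta> m)))^2)" if \<phi>: "\<phi> \<in> test_functions \<Omega>" for \<phi>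
  proof -
    note \<phi>C = test_function_C1c[OF \<phi>]
    have "L2_inner \<Omega> \<phi> (indicator (grid_cell \<delta> m)) = (LINT x|lborel. indicator (grid_cell \<delta> m) x * \<phi> x)" for m
    proof -
      have m: "(\<lambda>x. indicator (grid_cell \<delta> m) x * \<phi> x) \<in> borel_measurable lborel"
        using borel_measurable_continuous_onI[OF C1c_continuous[OF \<phi>C]] grid_cell_measure(1)[OF \<open>\<delta> > 0\<close>, of m] by simp
      have "L2_inner \<Omega> \<phi> (indicator (grid_cell \<delta> m)) = (LINT x|lebesgue. indicator \<Omega> x *\<^sub>R (\<phi> x \<bullet> indicator (grid_cell \<delta> m) x))"
        unfolding L2_inner_def using domain_sets by (subst integral_restrict_space) auto
      also have "\<dots> = (LINT x|lebesgue. indicator (grid_cell \<delta> m) x * \<phi> x)"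
        by (intro Bochner_Integration.integral_cong)
           (use test_function_gradient_zero(1)[OF \<phi>] in \<open>auto split: split_indicator\<close>)
      also have "\<dots> = (LINT x|lborel. indicator (grid_cell \<delta> m) x * \<phi> x)" by (rule integral_completion[OF m])
      finally show ?thesis .
    qed
    moreover have "(\<lambda>i. \<lfloor>x $ i / \<delta>\<rfloor>) \<in> J" if "\<phi> x \<noteq> 0" for x
      using that test_function_gradient_zero(1)[OF \<phi>] inJ by blast
    ultimately show ?thesis
      using C1c_grid_Poincare[OF \<phi>C \<open>\<delta> > 0\<close> fin] by (simp add: test_norms[OF \<phi>])
  qed
  with fin show ?thesis by (rule that)
qed

text \<open>
  This inequality contains what is needed of Rellich's theorem: up to an arbitrarily small part of the
  gradient norm, the L2 norm on \<open>H10\<close> is controlled by finitely many continuous functionals.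
\<close>

theorem H10_compactness:
  assumes "\<epsilon> > 0"
  obtains J :: "('d \<Rightarrow> int) set" and q :: "('d \<Rightarrow> int) \<Rightarrow> real^'d \<Rightarrow> real" and C :: real
  where "finite J" "\<And>m. q m \<in> L2 \<Omega>" "C \<ge> 0"
    "\<And>v. v \<in> H10 \<Omega> \<Longrightarrow> (L2_norm \<Omega> v)^2 \<le> \<epsilon> * (L2_norm \<Omega> (weak_grad \<Omega> v))^2 + C * (\<Sum>m\<in>J. (L2_inner \<Omega> v (q m))^2)"
proof -
  define K where "K = 2 ^ CARD('d) * (real CARD('d))^2"
  have "K > 0" by (simp add: K_def)
  define \<delta> where "\<delta> = sqrt (\<epsilon> / K)"
  have dp: "\<delta> > 0" using \<open>\<epsilon> > 0\<close> \<open>K > 0\<close> by (simp add: \<delta>_def)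
  have Kd: "K * \<delta>^2 = \<epsilon>" using \<open>\<epsilon> > 0\<close> \<open>K > 0\<close> by (simp add: \<delta>_def)
  obtain J :: "('d \<Rightarrow> int) set" where J: "finite J"
    "\<And>\<phi>. \<phi> \<in> test_functions \<Omega> \<Longrightarrow> (L2_norm \<Omega> \<phi>)^2 \<le> 2 ^ CARD('d) * (real CARD('d) * \<delta> * L2_norm \<Omega> (gradient \<phi>))^2
     + (1 / \<delta> ^ CARD('d)) * (\<Sum>m\<in>J. (L2_inner \<Omega> \<phi> (indicator (grid_cell \<delta> m)))^2)"
    using test_functions_grid_Poincare[OF dp] by blast
  have qL: "(indicator (grid_cell \<delta> m) :: real^'d \<Rightarrow> real) \<in> L2 \<Omega>" for m :: "'d \<Rightarrow> int"
  proof (rule L2_dominated(1)[where f = "\<lambda>x. 1::real" and M = 1])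
    show "(\<lambda>x. 1::real) \<in> L2 \<Omega>" by (rule L2_const[OF domain_lmeasurable])
    have "(indicator (grid_cell \<delta> m) :: real^'d \<Rightarrow> real) \<in> borel_measurable lborel"
      using grid_cell_measure(1)[OF dp, of m] by simp
    then show "(indicator (grid_cell \<delta> m) :: real^'d \<Rightarrow> real) \<in> borel_measurable (lebesgue_on \<Omega>)"
      by (intro measurable_restrict_space1 measurable_completion)
    show "AE x in lebesgue_on \<Omega>. norm (indicator (grid_cell \<delta> m) x :: real) \<le> 1 * norm (1::real)"
      by (intro AE_I2) (simp split: split_indicator)
  qed simp
  have "(L2_norm \<Omega> v)^2 \<le> \<epsilon> * (L2_norm \<Omega> (weak_grad \<Omega> v))^2
      + (1 / \<delta> ^ CARD('d)) * (\<Sum>m\<in>J. (L2_inner \<Omega> v (indicator (grid_cell \<delta> m)))^2)" if v: "v \<in> H10 \<Omega>" for v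
  proof -
    obtain \<phi> where \<phi>: "\<And>n. \<phi> n \<in> test_functions \<Omega>"
      "(\<lambda>n. L2_norm \<Omega> (\<lambda>x. \<phi> n x - v x)) \<longlonglongrightarrow> 0"
      "(\<lambda>n. L2_norm \<Omega> (\<lambda>x. gradient (\<phi> n) x - weak_grad \<Omega> v x)) \<longlonglongrightarrow> 0" using H10_approx[OF v] by blast
    have le: "(L2_norm \<Omega> (\<phi> n))^2 \<le> \<epsilon> * (L2_norm \<Omega> (gradient (\<phi> n)))^2
      + (1 / \<delta> ^ CARD('d)) * (\<Sum>m\<in>J. (L2_inner \<Omega> (\<phi> n) (indicator (grid_cell \<delta> m)))^2)" for n
      using J(2)[OF \<phi>(1)[of n]] unfolding Kd[symmetric] K_def by (simp add: power_mult_distrib mult_ac)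
    show ?thesis
    proof (rule LIMSEQ_le)
      show "(\<lambda>n. (L2_norm \<Omega> (\<phi> n))^2) \<longlonglongrightarrow> (L2_norm \<Omega> v)^2"
        by (intro tendsto_power L2_norm_tendsto[OF test_L2[OF \<phi>(1)] H10_L2[OF v] \<phi>(2)])
      show "(\<lambda>n. \<epsilon> * (L2_norm \<Omega> (gradient (\<phi> n)))^2
      + (1 / \<delta> ^ CARD('d)) * (\<Sum>m\<in>J. (L2_inner \<Omega> (\<phi> n) (indicator (grid_cell \<delta> m)))^2)) \<longlonglongrightarrow>
        \<epsilon> * (L2_norm \<Omega> (weak_grad \<Omega> v))^2
      + (1 / \<delta> ^ CARD('d)) * (\<Sum>m\<in>J. (L2_inner \<Omega> v (indicator (grid_cell \<delta> m)))^2)"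
        by (intro tendsto_add tendsto_mult tendsto_const tendsto_power tendsto_sum
            L2_norm_tendsto[OF test_gradient_L2[OF \<phi>(1)] H10_weak_grad_L2[OF v] \<phi>(3)]
            L2_inner_tendsto_left[OF test_L2[OF \<phi>(1)] H10_L2[OF v] qL \<phi>(2)])
    qed (use le in blast)
  qed
  with J(1) qL dp show ?thesis by (intro that[of J "\<lambda>m. indicator (grid_cell \<delta> m)" "1 / \<delta> ^ CARD('d)"]) auto
qed

end

section \<open>Square roots of positive definite matrices\<close>

lemma symmetric_inner: "transpose M = M \<Longrightarrow> x \<bullet> (M *v y) = (M *v x) \<bullet> (y :: real^'n)"
  by (metis dot_lmul_matrix matrix_vector_mul_linear transpose_matrix_vector)

text \<open>
  A maximiser \<open>v\<close> of the quadratic form on the unit sphere of \<open>S\<close> is an eigenvector: with the maximum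
  \<open>r\<close>, the form \<open>r |y|\<^sup>2 - y \<cdot> My\<close> is nonnegative on \<open>S\<close> and vanishes at \<open>v\<close>, so its first variation at \<open>v\<close>
  vanishes.  It is evaluated in the direction of the residual \<open>w = rv - Mv\<close>, which belongs to \<open>S\<close>.
\<close>

lemma symmetric_eigenvector:
  fixes M :: "real^'n^'n"
  assumes sym: "transpose M = M" and S: "subspace S" and inv: "\<And>x. x \<in> S \<Longrightarrow> M *v x \<in> S"
    and ne: "S \<noteq> {0}"
  obtains v r where "v \<in> S" "norm v = 1" "M *v v = r *\<^sub>R v"
proof -
  have "compact (S \<inter> sphere 0 1)"
    using closed_subspace[OF S] compact_sphere by (simp add: closed_Int_compact)
  moreover obtain x where x: "x \<in> S" "x \<noteq> 0" using ne subspace_0[OF S] by blast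
  then have "(1 / norm x) *\<^sub>R x \<in> S \<inter> sphere 0 1" using S by (auto simp: subspace_scale)
  then have "S \<inter> sphere 0 1 \<noteq> {}" by blast
  moreover have "continuous_on (S \<inter> sphere 0 1) (\<lambda>x. x \<bullet> (M *v x))"
    by (intro continuous_intros)
  ultimately obtain v where v': "v \<in> S \<inter> sphere 0 1"
    and max': "\<forall>y\<in>S \<inter> sphere 0 1. y \<bullet> (M *v y) \<le> v \<bullet> (M *v v)"
    using continuous_attains_sup[of "S \<inter> sphere 0 1" "\<lambda>x. x \<bullet> (M *v x)"] by blast
  from v' have v: "v \<in> S" "norm v = 1" by auto
  have max: "y \<bullet> (M *v y) \<le> v \<bullet> (M *v v)" if "y \<in> S" "norm y = 1" for y
    using max' that by simp
  define r where "r = v \<bullet> (M *v v)"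
  have q: "0 \<le> r * (y \<bullet> y) - y \<bullet> (M *v y)" if "y \<in> S" for y
  proof (cases "y = 0")
    case False
    have "((1 / norm y) *\<^sub>R y) \<bullet> (M *v ((1 / norm y) *\<^sub>R y)) \<le> r"
      unfolding r_def by (rule max) (use False that S in \<open>auto simp: subspace_scale\<close>)
    then have "(y \<bullet> (M *v y)) / (norm y)^2 \<le> r"
      by (simp add: matrix_vector_mult_scaleR power2_eq_square)
    then show ?thesis using False by (simp add: divide_le_eq power2_norm_eq_inner)
  qed simp
  define w where "w = r *\<^sub>R v - M *v v"
  have wS: "w \<in> S" unfolding w_def using v(1) S inv by (intro subspace_diff subspace_scale) auto
  have vv: "v \<bullet> v = 1" using v(2) by (simp add: dot_square_norm)
  have "2 * (w \<bullet> w) \<le> t * (r * (w \<bullet> w) - w \<bullet> (M *v w))" if "t > 0" for t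
  proof -
    have "v - t *\<^sub>R w \<in> S" using v(1) wS S by (intro subspace_diff subspace_scale) auto
    from q[OF this] have "0 \<le> r * ((v - t *\<^sub>R w) \<bullet> (v - t *\<^sub>R w)) - (v - t *\<^sub>R w) \<bullet> (M *v (v - t *\<^sub>R w))" .
    also have "\<dots> = - 2 * t * (r * (v \<bullet> w) - w \<bullet> (M *v v)) + t^2 * (r * (w \<bullet> w) - w \<bullet> (M *v w))"
      using symmetric_inner[OF sym, of v w] vv
      by (simp add: inner_diff_left inner_diff_right matrix_vector_mult_diff_distrib matrix_vector_mult_scaleR
          inner_commute[of w v] inner_commute[of "M *v v"] power2_eq_square algebra_simps flip: r_def)
    also have "r * (v \<bullet> w) - w \<bullet> (M *v v) = w \<bullet> w"
      by (subst (4) w_def) (simp add: inner_diff_right inner_commute)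
    finally have "t * (2 * (w \<bullet> w)) \<le> t * (t * (r * (w \<bullet> w) - w \<bullet> (M *v w)))"
      by (simp add: power2_eq_square algebra_simps)
    then show ?thesis using that by simp
  qed
  note bound = this
  have "((\<lambda>t. t * (r * (w \<bullet> w) - w \<bullet> (M *v w))) \<longlongrightarrow> 0 * (r * (w \<bullet> w) - w \<bullet> (M *v w))) (at_right 0)"
    by (intro tendsto_intros)
  moreover have "\<forall>\<^sub>F t in at_right 0. 2 * (w \<bullet> w) \<le> t * (r * (w \<bullet> w) - w \<bullet> (M *v w))"
    using eventually_at_right_less[of "0::real"] by eventually_elim (rule bound)
  ultimately have "2 * (w \<bullet> w) \<le> 0 * (r * (w \<bullet> w) - w \<bullet> (M *v w))"
    by (intro tendsto_lowerbound) auto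
  then have "w = 0" using inner_ge_zero[of w] by (simp add: inner_eq_zero_iff)
  then show ?thesis using that[of v r] v by (simp add: w_def)
qed

lemma symmetric_eigenbasis:
  fixes M :: "real^'n^'n"
  assumes sym: "transpose M = M"
  shows "subspace S \<Longrightarrow> (\<And>x. x \<in> S \<Longrightarrow> M *v x \<in> S) \<Longrightarrow>
    \<exists>B. finite B \<and> pairwise orthogonal B \<and> (\<forall>v\<in>B. norm v = 1 \<and> (\<exists>r. M *v v = r *\<^sub>R v)) \<and> span B = S"
proof (induction "dim S" arbitrary: S rule: less_induct)
  case less
  show ?case
  proof (cases "S = {0}")
    case True
    then show ?thesis by (intro exI[of _ "{}"]) auto
  next
    case False
    obtain v r where v: "v \<in> S" "norm v = 1" "M *v v = r *\<^sub>R v"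
      using symmetric_eigenvector[OF sym less.prems(1) _ False] less.prems(2) by blast
    have vv: "v \<bullet> v = 1" using v(2) by (simp add: dot_square_norm)
    define T where "T = {x \<in> S. v \<bullet> x = 0}"
    have T: "subspace T"
      using less.prems(1) by (auto simp: T_def subspace_def inner_add_right)
    have TM: "M *v x \<in> T" if "x \<in> T" for x
      using that less.prems(2) symmetric_inner[OF sym, of v x] v(3) by (simp add: T_def)
    have "v \<notin> T" using vv by (simp add: T_def)
    moreover have "T \<subseteq> S" by (auto simp: T_def)
    ultimately have "T \<subset> S" using v(1) by blast
    then have "span T \<subset> span S" using T less.prems(1) by (simp add: span_eq_iff[THEN iffD2])
    then have "dim T < dim S" by (rule dim_psubset)
    from less.hyps[OF this T TM] obtain B where B: "finite B" "pairwise orthogonal B"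
      "\<forall>v\<in>B. norm v = 1 \<and> (\<exists>r. M *v v = r *\<^sub>R v)" "span B = T" by blast
    have BT: "B \<subseteq> T" using B(4) span_superset by blast
    have orth: "pairwise orthogonal (insert v B)"
      using B(2) BT by (auto simp: pairwise_insert orthogonal_def T_def inner_commute)
    have "span (insert v B) = S"
    proof
      show "span (insert v B) \<subseteq> S"
        using v(1) BT less.prems(1) by (intro span_minimal) (auto simp: T_def)
      show "S \<subseteq> span (insert v B)"
      proof
        fix x assume x: "x \<in> S"
        have "x - (v \<bullet> x) *\<^sub>R v \<in> T"
          using x v(1) vv less.prems(1) by (auto simp: T_def subspace_diff subspace_scale inner_diff_right)
        then have "x - (v \<bullet> x) *\<^sub>R v \<in> span (insert v B)"
          using B(4) span_mono[of B "insert v B"] by blast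
        moreover have "(v \<bullet> x) *\<^sub>R v \<in> span (insert v B)" by (intro span_scale span_base) simp
        ultimately have "(x - (v \<bullet> x) *\<^sub>R v) + (v \<bullet> x) *\<^sub>R v \<in> span (insert v B)" by (rule span_add)
        then show "x \<in> span (insert v B)" by simp
      qed
    qed
    then show ?thesis using B v orth by (intro exI[of _ "insert v B"]) auto
  qed
qed

text \<open>
  Existence: take square roots of the eigenvalues in an orthonormal eigenbasis.  Uniqueness: if
  \<open>C\<close> is another root and \<open>Mv = s\<^sup>2v\<close>, then \<open>z = Cv - sv\<close> satisfies \<open>Cz = -sz\<close>, which for a nonnegative
  \<open>C\<close> and \<open>s > 0\<close> forces \<open>z = 0\<close>.  Both are needed to give meaning to the definite description in
  \<open>mat_sqrt\<close>.
\<close>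

lemma mat_sqrt_exists_unique:
  fixes M :: "real^'n^'n"
  assumes sym: "transpose M = M" and pos: "\<And>y. y \<noteq> 0 \<Longrightarrow> 0 < y \<bullet> (M *v y)"
  shows "\<exists>!B. transpose B = B \<and> (\<forall>y. 0 \<le> y \<bullet> (B *v y)) \<and> B ** B = M"
proof -
  obtain U where U: "finite U" "pairwise orthogonal U" "\<And>v. v \<in> U \<Longrightarrow> norm v = 1"
    "\<And>v. v \<in> U \<Longrightarrow> \<exists>r. M *v v = r *\<^sub>R v" "span U = (UNIV :: (real^'n) set)"
    using symmetric_eigenbasis[OF sym, of UNIV] by auto
  then obtain r where r: "\<And>v. v \<in> U \<Longrightarrow> M *v v = r v *\<^sub>R v" by metis
  have rp: "r v > 0" if "v \<in> U" for v
  proof -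
    have "v \<noteq> 0" using U(3)[OF that] by auto
    from pos[OF this] show ?thesis using r[OF that] U(3)[OF that] by (simp add: dot_square_norm)
  qed
  define R where "R x = (\<Sum>u\<in>U. (sqrt (r u) * (u \<bullet> x)) *\<^sub>R u)" for x
  have Rlin: "linear R"
    unfolding R_def by (intro linearI) (simp_all add: inner_add_right algebra_simps sum.distrib scaleR_sum_right)
  have RU: "R v = sqrt (r v) *\<^sub>R v" if "v \<in> U" for v
  proof -
    have "R v = (\<Sum>u\<in>U. if u = v then sqrt (r v) *\<^sub>R v else 0)"
      unfolding R_def using U(2) U(3)[OF that] that
      by (intro sum.cong) (auto simp: pairwise_def orthogonal_def dot_square_norm)
    then show ?thesis using U(1) that by simp
  qed
  define B where "B = matrix R"
  have Bv: "B *v x = R x" for x unfolding B_def using matrix_works[of R] Rlin by (simp add: linear_matrix_vector_mul_eq)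
  have symR: "x \<bullet> R y = R x \<bullet> y" for x y
    unfolding R_def by (simp add: inner_sum_right inner_sum_left inner_commute mult_ac)
  have "transpose B = B"
  proof -
    have "transpose B *v x = B *v x" for x
    proof (rule vector_eq_rdot[THEN iffD1], rule allI)
      fix z show "(transpose B *v x) \<bullet> z = (B *v x) \<bullet> z"
        using symR[of x z] by (simp add: transpose_matrix_vector dot_lmul_matrix Bv)
    qed
    then show ?thesis by (simp add: matrix_eq)
  qed
  moreover have "0 \<le> y \<bullet> (B *v y)" for y
    unfolding Bv R_def inner_sum_right
    by (intro sum_nonneg) (use rp in \<open>auto simp: inner_commute[of y] mult.assoc less_imp_le\<close>)
  moreover have "B ** B = M"
  proof -
    have "linear (\<lambda>x. R (R x))" using linear_compose[OF Rlin Rlin] by (simp add: o_def)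
    moreover have "R (R v) = M *v v" if "v \<in> U" for v
      using rp[OF that] by (simp add: RU[OF that] linear_cmul[OF Rlin] r[OF that])
    ultimately have "R (R x) = M *v x" for x
      using linear_eq_on_span[of "\<lambda>x. R (R x)" "(*v) M" U x] matrix_vector_mul_linear[of M] U(5) by auto
    then show ?thesis unfolding matrix_eq by (simp add: Bv flip: matrix_vector_mul_assoc)
  qed
  moreover have "C = B" if C: "transpose C = C" "\<forall>y. 0 \<le> y \<bullet> (C *v y)" "C ** C = M" for C
  proof -
    have "C *v v = R v" if "v \<in> U" for v
    proof -
      define s where "s = sqrt (r v)"
      have s: "s > 0" "s * s = r v" using rp[OF that] by (simp_all add: s_def)
      define z where "z = C *v v - s *\<^sub>R v"
      have "C *v z + s *\<^sub>R z = 0"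
        using r[OF that] s(2) C(3)[symmetric]
        by (simp add: z_def matrix_vector_mult_diff_distrib matrix_vector_mult_scaleR matrix_vector_mul_assoc scaleR_diff_right)
      then have "z \<bullet> (C *v z + s *\<^sub>R z) = 0" by simp
      then have "z \<bullet> (C *v z) + s * (z \<bullet> z) = 0" by (simp add: inner_add_right)
      moreover have "0 \<le> z \<bullet> (C *v z)" using C(2) by blast
      moreover have "0 \<le> s * (z \<bullet> z)" using s by simp
      ultimately have "s * (z \<bullet> z) = 0" by linarith
      then have "z = 0" using s by simp
      then show ?thesis by (simp add: z_def RU[OF that] s_def)
    qed
    then have "C *v x = R x" for x
      using linear_eq_on_span[of "(*v) C" R U x] matrix_vector_mul_linear[of C] Rlin U(5) by auto
    then show ?thesis by (simp add: matrix_eq Bv)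
  qed
  ultimately show ?thesis by blast
qed

text \<open>
  With \<open>B\<close> the square root of \<open>M\<close> one has \<open>Bw = z\<close> and \<open>|Bw|\<^sup>2 = w \<cdot> Mw\<close>, so ellipticity compares \<open>w\<close> with
  the residual \<open>z\<close>, in which no square root occurs.  The last statement, \<open>|w|\<^sup>2 = M\<^sup>-\<^sup>1z \<cdot> z\<close>, will show
  that \<open>|w|\<^sup>2\<close> depends measurably on the point.
\<close>

lemma sqrt_weighted_residual:
  fixes M :: "real^'n^'n" and s g f :: "real^'n"
  assumes sym: "transpose M = M" and "0 < \<Lambda>\<^sub>0"
    and ell: "\<And>y. \<Lambda>\<^sub>0 * (y \<bullet> y) \<le> y \<bullet> (M *v y) \<and> y \<bullet> (M *v y) \<le> \<Lambda>\<^sub>1 * (y \<bullet> y)"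
  defines "w \<equiv> matrix_inv (mat_sqrt M) *v s + mat_sqrt M *v g - mat_sqrt M *v f"
    and "z \<equiv> s + M *v g - M *v f"
  shows "\<Lambda>\<^sub>0 * (norm w)^2 \<le> (norm z)^2" "(norm z)^2 \<le> \<Lambda>\<^sub>1 * (norm w)^2"
    "M *v y = z \<Longrightarrow> (norm w)^2 = y \<bullet> z"
proof -
  define B where "B = mat_sqrt M"
  have pos: "0 < y \<bullet> (M *v y)" if "y \<noteq> 0" for y
  proof -
    have "0 < \<Lambda>\<^sub>0 * (y \<bullet> y)" using that \<open>0 < \<Lambda>\<^sub>0\<close> by simp
    then show ?thesis using ell[of y] by linarith
  qed
  have B: "transpose B = B" "\<And>y. 0 \<le> y \<bullet> (B *v y)" "B ** B = M"
    using theI'[OF mat_sqrt_exists_unique[OF sym pos]] unfolding B_def mat_sqrt_def by blast+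
  have inj: "x = 0" if "B *v x = 0" for x
  proof (rule ccontr)
    assume "x \<noteq> 0"
    have "M *v x = B *v (B *v x)" by (simp add: matrix_vector_mul_assoc B)
    with pos[OF \<open>x \<noteq> 0\<close>] that show False by simp
  qed
  then have "\<exists>B'. B' ** B = mat 1" by (simp add: matrix_left_invertible_ker)
  then have invB: "invertible B" by (simp add: invertible_left_inverse)
  then have BB: "B ** matrix_inv B = mat 1"
    unfolding invertible_def matrix_inv_def by (rule someI2_ex) blast
  have Bw: "B *v w = z"
    unfolding w_def z_def B_def[symmetric]
    by (simp add: matrix_vector_right_distrib matrix_vector_mult_diff_distrib matrix_vector_mul_assoc B(3) BB)
  have MB: "M *v x = B *v (B *v x)" for x by (simp add: matrix_vector_mul_assoc B(3))
  have nz: "(norm z)^2 = w \<bullet> (M *v w)"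
    using symmetric_inner[OF B(1), of w z] by (simp add: power2_norm_eq_inner MB Bw)
  show "\<Lambda>\<^sub>0 * (norm w)^2 \<le> (norm z)^2" "(norm z)^2 \<le> \<Lambda>\<^sub>1 * (norm w)^2"
    using ell[of w] nz by (simp_all only: power2_norm_eq_inner)
  show "(norm w)^2 = y \<bullet> z" if "M *v y = z"
  proof -
    have "B *v (B *v y - w) = 0"
      using that by (simp add: matrix_vector_mult_diff_distrib Bw MB)
    then have "B *v y = w" using inj by fastforce
    then show ?thesis using symmetric_inner[OF B(1), of y w] Bw by (simp add: power2_norm_eq_inner)
  qed
qed

lemma elliptic_matrix_bound:
  fixes M :: "real^'n^'n"
  assumes sym: "transpose M = M" and "0 < \<Lambda>\<^sub>0"
    and ell: "\<And>y. \<Lambda>\<^sub>0 * (y \<bullet> y) \<le> y \<bullet> (M *v y) \<and> y \<bullet> (M *v y) \<le> \<Lambda>\<^sub>1 * (y \<bullet> y)"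
  shows "norm (M *v y) \<le> \<Lambda>\<^sub>1 * norm y"
proof (cases "y = 0")
  case False
  then have "0 < \<Lambda>\<^sub>0 * (y \<bullet> y)" using \<open>0 < \<Lambda>\<^sub>0\<close> by simp
  with ell[of y] have "0 < \<Lambda>\<^sub>1 * (y \<bullet> y)" by linarith
  then have L1: "\<Lambda>\<^sub>1 > 0" using inner_ge_zero[of y] by (auto simp: zero_less_mult_iff)
  have "(norm (M *v y))^2 \<le> \<Lambda>\<^sub>1 * (y \<bullet> (M *v y))"
    using sqrt_weighted_residual(2)[OF sym \<open>0 < \<Lambda>\<^sub>0\<close> ell, of 0 y 0]
      sqrt_weighted_residual(3)[OF sym \<open>0 < \<Lambda>\<^sub>0\<close> ell, of y 0 y 0] by simp
  also have "\<dots> \<le> \<Lambda>\<^sub>1 * (\<Lambda>\<^sub>1 * (y \<bullet> y))" using ell[of y] L1 by (intro mult_left_mono) auto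
  also have "\<dots> = (\<Lambda>\<^sub>1 * norm y)^2" by (simp add: power2_eq_square power2_norm_eq_inner[symmetric])
  finally show ?thesis by (rule power2_le_imp_le) (use L1 in simp)
qed simp

section \<open>Measurability of matrix fields\<close>

lemma borel_measurable_vec_iff:
  fixes f :: "'a \<Rightarrow> real^'n"
  shows "f \<in> borel_measurable N \<longleftrightarrow> (\<forall>i. (\<lambda>x. f x $ i) \<in> borel_measurable N)"
proof -
  have "f \<in> borel_measurable N \<longleftrightarrow> (\<forall>b\<in>Basis. (\<lambda>x. f x \<bullet> b) \<in> borel_measurable N)"
    by (rule borel_measurable_euclidean_space)
  also have "\<dots> \<longleftrightarrow> (\<forall>i. (\<lambda>x. f x $ i) \<in> borel_measurable N)"
    by (auto simp: Basis_vec_def inner_axis)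
  finally show ?thesis .
qed

lemma borel_measurable_matrix_entry:
  fixes A :: "'a \<Rightarrow> real^'n^'m"
  assumes "A \<in> borel_measurable N" shows "(\<lambda>x. A x $ i $ j) \<in> borel_measurable N"
proof -
  have "(\<lambda>x. A x \<bullet> axis i (axis j 1)) \<in> borel_measurable N"
    by (intro borel_measurable_inner assms borel_measurable_const)
  then show ?thesis by (simp add: inner_axis)
qed

lemma borel_measurable_matrix_vector_mult:
  fixes A :: "'a \<Rightarrow> real^'n^'m"
  assumes "A \<in> borel_measurable N" "g \<in> borel_measurable N"
  shows "(\<lambda>x. A x *v g x) \<in> borel_measurable N"
  unfolding borel_measurable_vec_iff matrix_vector_mult_def vec_lambda_beta
  using assms(2) unfolding borel_measurable_vec_iff[of g]
  by (intro allI borel_measurable_sum borel_measurable_times borel_measurable_matrix_entry[OF assms(1)]) auto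

lemma borel_measurable_det:
  fixes A :: "'a \<Rightarrow> real^'n^'n"
  assumes "\<And>i j. (\<lambda>x. A x $ i $ j) \<in> borel_measurable N"
  shows "(\<lambda>x. det (A x)) \<in> borel_measurable N"
  unfolding det_def
  by (intro borel_measurable_sum borel_measurable_times borel_measurable_const borel_measurable_prod assms)

text \<open>
  Cramer's rule expresses the solution by determinants, which are polynomials in the entries.
\<close>

lemma borel_measurable_linear_solve:
  fixes A :: "'a \<Rightarrow> real^'n^'n"
  assumes A: "A \<in> borel_measurable N" and z: "z \<in> borel_measurable N"
  obtains y where "y \<in> borel_measurable N" "\<And>x. det (A x) \<noteq> 0 \<Longrightarrow> A x *v y x = z x"
proof
  let ?y = "\<lambda>x. \<chi> k. det (\<chi> i j. if j = k then z x $ i else A x $ i $ j) / det (A x)"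
  have zi: "(\<lambda>x. z x $ i) \<in> borel_measurable N" for i using z unfolding borel_measurable_vec_iff by blast
  have "(\<lambda>x. (\<chi> i j. if j = k then z x $ i else A x $ i $ j) $ i $ j) \<in> borel_measurable N" for i j k
    using zi borel_measurable_matrix_entry[OF A, of i j] by (cases "j = k") simp_all
  then have "(\<lambda>x. det (\<chi> i j. if j = k then z x $ i else A x $ i $ j)) \<in> borel_measurable N" for k
    by (rule borel_measurable_det)
  moreover have "(\<lambda>x. det (A x)) \<in> borel_measurable N"
    by (intro borel_measurable_det borel_measurable_matrix_entry A)
  ultimately show "?y \<in> borel_measurable N"
    unfolding borel_measurable_vec_iff vec_lambda_beta by (intro allI borel_measurable_divide)
  show "A x *v ?y x = z x" if "det (A x) \<noteq> 0" for x
    using cramer[OF that, of "?y x" "z x"] by simp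
qed

section \<open>Meshes\<close>

text \<open>
  The graph is the image of a hyperplane, a null set, under the Lipschitz map \<open>y \<mapsto> y + \<gamma>(y) n\<close>.
\<close>

lemma lipschitz_graph_negligible:
  fixes \<gamma> :: "real^'d \<Rightarrow> real"
  assumes n: "norm n = 1" and L: "L-lipschitz_on {y. n \<bullet> y = 0} \<gamma>"
  shows "negligible {x. \<gamma> (x - (n \<bullet> x) *\<^sub>R n) = n \<bullet> x}"
proof -
  let ?H = "{y. n \<bullet> y = 0}" and ?f = "\<lambda>y. y + \<gamma> y *\<^sub>R n"
  have nn: "n \<bullet> n = 1" using n by (simp add: dot_square_norm)
  have "negligible (?f ` ?H)"
  proof (rule negligible_locally_Lipschitz_image)
    show "negligible ?H" by (rule negligible_hyperplane) (use n in auto)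
    show "\<exists>T B. open T \<and> x \<in> T \<and> (\<forall>y\<in>?H \<inter> T. norm (?f y - ?f x) \<le> B * norm (y - x))" if "x \<in> ?H" for x
    proof (intro exI[of _ UNIV] exI[of _ "1 + L"] conjI ballI)
      fix y assume "y \<in> ?H \<inter> UNIV"
      then have "\<bar>\<gamma> y - \<gamma> x\<bar> \<le> L * norm (y - x)"
        using lipschitz_onD[OF L, of y x] that by (simp add: dist_norm)
      moreover have "norm (?f y - ?f x) \<le> norm (y - x) + norm ((\<gamma> y - \<gamma> x) *\<^sub>R n)"
        using norm_triangle_ineq[of "y - x" "(\<gamma> y - \<gamma> x) *\<^sub>R n"] by (simp add: algebra_simps)
      moreover have "norm ((\<gamma> y - \<gamma> x) *\<^sub>R n) = \<bar>\<gamma> y - \<gamma> x\<bar>" by (simp add: n)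
      moreover have "(1 + L) * norm (y - x) = norm (y - x) + L * norm (y - x)" by (simp add: distrib_right)
      ultimately show "norm (?f y - ?f x) \<le> (1 + L) * norm (y - x)" by linarith
    qed auto
  qed simp
  moreover have "{x. \<gamma> (x - (n \<bullet> x) *\<^sub>R n) = n \<bullet> x} \<subseteq> ?f ` ?H"
  proof
    fix x assume "x \<in> {x. \<gamma> (x - (n \<bullet> x) *\<^sub>R n) = n \<bullet> x}"
    then have "x = ?f (x - (n \<bullet> x) *\<^sub>R n)" "x - (n \<bullet> x) *\<^sub>R n \<in> ?H"
      by (simp_all add: inner_diff_right nn)
    then show "x \<in> ?f ` ?H" by blast
  qed
  ultimately show ?thesis by (rule negligible_subset)
qed

text \<open>
  For an open set alone this is false.  It is what makes the values of the discrete functions on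
  \<open>frontier \<Omega>\<close>, which the closed simplices contain but which carry no information, irrelevant for
  the estimator.
\<close>

lemma lipschitz_frontier_negligible:
  fixes \<Omega> :: "(real^'d) set"
  assumes \<Omega>: "open \<Omega>" "lipschitz_boundary \<Omega>"
  shows "negligible (frontier \<Omega>)"
proof -
  have local: "\<exists>r>0. negligible (frontier \<Omega> \<inter> ball p r)" if p: "p \<in> frontier \<Omega>" for p
  proof -
    obtain r n L and \<gamma> :: "real^'d \<Rightarrow> real" where r: "r > 0" and n: "norm n = 1" and L: "L-lipschitz_on {y. n \<bullet> y = 0} \<gamma>"
      and eq: "\<Omega> \<inter> ball p r = {x \<in> ball p r. \<gamma> (x - (n \<bullet> x) *\<^sub>R n) < n \<bullet> x}"
      using \<Omega>(2) p unfolding lipschitz_boundary_def by blast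
    have nn: "n \<bullet> n = 1" using n by (simp add: dot_square_norm)
    have "continuous_on UNIV (\<lambda>x. \<gamma> (x - (n \<bullet> x) *\<^sub>R n))"
      by (rule continuous_on_compose2[OF lipschitz_on_continuous_on[OF L]])
         (auto intro!: continuous_intros simp: inner_diff_right nn)
    then have c: "continuous_on UNIV (\<lambda>x. n \<bullet> x - \<gamma> (x - (n \<bullet> x) *\<^sub>R n))"
      by (intro continuous_intros)
    have "frontier \<Omega> \<inter> ball p r \<subseteq> {x. \<gamma> (x - (n \<bullet> x) *\<^sub>R n) = n \<bullet> x}"
    proof
      fix x assume x: "x \<in> frontier \<Omega> \<inter> ball p r"
      let ?g = "\<lambda>x. n \<bullet> x - \<gamma> (x - (n \<bullet> x) *\<^sub>R n)"
      have "x \<notin> \<Omega>" using x \<Omega>(1) by (auto simp: frontier_def interior_open)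
      then have "x \<notin> {x \<in> ball p r. \<gamma> (x - (n \<bullet> x) *\<^sub>R n) < n \<bullet> x}" unfolding eq[symmetric] by blast
      then have "?g x \<le> 0" using x by simp
      moreover have "\<not> ?g x < 0"
      proof
        assume "?g x < 0"
        \<comment> \<open>Near \<open>x\<close> the domain would be empty, although \<open>x\<close> lies in its closure.\<close>
        define U where "U = ball p r \<inter> {x. ?g x < 0}"
        have "open {x. ?g x < 0}" by (rule open_Collect_less[OF c continuous_on_const])
        then have "open U" unfolding U_def by (intro open_Int open_ball)
        moreover have "U \<inter> \<Omega> = {}"
        proof -
          have "U \<inter> \<Omega> \<subseteq> {x \<in> ball p r. \<gamma> (x - (n \<bullet> x) *\<^sub>R n) < n \<bullet> x}"
            unfolding eq[symmetric] U_def by blast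
          then show ?thesis unfolding U_def by auto
        qed
        ultimately have "U \<inter> closure \<Omega> = {}" using open_Int_closure_eq_empty by blast
        moreover have "x \<in> U" using x \<open>?g x < 0\<close> by (simp add: U_def)
        moreover have "x \<in> closure \<Omega>" using x by (simp add: frontier_def)
        ultimately show False by blast
      qed
      ultimately show "x \<in> {x. \<gamma> (x - (n \<bullet> x) *\<^sub>R n) = n \<bullet> x}" by simp
    qed
    then have "negligible (frontier \<Omega> \<inter> ball p r)"
      using negligible_subset[OF lipschitz_graph_negligible[OF n L]] by blast
    with r show ?thesis by blast
  qed
  show ?thesis
  proof (rule locally_negligible_alt[THEN iffD2], rule ballI)
    fix x assume x: "x \<in> frontier \<Omega>"
    obtain r where "r > 0" "negligible (frontier \<Omega> \<inter> ball x r)" using local[OF x] by blast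
    moreover have "openin (top_of_set (frontier \<Omega>)) (frontier \<Omega> \<inter> ball x r)" by (simp add: openin_open_Int)
    ultimately show "\<exists>U. openin (top_of_set (frontier \<Omega>)) U \<and> x \<in> U \<and> negligible U"
      using x by (intro exI[of _ "frontier \<Omega> \<inter> ball x r"]) simp
  qed
qed

text \<open>
  The intersection is a proper face of at least one of the two simplices, so its affine dimension
  drops.
\<close>

lemma full_simplices_overlap_negligible:
  fixes \<T> :: "(real^'d) set set"
  assumes tri: "triangulation \<T>" and full: "\<And>K. K \<in> \<T> \<Longrightarrow> int CARD('d) simplex K"
    and K: "K \<in> \<T>" "K' \<in> \<T>" "K \<noteq> K'"
  shows "negligible (K \<inter> K')"
proof -
  have inter: "\<And>T T'. T \<in> \<T> \<Longrightarrow> T' \<in> \<T> \<Longrightarrow> T \<inter> T' face_of T"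
    using tri unfolding triangulation_def by blast
  have face: "K \<inter> K' face_of K" "K \<inter> K' face_of K'"
    using inter[OF K(1,2)] inter[OF K(2,1)] by (simp_all only: Int_commute[of K'])
  have dims: "aff_dim K = int CARD('d)" "aff_dim K' = int CARD('d)"
    by (rule aff_dim_simplex[OF full], rule K)+
  have conv: "convex K" "convex K'" by (rule convex_simplex[OF full], rule K)+
  have "K \<inter> K' \<noteq> K \<or> K \<inter> K' \<noteq> K'" using K(3) by blast
  then have "aff_dim (K \<inter> K') < int CARD('d)"
    using face_of_aff_dim_lt[OF conv(1) face(1)] face_of_aff_dim_lt[OF conv(2) face(2)] dims by metis
  then have "interior (K \<inter> K') = {}" by (intro low_dim_interior) simp
  then show ?thesis using negligible_convex_interior[OF convex_Int[OF conv]] by simp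
qed

lemma borel_measurable_lebesgue_AE:
  fixes g h :: "'a::euclidean_space \<Rightarrow> 'b::topological_space"
  assumes h: "h \<in> borel_measurable lebesgue" and eq: "AE x in lebesgue. g x = h x"
  shows "g \<in> borel_measurable lebesgue"
proof (rule measurableI)
  fix S :: "'b set" assume S: "S \<in> sets borel"
  show "g -` S \<inter> space lebesgue \<in> sets lebesgue"
  proof (rule completion.in_sets_AE)
    show "h -` S \<inter> space lebesgue \<in> sets lebesgue" by (rule measurable_sets[OF h S])
    show "AE x in lebesgue. (x \<in> h -` S \<inter> space lebesgue) = (x \<in> g -` S \<inter> space lebesgue)"
      using eq by eventually_elim simp
  qed simp
qed simp

text \<open>
  Two functions \<open>F\<close> and \<open>h\<close> appear because the integrand of the estimator is only known to agree
  almost everywhere with a measurable function; completeness of Lebesgue measure then makes it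
  measurable.
\<close>

theorem mesh_integral:
  fixes F h :: "real^'d \<Rightarrow> real"
  assumes \<Omega>: "open \<Omega>" "lipschitz_boundary \<Omega>" and mesh: "regular_mesh \<kappa> \<Omega> \<T>"
    and h: "integrable (lebesgue_on \<Omega>) h" and eq: "AE x in lebesgue_on \<Omega>. F x = h x"
  shows "(\<Sum>K\<in>\<T>. LINT x|lebesgue_on K. F x) = (LINT x|lebesgue_on \<Omega>. h x)"
proof -
  note \<Omega>L = open_in_sets_lebesgue[OF \<Omega>(1)]
  have tri: "triangulation \<T>" and full: "\<And>K. K \<in> \<T> \<Longrightarrow> int CARD('d) simplex K" and cover: "\<Union>\<T> = closure \<Omega>"
    using mesh by (auto simp: regular_mesh_def)
  have fin: "finite \<T>" using tri by (simp add: triangulation_def)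
  have KL: "K \<in> sets lebesgue" if "K \<in> \<T>" for K
    using closed_simplex[OF full[OF that]] by (simp add: borel_closed sets_completionI_sets)
  define g where "g x = indicator \<Omega> x *\<^sub>R h x" for x
  have g: "integrable lebesgue g"
    unfolding g_def using h \<Omega>L by (subst (asm) integrable_restrict_space) auto
  have fr: "AE x in lebesgue. x \<notin> frontier \<Omega>"
    using lipschitz_frontier_negligible[OF \<Omega>] by (intro AE_not_in) (simp add: negligible_iff_null_sets)
  have eq': "AE x in lebesgue. x \<in> \<Omega> \<longrightarrow> F x = h x"
    using eq \<Omega>L by (simp add: AE_restrict_space_iff)
  have ov: "AE x in lebesgue. \<forall>K\<in>\<T>. \<forall>K'\<in>\<T>. K \<noteq> K' \<longrightarrow> x \<notin> K \<inter> K'"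
  proof (intro AE_finite_allI fin)
    fix K K' assume KK: "K \<in> \<T>" "K' \<in> \<T>"
    show "AE x in lebesgue. K \<noteq> K' \<longrightarrow> x \<notin> K \<inter> K'"
    proof (cases "K = K'")
      case False
      have "K \<inter> K' \<in> null_sets lebesgue"
        using full_simplices_overlap_negligible[OF tri full KK False] by (simp add: negligible_iff_null_sets)
      from AE_not_in[OF this] show ?thesis by eventually_elim simp
    qed simp
  qed
  have piece: "(LINT x|lebesgue_on K. F x) = (LINT x|lebesgue. indicator K x *\<^sub>R g x)"
    and piece_int: "integrable lebesgue (\<lambda>x. indicator K x *\<^sub>R g x)" if K: "K \<in> \<T>" for K
  proof -
    show i: "integrable lebesgue (\<lambda>x. indicator K x *\<^sub>R g x)" by (rule integrable_mult_indicator[OF KL[OF K] g])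
    have sub: "x \<in> \<Omega> \<or> x \<in> frontier \<Omega>" if "x \<in> K" for x
      using that K cover \<Omega>(1) by (auto simp: frontier_def interior_open)
    have ae: "AE x in lebesgue. indicator K x *\<^sub>R F x = indicator K x *\<^sub>R g x"
      using fr eq' by eventually_elim (use sub in \<open>auto simp: g_def indicator_def\<close>)
    have m: "(\<lambda>x. indicator K x *\<^sub>R F x) \<in> borel_measurable lebesgue"
      by (rule borel_measurable_lebesgue_AE[OF borel_measurable_integrable[OF i] ae])
    have "(LINT x|lebesgue_on K. F x) = (LINT x|lebesgue. indicator K x *\<^sub>R F x)"
      using KL[OF K] by (subst integral_restrict_space) auto
    also have "\<dots> = (LINT x|lebesgue. indicator K x *\<^sub>R g x)"
      by (rule integral_cong_AE[OF m borel_measurable_integrable[OF i] ae])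
    finally show "(LINT x|lebesgue_on K. F x) = (LINT x|lebesgue. indicator K x *\<^sub>R g x)" .
  qed
  have "(\<Sum>K\<in>\<T>. LINT x|lebesgue_on K. F x) = (\<Sum>K\<in>\<T>. LINT x|lebesgue. indicator K x *\<^sub>R g x)"
    by (intro sum.cong refl piece)
  also have "\<dots> = (LINT x|lebesgue. (\<Sum>K\<in>\<T>. indicator K x *\<^sub>R g x))"
    by (rule Bochner_Integration.integral_sum[symmetric]) (rule piece_int)
  also have "\<dots> = (LINT x|lebesgue. g x)"
  proof (rule integral_cong_AE)
    show "(\<lambda>x. \<Sum>K\<in>\<T>. indicator K x *\<^sub>R g x) \<in> borel_measurable lebesgue"
      by (intro borel_measurable_sum borel_measurable_integrable piece_int)
    show "g \<in> borel_measurable lebesgue" by (rule borel_measurable_integrable[OF g])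
    show "AE x in lebesgue. (\<Sum>K\<in>\<T>. indicator K x *\<^sub>R g x) = g x"
      using ov
    proof eventually_elim
      case (elim x)
      show ?case
      proof (cases "x \<in> \<Omega>")
        case True
        then have "x \<in> \<Union>\<T>" using cover closure_subset by blast
        then obtain K where K: "K \<in> \<T>" "x \<in> K" by blast
        have "(\<Sum>K'\<in>\<T>. indicator K' x *\<^sub>R g x) = (\<Sum>K'\<in>\<T>. if K' = K then g x else 0)"
        proof (intro sum.cong refl)
          fix K' assume "K' \<in> \<T>"
          then have "x \<notin> K'" if "K' \<noteq> K" using elim K that by blast
          then show "indicator K' x *\<^sub>R g x = (if K' = K then g x else 0)" using K(2) by auto
        qed
        then show ?thesis using K(1) fin by simp
      qed (simp add: g_def)
    qed
  qed
  also have "\<dots> = (LINT x|lebesgue_on \<Omega>. h x)"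
    unfolding g_def using \<Omega>L by (subst integral_restrict_space) auto
  finally show ?thesis .
qed

section \<open>Stability of the weak problem\<close>

lemma Linf_bound:
  assumes "f \<in> Linf S"
  obtains M where "M \<ge> 0" "f \<in> borel_measurable (lebesgue_on S)" "AE x in lebesgue_on S. norm (f x) \<le> M"
proof -
  obtain M where M: "AE x in lebesgue_on S. norm (f x) \<le> M" and m: "f \<in> borel_measurable (lebesgue_on S)"
    using assms by (auto simp: Linf_def)
  have "AE x in lebesgue_on S. norm (f x) \<le> \<bar>M\<bar>" using M by eventually_elim simp
  with m show ?thesis using that[of "\<bar>M\<bar>"] by simp
qed

lemma convergent_subsequence_finite:
  fixes l :: "'j \<Rightarrow> nat \<Rightarrow> real"
  assumes "finite J" and "\<And>j. j \<in> J \<Longrightarrow> bounded (range (l j))"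
  shows "\<exists>r :: nat \<Rightarrow> nat. strict_mono r \<and> (\<forall>j\<in>J. convergent (l j \<circ> r))"
  using assms
proof (induction J rule: finite_induct)
  case empty
  show ?case by (intro exI[of _ id]) (auto simp: strict_mono_def)
next
  case (insert j J)
  then have "\<exists>r :: nat \<Rightarrow> nat. strict_mono r \<and> (\<forall>i\<in>J. convergent (l i \<circ> r))" by blast
  then obtain r :: "nat \<Rightarrow> nat" where r: "strict_mono r" "\<forall>i\<in>J. convergent (l i \<circ> r)" by blast
  have "bounded (range (l j \<circ> r))"
    by (rule bounded_subset[of "range (l j)"]) (use insert.prems in auto)
  then obtain L and s :: "nat \<Rightarrow> nat" where s: "strict_mono s" "((l j \<circ> r) \<circ> s) \<longlonglongrightarrow> L"
    using bounded_imp_convergent_subsequence by blast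
  have "convergent (l i \<circ> (r \<circ> s))" if "i \<in> insert j J" for i
  proof (cases "i = j")
    case True
    then show ?thesis using s(2) by (auto simp: convergent_def o_assoc)
  next
    case False
    then have "convergent (l i \<circ> r)" using r(2) that by blast
    then show ?thesis using LIMSEQ_subseq_LIMSEQ[OF _ s(1), of "l i \<circ> r"] by (auto simp: convergent_def o_assoc)
  qed
  with strict_mono_o[OF r(1) s(1)] show ?case by blast
qed

text \<open>
  The bounds of the lower order coefficients are parameters, so that the constants below can be
  written down.
\<close>

locale elliptic_problem = bounded_domain +
  fixes A :: "real^'d \<Rightarrow> real^'d^'d" and b :: "real^'d \<Rightarrow> real^'d" and c :: "real^'d \<Rightarrow> real"
    and \<Lambda>\<^sub>0 \<Lambda>\<^sub>1 Mb Mc :: real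
  assumes A_measurable: "A \<in> borel_measurable (lebesgue_on \<Omega>)"
    and A_sym: "AE x in lebesgue_on \<Omega>. transpose (A x) = A x"
    and A_elliptic: "AE x in lebesgue_on \<Omega>. \<forall>y. \<Lambda>\<^sub>0 * (y \<bullet> y) \<le> y \<bullet> (A x *v y) \<and>
                                      y \<bullet> (A x *v y) \<le> \<Lambda>\<^sub>1 * (y \<bullet> y)"
    and Lam: "0 < \<Lambda>\<^sub>0" "\<Lambda>\<^sub>0 \<le> \<Lambda>\<^sub>1"
    and b: "b \<in> borel_measurable (lebesgue_on \<Omega>)" "AE x in lebesgue_on \<Omega>. norm (b x) \<le> Mb" "0 \<le> Mb"
    and c: "c \<in> borel_measurable (lebesgue_on \<Omega>)" "AE x in lebesgue_on \<Omega>. norm (c x) \<le> Mc" "0 \<le> Mc"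
begin

lemma A_L2:
  assumes g: "g \<in> L2 \<Omega>"
  shows "(\<lambda>x. A x *v g x) \<in> L2 \<Omega>" "L2_norm \<Omega> (\<lambda>x. A x *v g x) \<le> \<Lambda>\<^sub>1 * L2_norm \<Omega> g"
proof -
  have m: "(\<lambda>x. A x *v g x) \<in> borel_measurable (lebesgue_on \<Omega>)"
    by (rule borel_measurable_matrix_vector_mult[OF A_measurable L2_measurable[OF g]])
  have "AE x in lebesgue_on \<Omega>. norm (A x *v g x) \<le> \<Lambda>\<^sub>1 * norm (g x)"
    using A_sym A_elliptic
  proof eventually_elim
    case (elim x)
    show ?case by (rule elliptic_matrix_bound[OF elim(1) Lam(1)]) (use elim(2) in blast)
  qed
  from L2_dominated[OF m g _ this] Lam
  show "(\<lambda>x. A x *v g x) \<in> L2 \<Omega>" "L2_norm \<Omega> (\<lambda>x. A x *v g x) \<le> \<Lambda>\<^sub>1 * L2_norm \<Omega> g" by auto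
qed

lemma A_coercive:
  assumes g: "g \<in> L2 \<Omega>"
  shows "\<Lambda>\<^sub>0 * (L2_norm \<Omega> g)^2 \<le> L2_inner \<Omega> (\<lambda>x. A x *v g x) g"
proof -
  have "(LINT x|lebesgue_on \<Omega>. \<Lambda>\<^sub>0 * (g x \<bullet> g x)) \<le> (LINT x|lebesgue_on \<Omega>. (A x *v g x) \<bullet> g x)"
  proof (rule integral_mono_AE)
    show "integrable (lebesgue_on \<Omega>) (\<lambda>x. \<Lambda>\<^sub>0 * (g x \<bullet> g x))"
      by (intro integrable_mult_right L2_integrable_inner g)
    show "integrable (lebesgue_on \<Omega>) (\<lambda>x. (A x *v g x) \<bullet> g x)" by (rule L2_integrable_inner[OF A_L2(1)[OF g] g])
    show "AE x in lebesgue_on \<Omega>. \<Lambda>\<^sub>0 * (g x \<bullet> g x) \<le> (A x *v g x) \<bullet> g x"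
      using A_elliptic by eventually_elim (simp add: inner_commute)
  qed
  then show ?thesis by (simp add: L2_norm_sq L2_inner_def)
qed

lemma Xop_L2:
  assumes v: "v \<in> H10 \<Omega>"
  shows "Xop \<Omega> b c v \<in> L2 \<Omega>"
    "L2_norm \<Omega> (Xop \<Omega> b c v) \<le> Mb * L2_norm \<Omega> (weak_grad \<Omega> v) + Mc * L2_norm \<Omega> v"
proof -
  note vL = H10_L2[OF v] and gL = H10_weak_grad_L2[OF v]
  have "(\<lambda>x. b x \<bullet> weak_grad \<Omega> v x) \<in> borel_measurable (lebesgue_on \<Omega>)"
    by (intro borel_measurable_inner b L2_measurable gL)
  moreover have "AE x in lebesgue_on \<Omega>. norm (b x \<bullet> weak_grad \<Omega> v x) \<le> Mb * norm (weak_grad \<Omega> v x)"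
    using b(2)
  proof eventually_elim
    case (elim x)
    have "norm (b x \<bullet> weak_grad \<Omega> v x) \<le> norm (b x) * norm (weak_grad \<Omega> v x)" by (simp add: Cauchy_Schwarz_ineq2)
    also have "\<dots> \<le> Mb * norm (weak_grad \<Omega> v x)" by (intro mult_right_mono elim) simp
    finally show ?case .
  qed
  ultimately have 1: "(\<lambda>x. b x \<bullet> weak_grad \<Omega> v x) \<in> L2 \<Omega>"
    "L2_norm \<Omega> (\<lambda>x. b x \<bullet> weak_grad \<Omega> v x) \<le> Mb * L2_norm \<Omega> (weak_grad \<Omega> v)"
    using L2_dominated[OF _ gL b(3)] by blast+
  have "(\<lambda>x. c x * v x) \<in> borel_measurable (lebesgue_on \<Omega>)"
    by (intro borel_measurable_times c L2_measurable vL)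
  moreover have "AE x in lebesgue_on \<Omega>. norm (c x * v x) \<le> Mc * norm (v x)"
    using c(2) by eventually_elim (simp add: abs_mult mult_right_mono)
  ultimately have 2: "(\<lambda>x. c x * v x) \<in> L2 \<Omega>" "L2_norm \<Omega> (\<lambda>x. c x * v x) \<le> Mc * L2_norm \<Omega> v"
    using L2_dominated[OF _ vL c(3)] by blast+
  show "Xop \<Omega> b c v \<in> L2 \<Omega>" unfolding Xop_def[abs_def] by (rule L2_add[OF 1(1) 2(1)])
  show "L2_norm \<Omega> (Xop \<Omega> b c v) \<le> Mb * L2_norm \<Omega> (weak_grad \<Omega> v) + Mc * L2_norm \<Omega> v"
    unfolding Xop_def[abs_def] using L2_norm_triangle[OF 1(1) 2(1)] 1(2) 2(2) by linarith
qed

definition bform :: "(real^'d \<Rightarrow> real) \<Rightarrow> (real^'d \<Rightarrow> real) \<Rightarrow> real" where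
  "bform w v = L2_inner \<Omega> (\<lambda>x. A x *v weak_grad \<Omega> w x) (weak_grad \<Omega> v) + L2_inner \<Omega> (Xop \<Omega> b c w) v"

lemma bform_bound:
  assumes w: "w \<in> H10 \<Omega>" and v: "v \<in> H10 \<Omega>"
  shows "\<bar>bform w v\<bar> \<le> \<Lambda>\<^sub>1 * L2_norm \<Omega> (weak_grad \<Omega> w) * L2_norm \<Omega> (weak_grad \<Omega> v)
     + (Mb * L2_norm \<Omega> (weak_grad \<Omega> w) + Mc * L2_norm \<Omega> w) * L2_norm \<Omega> v"
proof -
  note gw = H10_weak_grad_L2[OF w] and gv = H10_weak_grad_L2[OF v]
  have "\<bar>L2_inner \<Omega> (\<lambda>x. A x *v weak_grad \<Omega> w x) (weak_grad \<Omega> v)\<bar>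
      \<le> L2_norm \<Omega> (\<lambda>x. A x *v weak_grad \<Omega> w x) * L2_norm \<Omega> (weak_grad \<Omega> v)"
    by (rule L2_Cauchy_Schwarz[OF A_L2(1)[OF gw] gv])
  also have "\<dots> \<le> \<Lambda>\<^sub>1 * L2_norm \<Omega> (weak_grad \<Omega> w) * L2_norm \<Omega> (weak_grad \<Omega> v)"
    by (intro mult_right_mono A_L2 gw L2_norm_nonneg)
  finally have 1: "\<bar>L2_inner \<Omega> (\<lambda>x. A x *v weak_grad \<Omega> w x) (weak_grad \<Omega> v)\<bar>
      \<le> \<Lambda>\<^sub>1 * L2_norm \<Omega> (weak_grad \<Omega> w) * L2_norm \<Omega> (weak_grad \<Omega> v)" .
  have "\<bar>L2_inner \<Omega> (Xop \<Omega> b c w) v\<bar> \<le> L2_norm \<Omega> (Xop \<Omega> b c w) * L2_norm \<Omega> v"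
    by (rule L2_Cauchy_Schwarz[OF Xop_L2(1)[OF w] H10_L2[OF v]])
  also have "\<dots> \<le> (Mb * L2_norm \<Omega> (weak_grad \<Omega> w) + Mc * L2_norm \<Omega> w) * L2_norm \<Omega> v"
    by (intro mult_right_mono Xop_L2 w L2_norm_nonneg)
  finally show ?thesis using 1 unfolding bform_def by linarith
qed

lemma Xop_lincomb:
  assumes v: "v \<in> H10 \<Omega>" and w: "w \<in> H10 \<Omega>"
  shows "AE x in lebesgue_on \<Omega>. Xop \<Omega> b c (\<lambda>x. r * v x + s * w x) x = r * Xop \<Omega> b c v x + s * Xop \<Omega> b c w x"
  using H1_lincomb(2)[OF H10_H1[OF v] H10_H1[OF w], of r s]
  by eventually_elim (simp add: Xop_def inner_add_right algebra_simps)

lemma bform_lincomb: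
  assumes v: "v \<in> H10 \<Omega>" and w: "w \<in> H10 \<Omega>" and z: "z \<in> H10 \<Omega>"
  shows "bform (\<lambda>x. r * v x + s * w x) z = r * bform v z + s * bform w z"
proof -
  note vw = H10_lincomb[OF v w, of r s]
  note gv = H10_weak_grad_L2[OF v] and gw = H10_weak_grad_L2[OF w] and gz = H10_weak_grad_L2[OF z]
  have "L2_inner \<Omega> (\<lambda>x. A x *v weak_grad \<Omega> (\<lambda>x. r * v x + s * w x) x) (weak_grad \<Omega> z)
      = L2_inner \<Omega> (\<lambda>x. r *\<^sub>R (A x *v weak_grad \<Omega> v x) + s *\<^sub>R (A x *v weak_grad \<Omega> w x)) (weak_grad \<Omega> z)"
  proof (rule L2_inner_cong_AE)
    show "AE x in lebesgue_on \<Omega>. A x *v weak_grad \<Omega> (\<lambda>x. r * v x + s * w x) x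
        = r *\<^sub>R (A x *v weak_grad \<Omega> v x) + s *\<^sub>R (A x *v weak_grad \<Omega> w x)"
      using H1_lincomb(2)[OF H10_H1[OF v] H10_H1[OF w], of r s]
      by eventually_elim (simp add: matrix_vector_right_distrib matrix_vector_mult_scaleR)
  qed (use A_L2(1) gv gw gz H10_weak_grad_L2[OF vw] in \<open>auto intro!: L2_add L2_scaleR\<close>)
  moreover have "L2_inner \<Omega> (Xop \<Omega> b c (\<lambda>x. r * v x + s * w x)) z
      = L2_inner \<Omega> (\<lambda>x. r *\<^sub>R Xop \<Omega> b c v x + s *\<^sub>R Xop \<Omega> b c w x) z"
  proof (rule L2_inner_cong_AE)
    show "AE x in lebesgue_on \<Omega>. Xop \<Omega> b c (\<lambda>x. r * v x + s * w x) x = r *\<^sub>R Xop \<Omega> b c v x + s *\<^sub>R Xop \<Omega> b c w x"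
      using Xop_lincomb[OF v w, of r s] by simp
  qed (use Xop_L2(1) v w vw H10_L2[OF z] in \<open>auto intro!: L2_add L2_scale\<close>)
  ultimately show ?thesis
    unfolding bform_def
    by (simp only: L2_inner_add_left L2_inner_scaleR_left L2_scaleR A_L2(1) gv gw gz Xop_L2(1) v w H10_L2[OF z])
       (simp add: algebra_simps)
qed

lemma bform_diff:
  assumes "v \<in> H10 \<Omega>" "w \<in> H10 \<Omega>" "z \<in> H10 \<Omega>"
  shows "bform (\<lambda>x. v x - w x) z = bform v z - bform w z"
  using bform_lincomb[OF assms, of 1 "-1"] by simp

lemma bform_scale:
  assumes "v \<in> H10 \<Omega>" "z \<in> H10 \<Omega>"
  shows "bform (\<lambda>x. r * v x) z = r * bform v z"
  using bform_lincomb[OF assms(1) assms(1) assms(2), of r 0] by simp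

lemma weak_grad_diff_norm:
  assumes "v \<in> H10 \<Omega>" "w \<in> H10 \<Omega>"
  shows "L2_norm \<Omega> (weak_grad \<Omega> (\<lambda>x. v x - w x)) = L2_norm \<Omega> (\<lambda>x. weak_grad \<Omega> v x - weak_grad \<Omega> w x)"
  by (intro L2_norm_cong_AE H10_diff H10_weak_grad_L2 L2_diff assms)

lemma bform_Garding:
  assumes v: "v \<in> H10 \<Omega>"
  shows "\<Lambda>\<^sub>0 / 2 * (L2_norm \<Omega> (weak_grad \<Omega> v))^2 \<le> bform v v + (Mb^2 / (2 * \<Lambda>\<^sub>0) + Mc) * (L2_norm \<Omega> v)^2"
proof -
  define G N where "G = L2_norm \<Omega> (weak_grad \<Omega> v)" and "N = L2_norm \<Omega> v"
  have "\<bar>L2_inner \<Omega> (Xop \<Omega> b c v) v\<bar> \<le> L2_norm \<Omega> (Xop \<Omega> b c v) * N"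
    unfolding N_def by (rule L2_Cauchy_Schwarz[OF Xop_L2(1)[OF v] H10_L2[OF v]])
  also have "\<dots> \<le> (Mb * G + Mc * N) * N"
    unfolding G_def N_def by (intro mult_right_mono Xop_L2 v L2_norm_nonneg)
  finally have X: "\<bar>L2_inner \<Omega> (Xop \<Omega> b c v) v\<bar> \<le> (Mb * G + Mc * N) * N" .
  have young: "Mb * G * N \<le> \<Lambda>\<^sub>0 / 2 * G^2 + Mb^2 / (2 * \<Lambda>\<^sub>0) * N^2"
  proof -
    have "0 \<le> (\<Lambda>\<^sub>0 * G - Mb * N)^2" by simp
    then have "\<Lambda>\<^sub>0 * (2 * (Mb * G * N)) \<le> \<Lambda>\<^sub>0^2 * G^2 + Mb^2 * N^2"
      by (simp add: power2_diff power_mult_distrib algebra_simps)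
    also have "\<dots> = \<Lambda>\<^sub>0 * (2 * (\<Lambda>\<^sub>0 / 2 * G^2 + Mb^2 / (2 * \<Lambda>\<^sub>0) * N^2))"
      using Lam(1) by (simp add: field_simps power2_eq_square)
    finally have "2 * (Mb * G * N) \<le> 2 * (\<Lambda>\<^sub>0 / 2 * G^2 + Mb^2 / (2 * \<Lambda>\<^sub>0) * N^2)"
      by (rule mult_left_le_imp_le) (rule Lam(1))
    then show ?thesis by simp
  qed
  have "\<Lambda>\<^sub>0 * G^2 \<le> L2_inner \<Omega> (\<lambda>x. A x *v weak_grad \<Omega> v x) (weak_grad \<Omega> v)"
    unfolding G_def by (rule A_coercive[OF H10_weak_grad_L2[OF v]])
  then have "\<Lambda>\<^sub>0 * G^2 \<le> bform v v + (Mb * G * N + Mc * N^2)"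
    using X unfolding bform_def by (simp add: algebra_simps power2_eq_square)
  moreover have "\<Lambda>\<^sub>0 / 2 * G^2 + \<Lambda>\<^sub>0 / 2 * G^2 = \<Lambda>\<^sub>0 * G^2" by simp
  ultimately show ?thesis
    using young unfolding G_def[symmetric] N_def[symmetric] distrib_right by linarith
qed

text \<open>
  The negative term in Garding's inequality is absorbed by \<open>H10_compactness\<close>, with \<open>\<epsilon>\<close> chosen
  such that half of the coercivity remains.
\<close>

lemma bform_Garding_finite_rank:
  obtains J :: "('d \<Rightarrow> int) set" and q :: "('d \<Rightarrow> int) \<Rightarrow> real^'d \<Rightarrow> real" and C :: real
  where "finite J" "\<And>m. q m \<in> L2 \<Omega>" "C \<ge> 0"
    "\<And>v. v \<in> H10 \<Omega> \<Longrightarrow> \<Lambda>\<^sub>0 / 4 * (L2_norm \<Omega> (weak_grad \<Omega> v))^2 \<le> bform v v + C * (\<Sum>m\<in>J. (L2_inner \<Omega> v (q m))^2)"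
proof -
  define C1 where "C1 = Mb^2 / (2 * \<Lambda>\<^sub>0) + Mc + 1"
  have C1: "C1 > 0" using Lam b(3) c(3) by (simp add: C1_def add_nonneg_pos)
  have ep: "\<Lambda>\<^sub>0 / (4 * C1) > 0" using C1 Lam by simp
  obtain J :: "('d \<Rightarrow> int) set" and q :: "('d \<Rightarrow> int) \<Rightarrow> real^'d \<Rightarrow> real" and C :: real
    where J: "finite J" "\<And>m. q m \<in> L2 \<Omega>" "C \<ge> 0"
    and le: "\<And>v. v \<in> H10 \<Omega> \<Longrightarrow> (L2_norm \<Omega> v)^2 \<le> \<Lambda>\<^sub>0 / (4 * C1) * (L2_norm \<Omega> (weak_grad \<Omega> v))^2 + C * (\<Sum>m\<in>J. (L2_inner \<Omega> v (q m))^2)"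
    using H10_compactness[OF ep] by blast
  have "\<Lambda>\<^sub>0 / 4 * (L2_norm \<Omega> (weak_grad \<Omega> v))^2 \<le> bform v v + (C1 * C) * (\<Sum>m\<in>J. (L2_inner \<Omega> v (q m))^2)"
    if v: "v \<in> H10 \<Omega>" for v
  proof -
    have "(Mb^2 / (2 * \<Lambda>\<^sub>0) + Mc) * (L2_norm \<Omega> v)^2 \<le> C1 * (L2_norm \<Omega> v)^2"
      by (intro mult_right_mono) (auto simp: C1_def)
    also have "\<dots> \<le> C1 * (\<Lambda>\<^sub>0 / (4 * C1) * (L2_norm \<Omega> (weak_grad \<Omega> v))^2 + C * (\<Sum>m\<in>J. (L2_inner \<Omega> v (q m))^2))"
      using le[OF v] C1 by (intro mult_left_mono) auto
    also have "\<dots> = \<Lambda>\<^sub>0 / 4 * (L2_norm \<Omega> (weak_grad \<Omega> v))^2 + (C1 * C) * (\<Sum>m\<in>J. (L2_inner \<Omega> v (q m))^2)"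
      using C1 by (simp add: field_simps)
    finally show ?thesis using bform_Garding[OF v] by linarith
  qed
  then show ?thesis using J C1 by (intro that[of J q "C1 * C"]) auto
qed

lemma bform_tendsto:
  assumes w: "\<And>n. w n \<in> H10 \<Omega>" and u: "u \<in> H10 \<Omega>" and v: "v \<in> H10 \<Omega>"
    and l0: "(\<lambda>n. L2_norm \<Omega> (\<lambda>x. w n x - u x)) \<longlonglongrightarrow> 0"
    and l1: "(\<lambda>n. L2_norm \<Omega> (\<lambda>x. weak_grad \<Omega> (w n) x - weak_grad \<Omega> u x)) \<longlonglongrightarrow> 0"
  shows "(\<lambda>n. bform (w n) v) \<longlonglongrightarrow> bform u v"
proof -
  define B where "B n = \<Lambda>\<^sub>1 * L2_norm \<Omega> (\<lambda>x. weak_grad \<Omega> (w n) x - weak_grad \<Omega> u x) * L2_norm \<Omega> (weak_grad \<Omega> v)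
     + (Mb * L2_norm \<Omega> (\<lambda>x. weak_grad \<Omega> (w n) x - weak_grad \<Omega> u x) + Mc * L2_norm \<Omega> (\<lambda>x. w n x - u x)) * L2_norm \<Omega> v" for n
  have "B \<longlonglongrightarrow> \<Lambda>\<^sub>1 * 0 * L2_norm \<Omega> (weak_grad \<Omega> v) + (Mb * 0 + Mc * 0) * L2_norm \<Omega> v"
    unfolding B_def by (intro tendsto_add tendsto_mult tendsto_const l0 l1)
  then have B0: "B \<longlonglongrightarrow> 0" by simp
  have "norm (bform (w n) v - bform u v) \<le> B n" for n
    using bform_bound[OF H10_diff(1)[OF w[of n] u] v]
    by (simp add: bform_diff[OF w u v] weak_grad_diff_norm[OF w u] B_def)
  then have "(\<lambda>n. bform (w n) v - bform u v) \<longlonglongrightarrow> 0"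
    by (intro Lim_null_comparison[OF always_eventually[OF allI] B0])
  then show ?thesis by (rule LIM_zero_cancel)
qed

text \<open>
  Coercivity up to finite rank is applied to differences \<open>U\<close> of members of the sequence.  The form
  \<open>a(U, U)\<close> is small because \<open>a(w\<^sub>n, \<cdot>)\<close> is, and the finite-rank term is small along a subsequence on
  which the finitely many functionals converge.  The bound is split as \<open>e m + e n\<close> with a null
  sequence \<open>e\<close> to keep the two indices apart.
\<close>

lemma bform_null_sequence_Cauchy:
  assumes w: "\<And>n. w n \<in> H10 \<Omega>" and unit: "\<And>n. L2_norm \<Omega> (weak_grad \<Omega> (w n)) = 1"
    and small: "\<And>n v. v \<in> H10 \<Omega> \<Longrightarrow> \<bar>bform (w n) v\<bar> \<le> inverse (real (Suc n)) * L2_norm \<Omega> (weak_grad \<Omega> v)"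
  shows "\<exists>(r :: nat \<Rightarrow> nat) e. strict_mono r \<and> e \<longlonglongrightarrow> 0 \<and>
    (\<forall>m n. (L2_norm \<Omega> (\<lambda>x. weak_grad \<Omega> (w (r m)) x - weak_grad \<Omega> (w (r n)) x))^2 \<le> e m + e n)"
proof -
  obtain P where P: "P > 0" "\<And>v. v \<in> H10 \<Omega> \<Longrightarrow> L2_norm \<Omega> v \<le> P * L2_norm \<Omega> (weak_grad \<Omega> v)"
    using H10_Poincare by blast
  obtain J :: "('d \<Rightarrow> int) set" and q :: "('d \<Rightarrow> int) \<Rightarrow> real^'d \<Rightarrow> real" and C :: real
    where J: "finite J" "\<And>m. q m \<in> L2 \<Omega>" "C \<ge> 0"
    and garding: "\<And>v. v \<in> H10 \<Omega> \<Longrightarrow> \<Lambda>\<^sub>0 / 4 * (L2_norm \<Omega> (weak_grad \<Omega> v))^2 \<le> bform v v + C * (\<Sum>m\<in>J. (L2_inner \<Omega> v (q m))^2)"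
    using bform_Garding_finite_rank by blast
  define l where "l j n = L2_inner \<Omega> (w n) (q j)" for j n
  have "bounded (range (l j))" for j
  proof (rule boundedI)
    fix y assume "y \<in> range (l j)"
    then obtain n where y: "y = l j n" by (rule rangeE)
    have "\<bar>l j n\<bar> \<le> L2_norm \<Omega> (w n) * L2_norm \<Omega> (q j)"
      unfolding l_def by (rule L2_Cauchy_Schwarz[OF H10_L2[OF w] J(2)])
    also have "\<dots> \<le> P * L2_norm \<Omega> (q j)"
      using P(2)[OF w[of n]] unit[of n] by (intro mult_right_mono L2_norm_nonneg) simp
    finally show "norm y \<le> P * L2_norm \<Omega> (q j)" by (simp add: y)
  qed
  then obtain r :: "nat \<Rightarrow> nat" where r: "strict_mono r" "\<And>j. j \<in> J \<Longrightarrow> convergent (l j \<circ> r)"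
    using convergent_subsequence_finite[OF J(1), of l] by blast
  define L where "L j = lim (l j \<circ> r)" for j
  have L: "(\<lambda>n. l j (r n)) \<longlonglongrightarrow> L j" if "j \<in> J" for j
    using r(2)[OF that] unfolding L_def convergent_LIMSEQ_iff by (simp add: o_def)
  define e where "e n = 4 / \<Lambda>\<^sub>0 * (2 * inverse (real (Suc n)) + C * (\<Sum>j\<in>J. 2 * (l j (r n) - L j)^2))" for n
  have "e \<longlonglongrightarrow> 4 / \<Lambda>\<^sub>0 * (2 * 0 + C * (\<Sum>j\<in>J. 2 * (L j - L j)^2))"
    unfolding e_def by (intro tendsto_mult tendsto_add tendsto_const tendsto_sum tendsto_power tendsto_diff L LIMSEQ_inverse_real_of_nat)
  then have e0: "e \<longlonglongrightarrow> 0" by simp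
  have "(L2_norm \<Omega> (\<lambda>x. weak_grad \<Omega> (w (r m)) x - weak_grad \<Omega> (w (r n)) x))^2 \<le> e m + e n" for m n
  proof -
    define U where "U = (\<lambda>x. w (r m) x - w (r n) x)"
    define G where "G = L2_norm \<Omega> (weak_grad \<Omega> U)"
    have U: "U \<in> H10 \<Omega>" unfolding U_def by (rule H10_diff(1)[OF w w])
    have Geq: "G = L2_norm \<Omega> (\<lambda>x. weak_grad \<Omega> (w (r m)) x - weak_grad \<Omega> (w (r n)) x)"
      unfolding G_def U_def by (rule weak_grad_diff_norm[OF w w])
    have G2: "G \<le> 2"
      using L2_norm_triangle_diff[OF H10_weak_grad_L2[OF w[of "r m"]] H10_weak_grad_L2[OF w[of "r n"]]] unit unfolding Geq by simp
    have G0: "0 \<le> G" by (simp add: G_def L2_norm_nonneg)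
    have one: "\<bar>bform (w (r k)) U\<bar> \<le> 2 * inverse (real (Suc k))" for k
    proof -
      have "inverse (real (Suc (r k))) \<le> inverse (real (Suc k))"
        using seq_suble[OF r(1), of k] by (intro le_imp_inverse_le) auto
      then have "inverse (real (Suc (r k))) * G \<le> inverse (real (Suc k)) * 2"
        using G0 G2 by (intro mult_mono) auto
      with small[OF U, of "r k"] show ?thesis unfolding G_def by linarith
    qed
    have "bform U U = bform (w (r m)) U - bform (w (r n)) U"
      unfolding U_def by (rule bform_diff[OF w w H10_diff(1)[OF w w]])
    then have bU: "bform U U \<le> 2 * inverse (real (Suc m)) + 2 * inverse (real (Suc n))"
      using one[of m] one[of n] by linarith
    have "(\<Sum>j\<in>J. (L2_inner \<Omega> U (q j))^2) \<le> (\<Sum>j\<in>J. 2 * (l j (r m) - L j)^2 + 2 * (l j (r n) - L j)^2)"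
    proof (rule sum_mono)
      fix j assume "j \<in> J"
      have "L2_inner \<Omega> U (q j) = l j (r m) - l j (r n)"
        unfolding U_def l_def by (rule L2_inner_diff_left[OF H10_L2[OF w] H10_L2[OF w] J(2)])
      moreover have "(a - a')^2 \<le> 2 * (a - z)^2 + 2 * (a' - z)^2" for a a' z :: real
        using zero_le_power2[of "(a - z) + (a' - z)"] by (simp add: power2_eq_square algebra_simps)
      ultimately show "(L2_inner \<Omega> U (q j))^2 \<le> 2 * (l j (r m) - L j)^2 + 2 * (l j (r n) - L j)^2" by simp
    qed
    then have "C * (\<Sum>j\<in>J. (L2_inner \<Omega> U (q j))^2) \<le> C * ((\<Sum>j\<in>J. 2 * (l j (r m) - L j)^2) + (\<Sum>j\<in>J. 2 * (l j (r n) - L j)^2))"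
      unfolding sum.distrib[symmetric] by (rule mult_left_mono[OF _ J(3)])
    then have "\<Lambda>\<^sub>0 / 4 * G^2 \<le> \<Lambda>\<^sub>0 / 4 * (e m + e n)"
      using garding[OF U] bU Lam(1) unfolding G_def e_def by (simp add: distrib_left)
    then have "G^2 \<le> e m + e n" by (rule mult_left_le_imp_le) (use Lam(1) in simp)
    then show ?thesis unfolding Geq .
  qed
  with r(1) e0 show ?thesis by blast
qed

text \<open>
  A normalised sequence violating the bound has, by the preceding lemma, a subsequence converging
  in \<open>H10\<close>.  The limit solves the homogeneous problem, so it is zero by uniqueness, although its
  gradient has norm one.
\<close>

theorem stability:
  assumes uniq: "uniqueness \<Omega> A b c"
  shows "\<exists>K>0. \<forall>w\<in>H10 \<Omega>. \<forall>S\<ge>0. (\<forall>v\<in>H10 \<Omega>. \<bar>bform w v\<bar> \<le> S * L2_norm \<Omega> (weak_grad \<Omega> v))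
     \<longrightarrow> L2_norm \<Omega> (weak_grad \<Omega> w) \<le> K * S"
proof (rule ccontr)
  assume neg: "\<not> ?thesis"
  have "\<exists>w. w \<in> H10 \<Omega> \<and> L2_norm \<Omega> (weak_grad \<Omega> w) = 1 \<and>
      (\<forall>v\<in>H10 \<Omega>. \<bar>bform w v\<bar> \<le> inverse (real (Suc n)) * L2_norm \<Omega> (weak_grad \<Omega> v))" for n
  proof -
    have "\<not> (\<forall>w\<in>H10 \<Omega>. \<forall>S\<ge>0. (\<forall>v\<in>H10 \<Omega>. \<bar>bform w v\<bar> \<le> S * L2_norm \<Omega> (weak_grad \<Omega> v))
     \<longrightarrow> L2_norm \<Omega> (weak_grad \<Omega> w) \<le> real (Suc n) * S)"
      using neg of_nat_0_less_iff zero_less_Suc by blast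
    then obtain w S where w: "w \<in> H10 \<Omega>" and S: "S \<ge> 0"
      and bS: "\<And>v. v \<in> H10 \<Omega> \<Longrightarrow> \<bar>bform w v\<bar> \<le> S * L2_norm \<Omega> (weak_grad \<Omega> v)"
      and G: "L2_norm \<Omega> (weak_grad \<Omega> w) > real (Suc n) * S" by (auto simp: not_le)
    define G' where "G' = L2_norm \<Omega> (weak_grad \<Omega> w)"
    have "0 \<le> real (Suc n) * S" using S by (intro mult_nonneg_nonneg) auto
    then have Gp: "G' > 0" using G unfolding G'_def by linarith
    note ws = H10_scale[OF w, of "1 / G'"]
    have "L2_norm \<Omega> (weak_grad \<Omega> (\<lambda>x. 1 / G' * w x)) = L2_norm \<Omega> (\<lambda>x. (1 / G') *\<^sub>R weak_grad \<Omega> w x)"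
      by (intro L2_norm_cong_AE ws H10_weak_grad_L2 L2_scaleR w)
    also have "\<dots> = 1" unfolding L2_norm_scaleR G'_def[symmetric] using Gp by simp
    finally have n1: "L2_norm \<Omega> (weak_grad \<Omega> (\<lambda>x. 1 / G' * w x)) = 1" .
    have "\<bar>bform (\<lambda>x. 1 / G' * w x) v\<bar> \<le> inverse (real (Suc n)) * L2_norm \<Omega> (weak_grad \<Omega> v)" if v: "v \<in> H10 \<Omega>" for v
    proof -
      have "\<bar>bform (\<lambda>x. 1 / G' * w x) v\<bar> = \<bar>bform w v\<bar> / G'"
        unfolding bform_scale[OF w v] using Gp by (simp add: abs_mult)
      also have "\<dots> \<le> (S * L2_norm \<Omega> (weak_grad \<Omega> v)) / G'" using bS[OF v] Gp by (intro divide_right_mono) auto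
      also have "\<dots> = (S / G') * L2_norm \<Omega> (weak_grad \<Omega> v)" by simp
      also have "\<dots> \<le> inverse (real (Suc n)) * L2_norm \<Omega> (weak_grad \<Omega> v)"
      proof (intro mult_right_mono L2_norm_nonneg)
        show "S / G' \<le> inverse (real (Suc n))"
          using G Gp unfolding G'_def[symmetric] by (simp add: field_simps del: of_nat_Suc)
      qed
      finally show ?thesis .
    qed
    with ws(1) n1 show ?thesis by blast
  qed
  then obtain w where w: "\<And>n. w n \<in> H10 \<Omega>" and unit: "\<And>n. L2_norm \<Omega> (weak_grad \<Omega> (w n)) = 1"
    and small: "\<And>n v. v \<in> H10 \<Omega> \<Longrightarrow> \<bar>bform (w n) v\<bar> \<le> inverse (real (Suc n)) * L2_norm \<Omega> (weak_grad \<Omega> v)"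
    by metis
  have "\<exists>(r :: nat \<Rightarrow> nat) e. strict_mono r \<and> e \<longlonglongrightarrow> 0 \<and>
    (\<forall>m n. (L2_norm \<Omega> (\<lambda>x. weak_grad \<Omega> (w (r m)) x - weak_grad \<Omega> (w (r n)) x))^2 \<le> e m + e n)"
    by (rule bform_null_sequence_Cauchy[OF w unit]) (rule small)
  then obtain r :: "nat \<Rightarrow> nat" and e where re: "strict_mono r \<and> e \<longlonglongrightarrow> 0 \<and>
    (\<forall>m n. (L2_norm \<Omega> (\<lambda>x. weak_grad \<Omega> (w (r m)) x - weak_grad \<Omega> (w (r n)) x))^2 \<le> e m + e n)"
    by (elim exE) (rule that)
  then have r: "strict_mono r" and e0: "e \<longlonglongrightarrow> 0"
    and e: "(L2_norm \<Omega> (\<lambda>x. weak_grad \<Omega> (w (r m)) x - weak_grad \<Omega> (w (r n)) x))^2 \<le> e m + e n" for m n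
    by simp_all
  obtain P where P: "P > 0" "\<And>v. v \<in> H10 \<Omega> \<Longrightarrow> L2_norm \<Omega> v \<le> P * L2_norm \<Omega> (weak_grad \<Omega> v)"
    using H10_Poincare by blast
  have C1: "\<exists>N. \<forall>m\<ge>N. \<forall>n\<ge>N. L2_norm \<Omega> (\<lambda>x. weak_grad \<Omega> (w (r m)) x - weak_grad \<Omega> (w (r n)) x) < \<epsilon>" if "\<epsilon> > 0" for \<epsilon>
  proof -
    have "\<forall>\<^sub>F n in sequentially. e n < \<epsilon>^2 / 2" using order_tendstoD(2)[OF e0, of "\<epsilon>^2/2"] that by simp
    then obtain N where N: "\<And>n. n \<ge> N \<Longrightarrow> e n < \<epsilon>^2 / 2" unfolding eventually_sequentially by blast
    have "L2_norm \<Omega> (\<lambda>x. weak_grad \<Omega> (w (r m)) x - weak_grad \<Omega> (w (r n)) x) < \<epsilon>" if "m \<ge> N" "n \<ge> N" for m n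
    proof (rule power2_less_imp_less)
      show "(L2_norm \<Omega> (\<lambda>x. weak_grad \<Omega> (w (r m)) x - weak_grad \<Omega> (w (r n)) x))^2 < \<epsilon>^2"
        using e[of m n] N[OF that(1)] N[OF that(2)] by linarith
    qed (use \<open>\<epsilon> > 0\<close> in simp)
    then show ?thesis by blast
  qed
  have C0: "\<exists>N. \<forall>m\<ge>N. \<forall>n\<ge>N. L2_norm \<Omega> (\<lambda>x. w (r m) x - w (r n) x) < \<epsilon>" if "\<epsilon> > 0" for \<epsilon>
  proof -
    obtain N where N: "\<And>m n. m \<ge> N \<Longrightarrow> n \<ge> N \<Longrightarrow> L2_norm \<Omega> (\<lambda>x. weak_grad \<Omega> (w (r m)) x - weak_grad \<Omega> (w (r n)) x) < \<epsilon> / P"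
      using C1[of "\<epsilon> / P"] \<open>\<epsilon> > 0\<close> P(1) by auto
    have "L2_norm \<Omega> (\<lambda>x. w (r m) x - w (r n) x) < \<epsilon>" if "m \<ge> N" "n \<ge> N" for m n
      using P(2)[OF H10_diff(1)[OF w w], of "r m" "r n"] N[OF that] P(1)
      unfolding weak_grad_diff_norm[OF w w] by (simp add: field_simps)
    then show ?thesis by blast
  qed
  obtain u where u: "u \<in> H10 \<Omega>" and l0: "(\<lambda>n. L2_norm \<Omega> (\<lambda>x. w (r n) x - u x)) \<longlonglongrightarrow> 0"
    and l1: "(\<lambda>n. L2_norm \<Omega> (\<lambda>x. weak_grad \<Omega> (w (r n)) x - weak_grad \<Omega> u x)) \<longlonglongrightarrow> 0"
    using H10_complete[of "\<lambda>n. w (r n)"] w C0 C1 by blast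
  have bu: "bform u v = 0" if v: "v \<in> H10 \<Omega>" for v
  proof -
    have "(\<lambda>n. inverse (real (Suc n)) * L2_norm \<Omega> (weak_grad \<Omega> v)) \<longlonglongrightarrow> 0"
      using tendsto_mult_left_zero[OF LIMSEQ_inverse_real_of_nat] .
    then have "(\<lambda>n. bform (w n) v) \<longlonglongrightarrow> 0"
      by (rule Lim_null_comparison[rotated]) (use small[OF v] in \<open>auto intro!: always_eventually\<close>)
    then have "(\<lambda>n. bform (w (r n)) v) \<longlonglongrightarrow> 0"
      using LIMSEQ_subseq_LIMSEQ[OF _ r, of "\<lambda>n. bform (w n) v"] by (simp add: o_def)
    moreover have "(\<lambda>n. bform (w (r n)) v) \<longlonglongrightarrow> bform u v"
      by (rule bform_tendsto[OF w u v l0 l1])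
    ultimately show ?thesis using LIMSEQ_unique by blast
  qed
  have u0: "AE x in lebesgue_on \<Omega>. u x = 0"
    using uniq[unfolded uniqueness_def, THEN bspec[OF _ u]] bu by (simp add: bform_def)
  have "is_weak_grad \<Omega> u (\<lambda>x. 0)"
    unfolding is_weak_grad_def
  proof (intro conjI ballI allI L2_zero)
    fix \<phi> i assume \<phi>: "\<phi> \<in> test_functions \<Omega>"
    have "L2_inner \<Omega> u (partial_deriv i \<phi>) = L2_inner \<Omega> (\<lambda>x. 0) (partial_deriv i \<phi>)"
      by (intro L2_inner_cong_AE u0 H10_L2[OF u] L2_zero test_partial_L2[OF \<phi>]) simp
    then show "L2_inner \<Omega> u (partial_deriv i \<phi>) = - L2_inner \<Omega> (\<lambda>x. 0 $ i) \<phi>"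
      by (simp add: L2_inner_def)
  qed
  then have "AE x in lebesgue_on \<Omega>. weak_grad \<Omega> u x = 0"
    by (rule weak_grad_AE[OF H10_L2[OF u]])
  then have "L2_norm \<Omega> (weak_grad \<Omega> u) = 0"
    by (simp add: L2_norm_eq_0_iff H10_weak_grad_L2[OF u])
  moreover have "(\<lambda>n. L2_norm \<Omega> (weak_grad \<Omega> (w (r n)))) \<longlonglongrightarrow> L2_norm \<Omega> (weak_grad \<Omega> u)"
    by (rule L2_norm_tendsto[OF H10_weak_grad_L2[OF w] H10_weak_grad_L2[OF u] l1])
  ultimately show False by (simp add: unit LIMSEQ_const_iff)
qed

end

section \<open>Reliability and efficiency\<close>

lemma (in bounded_domain) Hdiv_weak_div:
  "\<tau> \<in> Hdiv \<Omega> \<Longrightarrow> is_weak_div \<Omega> \<tau> (weak_div \<Omega> \<tau>)"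
proof -
  assume "\<tau> \<in> Hdiv \<Omega>"
  then have "\<exists>g. is_weak_div \<Omega> \<tau> g" by (simp add: Hdiv_def)
  then show ?thesis unfolding weak_div_def by (rule someI_ex)
qed

lemma square_sum_bound:
  fixes a x y :: real
  assumes "a \<le> x + y" "0 \<le> a"
  shows "a^2 \<le> 2 * x^2 + 2 * y^2"
proof -
  have "a^2 \<le> (x + y)^2" using assms by (intro power_mono)
  also have "\<dots> \<le> 2 * x^2 + 2 * y^2"
    using zero_le_power2[of "x - y"] by (simp add: power2_eq_square algebra_simps)
  finally show ?thesis .
qed

lemma efficiency_arithmetic:
  fixes E D G R1 R2 P L0 L1 Cx :: real
  assumes "R1 \<le> E + L1 * G" "R2 \<le> D + Cx * G" "L0 * P \<le> R1^2" "0 < L0" "0 \<le> R1" "0 \<le> R2"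
  shows "P + R2^2 \<le> (2 / L0 + 2 * L1^2 / L0 + 2 + 2 * Cx^2) * (E^2 + D^2 + G^2)"
proof -
  have "R1^2 \<le> 2 * E^2 + 2 * L1^2 * G^2" "R2^2 \<le> 2 * D^2 + 2 * Cx^2 * G^2"
    using square_sum_bound[OF assms(1,5)] square_sum_bound[OF assms(2,6)] by (simp_all add: power_mult_distrib)
  moreover have "P \<le> R1^2 / L0" using assms(3,4) by (simp add: field_simps)
  moreover have "R1^2 / L0 \<le> (2 * E^2 + 2 * L1^2 * G^2) / L0"
    using calculation(1) assms(4) by (intro divide_right_mono) auto
  moreover have "(2 * E^2 + 2 * L1^2 * G^2) / L0 = 2 / L0 * E^2 + 2 * L1^2 / L0 * G^2"
    by (simp add: add_divide_distrib)
  ultimately have "P + R2^2 \<le> 2 / L0 * E^2 + 2 * L1^2 / L0 * G^2 + 2 * D^2 + 2 * Cx^2 * G^2" by linarith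
  also have "\<dots> \<le> (2 / L0 + 2 * L1^2 / L0 + 2 + 2 * Cx^2) * (E^2 + D^2 + G^2)"
  proof -
    have "p * E^2 + q * G^2 + 2 * D^2 + r * G^2 \<le> (p + q + 2 + r) * (E^2 + D^2 + G^2)"
      if "0 \<le> p" "0 \<le> q" "0 \<le> r" for p q r :: real
    proof -
      have "0 \<le> p * (D^2 + G^2) + q * (E^2 + D^2) + 2 * (E^2 + G^2) + r * (E^2 + D^2)"
        by (intro add_nonneg_nonneg mult_nonneg_nonneg that) auto
      then show ?thesis by (simp add: algebra_simps)
    qed
    from this[of "2 / L0" "2 * L1^2 / L0" "2 * Cx^2"] show ?thesis using assms(4) by simp
  qed
  finally show ?thesis .
qed

lemma reliability_arithmetic:
  fixes E D G R1 R2 P L1 Cx K Cp :: real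
  assumes "E \<le> R1 + L1 * G" "D \<le> R2 + Cx * G" "G \<le> K * (R1 + Cp * R2)" "R1^2 \<le> L1 * P"
    and nn: "0 \<le> E" "0 \<le> D" "0 \<le> G" "0 \<le> P" "0 < L1"
  shows "E^2 + D^2 + G^2 \<le> (2 + (1 + 2 * L1^2 + 2 * Cx^2) * (2 * K^2 * (1 + Cp^2))) * (L1 + 1) * (P + R2^2)"
proof -
  define Q where "Q = 1 + 2 * L1^2 + 2 * Cx^2"
  have Q: "Q \<ge> 0" by (simp add: Q_def)
  have ED: "E^2 \<le> 2 * R1^2 + 2 * L1^2 * G^2" "D^2 \<le> 2 * R2^2 + 2 * Cx^2 * G^2"
    using square_sum_bound[OF assms(1) nn(1)] square_sum_bound[OF assms(2) nn(2)] by (simp_all add: power_mult_distrib)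
  have G: "G^2 \<le> 2 * K^2 * (1 + Cp^2) * (R1^2 + R2^2)"
  proof -
    have "G^2 \<le> 2 * (K * R1)^2 + 2 * (K * (Cp * R2))^2"
      by (rule square_sum_bound) (use assms(3) nn(3) in \<open>simp_all add: algebra_simps\<close>)
    also have "\<dots> = 2 * K^2 * (R1^2 + Cp^2 * R2^2)" by (simp add: power_mult_distrib algebra_simps)
    also have "\<dots> \<le> 2 * K^2 * ((1 + Cp^2) * (R1^2 + R2^2))"
      by (intro mult_left_mono) (auto simp: algebra_simps)
    finally show ?thesis by (simp add: mult.assoc)
  qed
  have "E^2 + D^2 + G^2 \<le> 2 * (R1^2 + R2^2) + Q * G^2" using ED by (simp add: Q_def algebra_simps)
  also have "\<dots> \<le> 2 * (R1^2 + R2^2) + Q * (2 * K^2 * (1 + Cp^2) * (R1^2 + R2^2))"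
    using G Q by (intro add_left_mono mult_left_mono)
  also have "\<dots> = (2 + Q * (2 * K^2 * (1 + Cp^2))) * (R1^2 + R2^2)" by (simp add: algebra_simps)
  also have "\<dots> \<le> (2 + Q * (2 * K^2 * (1 + Cp^2))) * ((L1 + 1) * (P + R2^2))"
  proof (rule mult_left_mono)
    have "0 \<le> P + L1 * R2^2" using nn by simp
    then show "R1^2 + R2^2 \<le> (L1 + 1) * (P + R2^2)" using assms(4) by (simp add: algebra_simps)
    show "0 \<le> 2 + Q * (2 * K^2 * (1 + Cp^2))" using Q by simp
  qed
  finally show ?thesis by (simp add: Q_def mult.assoc)
qed

context elliptic_problem
begin

text \<open>
  The weak formulation tested with test functions is the statement that the flux has the weak
  divergence \<open>f\<^sub>1 - Xu\<close>.
\<close>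

lemma flux_weak_div:
  assumes f1: "f1 \<in> L2 \<Omega>" and f2: "f2 \<in> L2 \<Omega>" and sol: "weak_solution \<Omega> A b c f1 f2 u"
  shows "flux \<Omega> A f2 u \<in> L2 \<Omega>" "is_weak_div \<Omega> (flux \<Omega> A f2 u) (\<lambda>x. f1 x - Xop \<Omega> b c u x)"
proof -
  have u: "u \<in> H10 \<Omega>" using sol by (simp add: weak_solution_def)
  note Af2 = A_L2(1)[OF f2] and Agu = A_L2(1)[OF H10_weak_grad_L2[OF u]] and Xu = Xop_L2(1)[OF u]
  show fl: "flux \<Omega> A f2 u \<in> L2 \<Omega>" unfolding flux_def[abs_def] by (rule L2_diff[OF Af2 Agu])
  show "is_weak_div \<Omega> (flux \<Omega> A f2 u) (\<lambda>x. f1 x - Xop \<Omega> b c u x)"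
    unfolding is_weak_div_def
  proof (intro conjI ballI)
    show "(\<lambda>x. f1 x - Xop \<Omega> b c u x) \<in> L2 \<Omega>" by (rule L2_diff[OF f1 Xu])
    fix \<phi> assume \<phi>: "\<phi> \<in> test_functions \<Omega>"
    have "L2_inner \<Omega> (\<lambda>x. A x *v weak_grad \<Omega> u x) (weak_grad \<Omega> \<phi>) + L2_inner \<Omega> (Xop \<Omega> b c u) \<phi>
        = L2_inner \<Omega> f1 \<phi> + L2_inner \<Omega> (\<lambda>x. A x *v f2 x) (weak_grad \<Omega> \<phi>)"
      using sol test_H10[OF \<phi>] by (simp add: weak_solution_def)
    moreover have "L2_inner \<Omega> h (weak_grad \<Omega> \<phi>) = L2_inner \<Omega> h (gradient \<phi>)" if "h \<in> L2 \<Omega>" for h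
      by (intro L2_inner_cong_AE that H10_weak_grad_L2 test_H10 test_gradient_L2 \<phi>
          weak_grad_AE[OF test_L2[OF \<phi>] test_weak_grad[OF \<phi>]]) simp
    ultimately have "L2_inner \<Omega> (\<lambda>x. A x *v weak_grad \<Omega> u x) (gradient \<phi>) + L2_inner \<Omega> (Xop \<Omega> b c u) \<phi>
        = L2_inner \<Omega> f1 \<phi> + L2_inner \<Omega> (\<lambda>x. A x *v f2 x) (gradient \<phi>)"
      using Af2 Agu by simp
    then show "L2_inner \<Omega> (flux \<Omega> A f2 u) (gradient \<phi>) = - L2_inner \<Omega> (\<lambda>x. f1 x - Xop \<Omega> b c u x) \<phi>"
      unfolding flux_def[abs_def]
      by (simp add: L2_inner_diff_left Af2 Agu f1 Xu test_L2[OF \<phi>] test_gradient_L2[OF \<phi>])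
  qed
qed

text \<open>
  By \<open>H10_divergence\<close> the terms with \<open>E\<close> and with its divergence \<open>g\<close> cancel, so \<open>e\<close> solves the weak
  problem with the functional \<open>v \<mapsto> (r\<^sub>1, \<nabla>v) + (r\<^sub>2, v)\<close> as right-hand side.
\<close>

lemma error_energy_bound:
  assumes K: "\<forall>w\<in>H10 \<Omega>. \<forall>S\<ge>0. (\<forall>v\<in>H10 \<Omega>. \<bar>bform w v\<bar> \<le> S * L2_norm \<Omega> (weak_grad \<Omega> v))
     \<longrightarrow> L2_norm \<Omega> (weak_grad \<Omega> w) \<le> K * S"
    and P: "\<And>v. v \<in> H10 \<Omega> \<Longrightarrow> L2_norm \<Omega> v \<le> P * L2_norm \<Omega> (weak_grad \<Omega> v)" "0 < P"
    and e: "e \<in> H10 \<Omega>" and E: "E \<in> L2 \<Omega>" "is_weak_div \<Omega> E g"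
  shows "L2_norm \<Omega> (weak_grad \<Omega> e) \<le> K * (L2_norm \<Omega> (\<lambda>x. E x + A x *v weak_grad \<Omega> e x)
     + P * L2_norm \<Omega> (\<lambda>x. g x + Xop \<Omega> b c e x))"
proof -
  let ?r1 = "\<lambda>x. E x + A x *v weak_grad \<Omega> e x" and ?r2 = "\<lambda>x. g x + Xop \<Omega> b c e x"
  have gL: "g \<in> L2 \<Omega>" using E by (simp add: is_weak_div_def)
  note Age = A_L2(1)[OF H10_weak_grad_L2[OF e]] and Xe = Xop_L2(1)[OF e]
  have r1: "?r1 \<in> L2 \<Omega>" by (rule L2_add[OF E(1) Age])
  have r2: "?r2 \<in> L2 \<Omega>" by (rule L2_add[OF gL Xe])
  have "\<bar>bform e v\<bar> \<le> (L2_norm \<Omega> ?r1 + P * L2_norm \<Omega> ?r2) * L2_norm \<Omega> (weak_grad \<Omega> v)" if v: "v \<in> H10 \<Omega>" for v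
  proof -
    note gv = H10_weak_grad_L2[OF v] and vL = H10_L2[OF v]
    have "L2_inner \<Omega> ?r1 (weak_grad \<Omega> v) + L2_inner \<Omega> ?r2 v = bform e v"
      using H10_divergence[OF E v] unfolding bform_def
      by (simp add: L2_inner_add_left E(1) Age gL Xe gv vL)
    moreover have "\<bar>L2_inner \<Omega> ?r1 (weak_grad \<Omega> v)\<bar> \<le> L2_norm \<Omega> ?r1 * L2_norm \<Omega> (weak_grad \<Omega> v)"
      by (rule L2_Cauchy_Schwarz[OF r1 gv])
    moreover have "\<bar>L2_inner \<Omega> ?r2 v\<bar> \<le> L2_norm \<Omega> ?r2 * L2_norm \<Omega> v"
      by (rule L2_Cauchy_Schwarz[OF r2 vL])
    moreover have "L2_norm \<Omega> ?r2 * L2_norm \<Omega> v \<le> L2_norm \<Omega> ?r2 * (P * L2_norm \<Omega> (weak_grad \<Omega> v))"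
      by (intro mult_left_mono P v L2_norm_nonneg)
    moreover have "(L2_norm \<Omega> ?r1 + P * L2_norm \<Omega> ?r2) * L2_norm \<Omega> (weak_grad \<Omega> v)
        = L2_norm \<Omega> ?r1 * L2_norm \<Omega> (weak_grad \<Omega> v) + L2_norm \<Omega> ?r2 * (P * L2_norm \<Omega> (weak_grad \<Omega> v))"
      by (simp add: algebra_simps)
    ultimately show ?thesis by linarith
  qed
  moreover have "0 \<le> L2_norm \<Omega> ?r1 + P * L2_norm \<Omega> ?r2"
    using P(2) by (intro add_nonneg_nonneg mult_nonneg_nonneg L2_norm_nonneg) auto
  ultimately show ?thesis using K e by blast
qed

text \<open>
  The number \<open>P\<close> is the squared norm of the weighted residual \<open>w = A\<^sup>-\<^sup>1\<^sup>/\<^sup>2z\<close>.  It is introduced as the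
  integral of \<open>y \<cdot> z\<close> with \<open>Ay = z\<close>, which is measurable by Cramer's rule.
\<close>

lemma estimator_sq:
  assumes mesh: "regular_mesh \<kappa> \<Omega> \<T>" and lip: "lipschitz_boundary \<Omega>"
    and \<sigma>h: "\<sigma>h \<in> L2 \<Omega>" and g: "g \<in> L2 \<Omega>" and f2: "f2 \<in> L2 \<Omega>" and g_eq: "g = weak_grad \<Omega> uh"
    and \<rho>: "(\<lambda>x. weak_div \<Omega> \<sigma>h x + Xop \<Omega> b c uh x - f1 x) \<in> L2 \<Omega>"
  obtains P where "P \<ge> 0"
    "(estimator \<Omega> \<T> A b c f1 f2 \<sigma>h uh)^2 = P + (L2_norm \<Omega> (\<lambda>x. weak_div \<Omega> \<sigma>h x + Xop \<Omega> b c uh x - f1 x))^2"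
    "\<Lambda>\<^sub>0 * P \<le> (L2_norm \<Omega> (\<lambda>x. \<sigma>h x + A x *v g x - A x *v f2 x))^2"
    "(L2_norm \<Omega> (\<lambda>x. \<sigma>h x + A x *v g x - A x *v f2 x))^2 \<le> \<Lambda>\<^sub>1 * P"
proof -
  define w where "w x = matrix_inv (mat_sqrt (A x)) *v \<sigma>h x + mat_sqrt (A x) *v g x - mat_sqrt (A x) *v f2 x" for x
  define z where "z x = \<sigma>h x + A x *v g x - A x *v f2 x" for x
  define r where "r x = weak_div \<Omega> \<sigma>h x + Xop \<Omega> b c uh x - f1 x" for x
  have zL: "z \<in> L2 \<Omega>" unfolding z_def by (intro L2_diff L2_add \<sigma>h A_L2(1) g f2)
  have rL: "r \<in> L2 \<Omega>" using \<rho> by (simp add: r_def[abs_def])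
  obtain y where y: "y \<in> borel_measurable (lebesgue_on \<Omega>)" "\<And>x. det (A x) \<noteq> 0 \<Longrightarrow> A x *v y x = z x"
    using borel_measurable_linear_solve[OF A_measurable L2_measurable[OF zL]] by metis
  have pointwise: "AE x in lebesgue_on \<Omega>. (norm (w x))^2 = y x \<bullet> z x \<and> 0 \<le> y x \<bullet> z x \<and>
      \<Lambda>\<^sub>0 * (y x \<bullet> z x) \<le> (norm (z x))^2 \<and> (norm (z x))^2 \<le> \<Lambda>\<^sub>1 * (y x \<bullet> z x)"
    using A_sym A_elliptic
  proof eventually_elim
    case (elim x)
    have ell: "\<Lambda>\<^sub>0 * (y \<bullet> y) \<le> y \<bullet> (A x *v y) \<and> y \<bullet> (A x *v y) \<le> \<Lambda>\<^sub>1 * (y \<bullet> y)" for y using elim(2) by blast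
    have "v = 0" if "A x *v v = 0" for v
    proof -
      have "\<Lambda>\<^sub>0 * (v \<bullet> v) \<le> 0" using ell[of v] that by simp
      then show ?thesis using Lam(1) inner_ge_zero[of v] by (simp add: mult_le_0_iff)
    qed
    then have "\<exists>B. B ** A x = mat 1" by (simp add: matrix_left_invertible_ker)
    then have "det (A x) \<noteq> 0" by (simp add: invertible_left_inverse flip: invertible_det_nz)
    note Ay = y(2)[OF this]
    note props = sqrt_weighted_residual[where s = "\<sigma>h x" and g = "g x" and f = "f2 x",
        OF elim(1) Lam(1) ell, folded w_def z_def]
    show ?case
      using props(1,2) zero_le_power2[of "norm (w x)"] unfolding props(3)[OF Ay] by blast
  qed
  have zz: "integrable (lebesgue_on \<Omega>) (\<lambda>x. (norm (z x))^2)" by (rule L2_integrable_sq[OF zL])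
  have h: "integrable (lebesgue_on \<Omega>) (\<lambda>x. y x \<bullet> z x)"
  proof (rule Bochner_Integration.integrable_bound)
    show "integrable (lebesgue_on \<Omega>) (\<lambda>x. (1 / \<Lambda>\<^sub>0) * (norm (z x))^2)" by (intro integrable_mult_right zz)
    show "(\<lambda>x. y x \<bullet> z x) \<in> borel_measurable (lebesgue_on \<Omega>)"
      by (intro borel_measurable_inner y L2_measurable zL)
    show "AE x in lebesgue_on \<Omega>. norm (y x \<bullet> z x) \<le> norm ((1 / \<Lambda>\<^sub>0) * (norm (z x))^2)"
      using pointwise
    proof eventually_elim
      case (elim x)
      have "\<Lambda>\<^sub>0 * (y x \<bullet> z x) \<le> (norm (z x))^2" "0 \<le> y x \<bullet> z x" using elim by blast+
      moreover from this(1) have "y x \<bullet> z x \<le> (1 / \<Lambda>\<^sub>0) * (norm (z x))^2"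
        using Lam(1) by (simp add: pos_le_divide_eq mult.commute)
      ultimately show ?case using Lam(1) by simp
    qed
  qed
  define P where "P = (LINT x|lebesgue_on \<Omega>. y x \<bullet> z x)"
  have "P \<ge> 0" unfolding P_def
    by (rule integral_nonneg_AE) (use pointwise in \<open>eventually_elim, blast\<close>)
  have Zsq: "(L2_norm \<Omega> z)^2 = (LINT x|lebesgue_on \<Omega>. (norm (z x))^2)"
    by (simp add: L2_norm_sq L2_inner_def power2_norm_eq_inner)
  have "\<Lambda>\<^sub>0 * P \<le> (L2_norm \<Omega> z)^2"
  proof -
    have "(LINT x|lebesgue_on \<Omega>. \<Lambda>\<^sub>0 * (y x \<bullet> z x)) \<le> (LINT x|lebesgue_on \<Omega>. (norm (z x))^2)"
      by (intro integral_mono_AE zz integrable_mult_right h) (use pointwise in \<open>eventually_elim, blast\<close>)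
    then show ?thesis by (simp add: Zsq P_def)
  qed
  moreover have "(L2_norm \<Omega> z)^2 \<le> \<Lambda>\<^sub>1 * P"
  proof -
    have "(LINT x|lebesgue_on \<Omega>. (norm (z x))^2) \<le> (LINT x|lebesgue_on \<Omega>. \<Lambda>\<^sub>1 * (y x \<bullet> z x))"
      by (intro integral_mono_AE zz integrable_mult_right h) (use pointwise in \<open>eventually_elim, blast\<close>)
    then show ?thesis by (simp add: Zsq P_def)
  qed
  moreover have "(estimator \<Omega> \<T> A b c f1 f2 \<sigma>h uh)^2 = P + (L2_norm \<Omega> r)^2"
  proof -
    have sq: "(L2_norm K f)^2 = (LINT x|lebesgue_on K. (norm (f x))^2)"
      for K :: "(real^'d) set" and f :: "real^'d \<Rightarrow> 'e::euclidean_space"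
      by (simp add: L2_norm_sq L2_inner_def power2_norm_eq_inner)
    have loc: "(local_estimator \<Omega> A b c f1 f2 \<sigma>h uh K)^2 = (LINT x|lebesgue_on K. (norm (w x))^2) + (LINT x|lebesgue_on K. (norm (r x))^2)" for K
      unfolding local_estimator_def sq[symmetric] by (simp add: w_def[abs_def] r_def[abs_def] g_eq)
    have "(estimator \<Omega> \<T> A b c f1 f2 \<sigma>h uh)^2 = (\<Sum>K\<in>\<T>. (local_estimator \<Omega> A b c f1 f2 \<sigma>h uh K)^2)"
      unfolding estimator_def by (rule real_sqrt_pow2) (intro sum_nonneg zero_le_power2)
    also have "\<dots> = (\<Sum>K\<in>\<T>. LINT x|lebesgue_on K. (norm (w x))^2) + (\<Sum>K\<in>\<T>. LINT x|lebesgue_on K. (norm (r x))^2)"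
      by (simp only: loc sum.distrib)
    also have "(\<Sum>K\<in>\<T>. LINT x|lebesgue_on K. (norm (w x))^2) = P"
      unfolding P_def by (rule mesh_integral[OF open_domain lip mesh h]) (use pointwise in \<open>eventually_elim, blast\<close>)
    also have "(\<Sum>K\<in>\<T>. LINT x|lebesgue_on K. (norm (r x))^2) = (LINT x|lebesgue_on \<Omega>. (norm (r x))^2)"
      by (rule mesh_integral[OF open_domain lip mesh L2_integrable_sq[OF rL]]) simp
    finally show ?thesis by (simp add: sq)
  qed
  ultimately show ?thesis
    using that[OF \<open>P \<ge> 0\<close>] by (simp add: z_def[abs_def] r_def[abs_def])
qed

end

theorem mainTheorem3:
  fixes \<Omega> :: "(real^'d) set"
    and A :: "real^'d \<Rightarrow> real^'d^'d"
    and b :: "real^'d \<Rightarrow> real^'d"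
    and c :: "real^'d \<Rightarrow> real"
    and \<Lambda>\<^sub>0 \<Lambda>\<^sub>1 :: real
    and k :: nat
  assumes "CARD('d) = 2 \<or> CARD('d) = 3"
    and "bounded \<Omega>" and "open \<Omega>" and "connected \<Omega>" and "lipschitz_boundary \<Omega>"
    and "A \<in> Linf \<Omega>" and "b \<in> Linf \<Omega>" and "c \<in> Linf \<Omega>"
    and "0 < \<Lambda>\<^sub>0" and "\<Lambda>\<^sub>0 \<le> \<Lambda>\<^sub>1"
    and "AE x in lebesgue_on \<Omega>. transpose (A x) = A x"
    and "AE x in lebesgue_on \<Omega>. \<forall>y. \<Lambda>\<^sub>0 * (y \<bullet> y) \<le> y \<bullet> (A x *v y) \<and>
                                      y \<bullet> (A x *v y) \<le> \<Lambda>\<^sub>1 * (y \<bullet> y)"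
    and "uniqueness \<Omega> A b c"
  shows "\<exists>C1>0. \<exists>C2>0. \<forall>\<kappa> \<T> f1 f2 u \<sigma>h uh.
    regular_mesh \<kappa> \<Omega> \<T> \<longrightarrow> f1 \<in> L2 \<Omega> \<longrightarrow> f2 \<in> L2 \<Omega> \<longrightarrow>
    weak_solution \<Omega> A b c f1 f2 u \<longrightarrow>
    least_squares_solution k \<Omega> \<T> A b c f1 f2 \<sigma>h uh \<longrightarrow>
    (let E = (\<lambda>x. flux \<Omega> A f2 u x - \<sigma>h x);
         e = (\<lambda>x. u x - uh x);
         err = (L2_norm \<Omega> E)^2 + (L2_norm \<Omega> (weak_div \<Omega> E))^2 + (L2_norm \<Omega> (weak_grad \<Omega> e))^2;
         \<eta> = estimator \<Omega> \<T> A b c f1 f2 \<sigma>h uh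
     in C1 * err \<le> \<eta>^2 \<and> \<eta>^2 \<le> C2 * err)"
proof -
  obtain Mb where Mb: "Mb \<ge> 0" "b \<in> borel_measurable (lebesgue_on \<Omega>)" "AE x in lebesgue_on \<Omega>. norm (b x) \<le> Mb"
    using Linf_bound[OF assms(7)] by blast
  obtain Mc where Mc: "Mc \<ge> 0" "c \<in> borel_measurable (lebesgue_on \<Omega>)" "AE x in lebesgue_on \<Omega>. norm (c x) \<le> Mc"
    using Linf_bound[OF assms(8)] by blast
  have Am: "A \<in> borel_measurable (lebesgue_on \<Omega>)" using assms(6) by (simp add: Linf_def)
  interpret elliptic_problem \<Omega> A b c \<Lambda>\<^sub>0 \<Lambda>\<^sub>1 Mb Mc
    by unfold_locales (rule assms Am Mb Mc)+
  obtain P where P: "P > 0" "\<And>v. v \<in> H10 \<Omega> \<Longrightarrow> L2_norm \<Omega> v \<le> P * L2_norm \<Omega> (weak_grad \<Omega> v)"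
    using H10_Poincare by blast
  obtain K where K: "\<forall>w\<in>H10 \<Omega>. \<forall>S\<ge>0. (\<forall>v\<in>H10 \<Omega>. \<bar>bform w v\<bar> \<le> S * L2_norm \<Omega> (weak_grad \<Omega> v))
     \<longrightarrow> L2_norm \<Omega> (weak_grad \<Omega> w) \<le> K * S"
    using stability[OF assms(13)] by blast
  define Cx where "Cx = Mb + Mc * P"
  define Q where "Q = (2 + (1 + 2 * \<Lambda>\<^sub>1^2 + 2 * Cx^2) * (2 * K^2 * (1 + P^2))) * (\<Lambda>\<^sub>1 + 1)"
  define C2 where "C2 = 2 / \<Lambda>\<^sub>0 + 2 * \<Lambda>\<^sub>1^2 / \<Lambda>\<^sub>0 + 2 + 2 * Cx^2"
  have L1: "\<Lambda>\<^sub>1 > 0" using Lam by linarith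
  have "2 + (1 + 2 * \<Lambda>\<^sub>1^2 + 2 * Cx^2) * (2 * K^2 * (1 + P^2)) > 0"
    by (intro add_pos_nonneg mult_nonneg_nonneg add_nonneg_nonneg) auto
  then have Qp: "Q > 0" unfolding Q_def using L1 by (intro mult_pos_pos) auto
  have C2p: "C2 > 0" unfolding C2_def using Lam(1) by (intro add_pos_nonneg add_nonneg_pos) auto
  have main: "err \<le> Q * \<eta>^2 \<and> \<eta>^2 \<le> C2 * err"
    if mesh: "regular_mesh \<kappa> \<Omega> \<T>" and f1: "f1 \<in> L2 \<Omega>" and f2: "f2 \<in> L2 \<Omega>"
      and sol: "weak_solution \<Omega> A b c f1 f2 u" and ls: "least_squares_solution k \<Omega> \<T> A b c f1 f2 \<sigma>h uh"
      and err: "err = (L2_norm \<Omega> (\<lambda>x. flux \<Omega> A f2 u x - \<sigma>h x))^2 + (L2_norm \<Omega> (weak_div \<Omega> (\<lambda>x. flux \<Omega> A f2 u x - \<sigma>h x)))^2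
        + (L2_norm \<Omega> (weak_grad \<Omega> (\<lambda>x. u x - uh x)))^2"
      and \<eta>: "\<eta> = estimator \<Omega> \<T> A b c f1 f2 \<sigma>h uh"
    for \<kappa> \<T> f1 f2 u \<sigma>h uh err \<eta>
  proof -
    define E where "E = (\<lambda>x. flux \<Omega> A f2 u x - \<sigma>h x)"
    define e where "e = (\<lambda>x. u x - uh x)"
    define g where "g = weak_div \<Omega> E"
    have u: "u \<in> H10 \<Omega>" using sol by (simp add: weak_solution_def)
    have uh: "uh \<in> H10 \<Omega>" using ls by (simp add: least_squares_solution_def S0_def)
    have \<sigma>hH: "\<sigma>h \<in> Hdiv \<Omega>" using ls by (simp add: least_squares_solution_def RT_def)
    then have \<sigma>hL: "\<sigma>h \<in> L2 \<Omega>" by (simp add: Hdiv_def)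
    note dh = Hdiv_weak_div[OF \<sigma>hH]
    then have dhL: "weak_div \<Omega> \<sigma>h \<in> L2 \<Omega>" by (simp add: is_weak_div_def)
    note fl = flux_weak_div[OF f1 f2 sol]
    have EL: "E \<in> L2 \<Omega>" unfolding E_def by (rule L2_diff[OF fl(1) \<sigma>hL])
    have Ediv: "is_weak_div \<Omega> E (\<lambda>x. (f1 x - Xop \<Omega> b c u x) - weak_div \<Omega> \<sigma>h x)"
      unfolding E_def by (rule is_weak_div_diff[OF fl \<sigma>hL dh])
    have "E \<in> Hdiv \<Omega>" using EL Ediv by (auto simp: Hdiv_def)
    from Hdiv_weak_div[OF this] have gdiv: "is_weak_div \<Omega> E g" unfolding g_def .
    then have gL: "g \<in> L2 \<Omega>" by (simp add: is_weak_div_def)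
    have g_eq: "AE x in lebesgue_on \<Omega>. g x = (f1 x - Xop \<Omega> b c u x) - weak_div \<Omega> \<sigma>h x"
      by (rule weak_div_unique[OF gdiv Ediv])
    have e: "e \<in> H10 \<Omega>" unfolding e_def by (rule H10_diff(1)[OF u uh])
    have ge: "AE x in lebesgue_on \<Omega>. weak_grad \<Omega> e x = weak_grad \<Omega> u x - weak_grad \<Omega> uh x"
      unfolding e_def by (rule H10_diff(2)[OF u uh])
    note geL = H10_weak_grad_L2[OF e] and guhL = H10_weak_grad_L2[OF uh]
    define r1 where "r1 = (\<lambda>x. E x + A x *v weak_grad \<Omega> e x)"
    define r2 where "r2 = (\<lambda>x. g x + Xop \<Omega> b c e x)"
    have r1L: "r1 \<in> L2 \<Omega>" and r2L: "r2 \<in> L2 \<Omega>"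
      unfolding r1_def r2_def by (intro L2_add EL gL A_L2(1) geL Xop_L2(1) e)+
    have \<rho>L: "(\<lambda>x. weak_div \<Omega> \<sigma>h x + Xop \<Omega> b c uh x - f1 x) \<in> L2 \<Omega>"
      by (intro L2_diff L2_add dhL Xop_L2(1) uh f1)
    have zL: "(\<lambda>x. \<sigma>h x + A x *v weak_grad \<Omega> uh x - A x *v f2 x) \<in> L2 \<Omega>"
      by (intro L2_diff L2_add \<sigma>hL A_L2(1) guhL f2)
    \<comment> \<open>The exact solution makes both residuals vanish, so the residuals are those of the error.\<close>
    have n1: "L2_norm \<Omega> (\<lambda>x. \<sigma>h x + A x *v weak_grad \<Omega> uh x - A x *v f2 x) = L2_norm \<Omega> r1"
    proof -
      have "L2_norm \<Omega> (\<lambda>x. \<sigma>h x + A x *v weak_grad \<Omega> uh x - A x *v f2 x) = L2_norm \<Omega> (\<lambda>x. - r1 x)"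
      proof (intro L2_norm_cong_AE zL L2_uminus r1L)
        show "AE x in lebesgue_on \<Omega>. \<sigma>h x + A x *v weak_grad \<Omega> uh x - A x *v f2 x = - r1 x"
          using ge by eventually_elim (simp add: r1_def E_def flux_def matrix_vector_mult_diff_distrib)
      qed
      then show ?thesis by (simp add: L2_norm_uminus)
    qed
    have n2: "L2_norm \<Omega> (\<lambda>x. weak_div \<Omega> \<sigma>h x + Xop \<Omega> b c uh x - f1 x) = L2_norm \<Omega> r2"
    proof -
      have "L2_norm \<Omega> (\<lambda>x. weak_div \<Omega> \<sigma>h x + Xop \<Omega> b c uh x - f1 x) = L2_norm \<Omega> (\<lambda>x. - r2 x)"
      proof (intro L2_norm_cong_AE \<rho>L L2_uminus r2L)
        show "AE x in lebesgue_on \<Omega>. weak_div \<Omega> \<sigma>h x + Xop \<Omega> b c uh x - f1 x = - r2 x"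
          using g_eq ge
        proof eventually_elim
          case (elim x)
          show ?case
            unfolding r2_def Xop_def elim inner_diff_right by (simp add: e_def algebra_simps)
        qed
      qed
      then show ?thesis by (simp add: L2_norm_uminus)
    qed
    obtain W where W: "W \<ge> 0" "\<eta>^2 = W + (L2_norm \<Omega> r2)^2"
      "\<Lambda>\<^sub>0 * W \<le> (L2_norm \<Omega> r1)^2" "(L2_norm \<Omega> r1)^2 \<le> \<Lambda>\<^sub>1 * W"
      using estimator_sq[OF mesh assms(5) \<sigma>hL guhL f2 refl \<rho>L] unfolding \<eta> n1 n2 by blast
    let ?G = "L2_norm \<Omega> (weak_grad \<Omega> e)"
    have XeB: "L2_norm \<Omega> (Xop \<Omega> b c e) \<le> Cx * ?G"
      using Xop_L2(2)[OF e] mult_left_mono[OF P(2)[OF e] Mc(1)] by (simp add: Cx_def algebra_simps)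
    note AeB = A_L2(2)[OF geL]
    have b1: "L2_norm \<Omega> r1 \<le> L2_norm \<Omega> E + \<Lambda>\<^sub>1 * ?G"
      using L2_norm_triangle[OF EL A_L2(1)[OF geL]] AeB unfolding r1_def by linarith
    have b2: "L2_norm \<Omega> r2 \<le> L2_norm \<Omega> g + Cx * ?G"
      using L2_norm_triangle[OF gL Xop_L2(1)[OF e]] XeB unfolding r2_def by linarith
    have b3: "L2_norm \<Omega> E \<le> L2_norm \<Omega> r1 + \<Lambda>\<^sub>1 * ?G"
      using L2_norm_triangle_diff[OF r1L A_L2(1)[OF geL]] AeB by (simp add: r1_def)
    have b4: "L2_norm \<Omega> g \<le> L2_norm \<Omega> r2 + Cx * ?G"
      using L2_norm_triangle_diff[OF r2L Xop_L2(1)[OF e]] XeB by (simp add: r2_def)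
    have b5: "?G \<le> K * (L2_norm \<Omega> r1 + P * L2_norm \<Omega> r2)"
      unfolding r1_def r2_def by (rule error_energy_bound[OF K P(2) P(1) e EL gdiv])
    have err': "err = (L2_norm \<Omega> E)^2 + (L2_norm \<Omega> g)^2 + ?G^2"
      unfolding err E_def e_def g_def ..
    show ?thesis
      unfolding err' W(2) Q_def C2_def
      using reliability_arithmetic[OF b3 b4 b5 W(4) L2_norm_nonneg L2_norm_nonneg L2_norm_nonneg W(1) L1]
        efficiency_arithmetic[OF b1 b2 W(3) Lam(1) L2_norm_nonneg L2_norm_nonneg] by blast
  qed
  show ?thesis
  proof (rule exI[of _ "1 / Q"], rule conjI, simp add: Qp,
      rule exI[of _ C2], rule conjI, rule C2p, intro allI impI)
    fix \<kappa> \<T> f1 f2 u \<sigma>h uh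
    assume *: "regular_mesh \<kappa> \<Omega> \<T>" "f1 \<in> L2 \<Omega>" "f2 \<in> L2 \<Omega>" "weak_solution \<Omega> A b c f1 f2 u"
      "least_squares_solution k \<Omega> \<T> A b c f1 f2 \<sigma>h uh"
    show "let E = (\<lambda>x. flux \<Omega> A f2 u x - \<sigma>h x);
         e = (\<lambda>x. u x - uh x);
         err = (L2_norm \<Omega> E)^2 + (L2_norm \<Omega> (weak_div \<Omega> E))^2 + (L2_norm \<Omega> (weak_grad \<Omega> e))^2;
         \<eta> = estimator \<Omega> \<T> A b c f1 f2 \<sigma>h uh
     in 1 / Q * err \<le> \<eta>^2 \<and> \<eta>^2 \<le> C2 * err"
      unfolding Let_def using main[OF * refl refl] Qp by (simp add: field_simps)
  qed
qed

end
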